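(* Let $-A$ be the generator of a $C_0$-semigroup $(T(t))_{t\ge0}$ on a Banach space $X$ with Fourier type $p\in[1,2]$ such that $\mathbb{C}_-\subseteq\rho(A)$. Suppose that there exists a nondecreasing $g:(0,\infty)\to(0,\infty)$ such that $$\|(\lambda+A)^{-1}\|_{\mathcal{L}(X)}\le g(\mathrm{Re}(\lambda)^{-1})\qquad(\lambda\in\mathbb{C}_+).$$ Then for each $\gamma\in(\frac1p-\frac1{p'},\infty)$ there exists a $C_\gamma\ge0$ such that $\|T(t)\|_{\mathcal{L}(X_\gamma,X)}\le C_\gamma(g(t)+1)$ for all $t>0$. For $p=2$ one may also let $\gamma=0$.
   Context: Banach spaces are nonzero and over $\mathbb{C}$; $\mathcal{L}(Y,X)$ denotes the bounded operators from $Y$ to $X$, $\mathcal{L}(X)=\mathcal{L}(X,X)$. $\mathbb{C}_+=\{\mathrm{Re}(\lambda)>0\}$, $\mathbb{C}_-=-\mathbb{C}_+$; $\rho(A)$ is the resolvent set. $p'$ is the Hölder conjugate of $p$. $X$ has Fourier type $p\in[1,2]$ if the Fourier transform is bounded from $L^p(\mathbb{R};X)$ into $L^{p'}(\mathbb{R};X)$. For $\gamma\in[0,\infty)$, $X_\gamma:=D((\omega+A)^\gamma)$ is the fractional domain with its graph norm, where $\omega$ is any fixed real number larger than the growth bound $\omega_0(T)$, so that $\omega+A$ is sectorial; up to equivalence of norms $X_\gamma$ does not depend on $\omega$. *)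

theory Defs
  imports "HOL-Analysis.Analysis" "HOL-Probability.Essential_Supremum"
begin

section \<open>Complex Banach spaces\<close>

class complex_normed_vector = real_normed_vector +
  fixes scaleC :: "complex \<Rightarrow> 'a \<Rightarrow> 'a"  (infixr \<open>*\<^sub>C\<close> 75)
  assumes scaleC_add_right: "c *\<^sub>C (x + y) = c *\<^sub>C x + c *\<^sub>C y"
    and scaleC_add_left: "(c + d) *\<^sub>C x = c *\<^sub>C x + d *\<^sub>C x"
    and scaleC_scaleC: "c *\<^sub>C (d *\<^sub>C x) = (c * d) *\<^sub>C x"
    and scaleC_one: "1 *\<^sub>C x = x"
    and scaleC_of_real: "complex_of_real r *\<^sub>C x = r *\<^sub>R x"
    and norm_scaleC: "norm (c *\<^sub>C x) = cmod c * norm x"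

class complex_banach = complex_normed_vector + banach

instantiation complex :: complex_banach
begin

definition scaleC_complex_def: "c *\<^sub>C (x :: complex) = c * x"

instance
  by standard (auto simp: scaleC_complex_def algebra_simps norm_mult scaleR_conv_of_real)

end

definition bounded_clinear :: "('a::complex_normed_vector \<Rightarrow> 'b::complex_normed_vector) \<Rightarrow> bool" where
  "bounded_clinear S \<longleftrightarrow> bounded_linear S \<and> (\<forall>c x. S (c *\<^sub>C x) = c *\<^sub>C S x)"

section \<open>Unbounded operators, represented by their graphs\<close>

type_synonym 'a operator = "('a \<times> 'a) set"

definition op_neg :: "'a::complex_normed_vector operator \<Rightarrow> 'a operator" where
  "op_neg A = {(x, - y) |x y. (x, y) \<in> A}"

text \<open>The operator \<open>\<mu> + A\<close>, with the same domain as \<open>A\<close>.\<close>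
definition op_shift :: "complex \<Rightarrow> 'a::complex_normed_vector operator \<Rightarrow> 'a operator" where
  "op_shift \<mu> A = {(x, \<mu> *\<^sub>C x + y) |x y. (x, y) \<in> A}"

text \<open>\<open>A\<close> is a bijection of its domain onto the whole space, and its inverse is bounded.\<close>
definition boundedly_invertible :: "'a::complex_normed_vector operator \<Rightarrow> bool" where
  "boundedly_invertible A \<longleftrightarrow>
     (\<exists>R. bounded_clinear R \<and> (\<forall>x y. (x, y) \<in> A \<longleftrightarrow> x = R y))"

definition op_inv :: "'a operator \<Rightarrow> 'a \<Rightarrow> 'a" where
  "op_inv A y = (THE x. (x, y) \<in> A)"

definition op_resolvent_set :: "'a::complex_normed_vector operator \<Rightarrow> complex set" where
  "op_resolvent_set A = {\<mu>. boundedly_invertible (op_shift \<mu> (op_neg A))}"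

definition graph_norm :: "'a::complex_normed_vector operator \<Rightarrow> 'a \<Rightarrow> real" where
  "graph_norm B x = norm x + norm (THE y. (x, y) \<in> B)"

text \<open>The (possibly infinite) norm of \<open>S\<close> as an operator from the domain of \<open>B\<close>, with its
  graph norm, to the ambient space.\<close>
definition graph_onorm :: "'a::complex_normed_vector operator \<Rightarrow> ('a \<Rightarrow> 'a) \<Rightarrow> ennreal" where
  "graph_onorm B S = (SUP x\<in>{x \<in> Domain B. graph_norm B x \<le> 1}. ennreal (norm (S x)))"

section \<open>Strongly continuous semigroups\<close>

text \<open>Only the values \<open>T t\<close> with \<open>t \<ge> 0\<close> are meaningful.\<close>
definition C0_semigroup :: "(real \<Rightarrow> 'a::complex_normed_vector \<Rightarrow> 'a) \<Rightarrow> bool" where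
  "C0_semigroup T \<longleftrightarrow>
     (\<forall>t\<ge>0. bounded_clinear (T t)) \<and>
     T 0 = id \<and>
     (\<forall>s\<ge>0. \<forall>t\<ge>0. T (s + t) = T s \<circ> T t) \<and>
     (\<forall>x. ((\<lambda>t. T t x) \<longlongrightarrow> x) (at_right 0))"

definition generator :: "(real \<Rightarrow> 'a::complex_normed_vector \<Rightarrow> 'a) \<Rightarrow> 'a operator" where
  "generator T = {(x, y). ((\<lambda>t. (1 / t) *\<^sub>R (T t x - x)) \<longlongrightarrow> y) (at_right 0)}"

definition growth_bound :: "(real \<Rightarrow> 'a::complex_normed_vector \<Rightarrow> 'a) \<Rightarrow> ereal" where
  "growth_bound T = (INF w\<in>{w. \<exists>M. \<forall>t\<ge>0. onorm (T t) \<le> M * exp (w * t)}. ereal w)"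

section \<open>Fractional powers\<close>

text \<open>For a sectorial operator \<open>B\<close> with bounded inverse and \<open>0 < \<theta> < 1\<close>, Balakrishnan's formula
    \<open>B\<^sup>-\<^sup>\<theta> x = sin (\<pi> \<theta>) / \<pi> \<integral>\<^sub>0\<^sup>\<infinity> s\<^sup>-\<^sup>\<theta> (s + B)\<^sup>-\<^sup>1 x ds\<close>
  defines a bounded injective operator; for \<open>\<gamma> = n + \<theta>\<close> one puts \<open>B\<^sup>-\<^sup>\<gamma> = B\<^sup>-\<^sup>n B\<^sup>-\<^sup>\<theta>\<close> and defines
  \<open>B\<^sup>\<gamma>\<close>, with domain the range of \<open>B\<^sup>-\<^sup>\<gamma>\<close>, as the inverse of \<open>B\<^sup>-\<^sup>\<gamma>\<close>. The integrand is continuous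
  and absolutely integrable, so the Henstock-Kurzweil integral is the Bochner integral. (The
  library's Bochner integral is restricted to separable spaces.)\<close>
definition balakrishnan :: "'a::complex_normed_vector operator \<Rightarrow> real \<Rightarrow> 'a \<Rightarrow> 'a" where
  "balakrishnan B \<theta> x =
     (if \<theta> = 0 then x
      else (sin (pi * \<theta>) / pi) *\<^sub>R
        integral {0<..} (\<lambda>s. (s powr (- \<theta>)) *\<^sub>R op_inv (op_shift (complex_of_real s) B) x))"

definition neg_power :: "'a::complex_normed_vector operator \<Rightarrow> real \<Rightarrow> 'a \<Rightarrow> 'a" where
  "neg_power B \<gamma> x = (op_inv B ^^ nat \<lfloor>\<gamma>\<rfloor>) (balakrishnan B (frac \<gamma>) x)"

definition frac_power :: "'a::complex_normed_vector operator \<Rightarrow> real \<Rightarrow> 'a operator" where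
  "frac_power B \<gamma> = {(x, y). x = neg_power B \<gamma> y}"

section \<open>Fourier type\<close>

definition hoelder_conj :: "real \<Rightarrow> ereal" where
  "hoelder_conj p = (if p = 1 then \<infinity> else ereal (p / (p - 1)))"

definition strongly_measurable :: "(real \<Rightarrow> 'a::real_normed_vector) \<Rightarrow> bool" where
  "strongly_measurable f \<longleftrightarrow>
     (\<exists>s. (\<forall>i. simple_function lborel (s i)) \<and> (\<forall>t. (\<lambda>i::nat. s i t) \<longlonglongrightarrow> f t))"

text \<open>Functions are not identified almost everywhere. Every element of \<open>L\<^sup>q\<close> has a representative
  that is a pointwise limit of Borel simple functions.\<close>
definition Lq_space :: "ereal \<Rightarrow> (real \<Rightarrow> 'a::real_normed_vector) set" where
  "Lq_space q = {f. strongly_measurable f \<and>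
     (if q = \<infinity> then esssup lborel (\<lambda>t. ereal (norm (f t))) < \<infinity>
      else integrable lborel (\<lambda>t. norm (f t) powr real_of_ereal q))}"

definition Lq_norm :: "ereal \<Rightarrow> (real \<Rightarrow> 'a::real_normed_vector) \<Rightarrow> real" where
  "Lq_norm q f =
     (if q = \<infinity> then real_of_ereal (esssup lborel (\<lambda>t. ereal (norm (f t))))
      else (\<integral>t. norm (f t) powr real_of_ereal q \<partial>lborel) powr (1 / real_of_ereal q))"

text \<open>Only used for \<open>f \<in> L\<^sup>1\<close>, where the Henstock-Kurzweil integral is the Bochner integral.\<close>
definition fourier_transform :: "(real \<Rightarrow> 'a::complex_normed_vector) \<Rightarrow> real \<Rightarrow> 'a" where
  "fourier_transform f \<xi> = integral UNIV (\<lambda>t. cis (- (\<xi> * t)) *\<^sub>C f t)"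

text \<open>Boundedness of the Fourier transform from \<open>L\<^sup>p\<close> to \<open>L\<^sup>p\<^sup>'\<close> means boundedness on the dense
  subspace \<open>L\<^sup>1 \<inter> L\<^sup>p\<close>, where it is given by the integral. The type argument carries the space.\<close>
definition has_fourier_type :: "'a::complex_banach itself \<Rightarrow> real \<Rightarrow> bool" where
  "has_fourier_type _ p \<longleftrightarrow>
     (\<exists>C. \<forall>f \<in> (Lq_space 1 \<inter> Lq_space (ereal p) :: (real \<Rightarrow> 'a) set).
        fourier_transform f \<in> Lq_space (hoelder_conj p) \<and>
        Lq_norm (hoelder_conj p) (fourier_transform f) \<le> C * Lq_norm (ereal p) f)"

end

theory Submission
  imports Defs "HOL-Probability.Probability" "HOL-Complex_Analysis.Complex_Analysis"
begin

text \<open>Write \<open>B = \<omega> + A\<close> and \<open>R z = (z + A)\<^sup>-\<^sup>1\<close>, and let \<open>norm (T t) \<le> M * exp (w * t)\<close> with \<open>0 \<le> w < \<omega>\<close>. (If \<open>\<omega> \<le> 0\<close>,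
the semigroup is bounded and there is nothing to prove.)

The orbit of \<open>x\<close> cannot grow quickly: for \<open>s\<close> in \<open>{t - 1..t}\<close> one has \<open>norm (T t x) \<le> M * exp w * norm (T s x)\<close>.
Hence \<open>norm (T t x)\<close> is bounded by an \<open>L\<^sup>q\<close> norm of the orbit over this interval, for any \<open>q\<close>. Put \<open>a = 1 / t\<close>,
so that the weight \<open>exp (- a s)\<close> is at least \<open>exp (- 1)\<close> there, and let the ramp \<open>\<chi>\<close> rise smoothly from 0 at 0 to
a constant on \<open>{1..}\<close>. Since \<open>\<chi>(s) T(s) x\<close> solves \<open>u' + A u = \<chi>' T(\<cdot>) x\<close> with \<open>u(0) = 0\<close>, the function
\<open>exp (- a s) \<chi>(s) T(s) x\<close> has Fourier transform \<open>R(a + i\<xi>) \<Psi>(a + i\<xi>) x\<close>, where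
\<open>\<Psi>(z) x = \<integral>\<^sub>0\<^sup>1 exp (- z s) \<chi>'(s) T(s) x ds\<close> sees only a compact piece of the orbit. Fourier type \<open>p\<close>, applied to this
product, bounds the \<open>L\<^sup>p\<^sup>'\<close> norm of the weighted orbit by its \<open>L\<^sup>p\<close> norm, and the resolvent contributes exactly one
factor \<open>g(1 / a) = g(t)\<close>.

It remains to bound \<open>\<Psi>(a + i\<xi>) x\<close> in \<open>L\<^sup>p\<close>, uniformly in small \<open>a\<close>, for \<open>x = B\<^sup>-\<^sup>\<gamma> y\<close>. Fourier type, used a second
time, puts \<open>\<Psi>(a + i\<xi>) y\<close> in \<open>L\<^sup>p\<^sup>'\<close>. An integration by parts turns \<open>B\<^sup>-\<^sup>\<gamma>\<close> into the factor \<open>(1 + \<bar>\<xi>\<bar>)\<^sup>-\<^sup>\<gamma>\<close>, at the price of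
replacing \<open>\<chi>'\<close> by its derivatives (\<open>lap_res_power_decay\<close>), and this factor brings \<open>L\<^sup>p\<^sup>'\<close> into \<open>L\<^sup>p\<close> as soon as
\<open>\<gamma> > 1 / p - 1 / p'\<close> (\<open>weighted_Lq_imp_Lp\<close>); for \<open>p = 2\<close> no factor is needed. The estimate is
\<open>smooth_estimate\<close>.

The number \<open>a\<close> may lie below the growth bound, where the Laplace integral of the orbit diverges, so the identification
of the transform needs an argument (\<open>inversion_formula\<close>). For \<open>x\<close> in the domain of \<open>B\<^sup>2\<close> the product above decays
quadratically, the line \<open>Re z = a\<close> can be moved to a line \<open>Re z = b\<close> with \<open>w < b < \<omega>\<close>, and there the classical
inversion theorem applies. The identity is one between vectors of a possibly nonseparable space; it is tested against
bounded functionals, of which there are enough by the Hahn-Banach theorem (\<open>eq_zero_of_functionals\<close>). Density of the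
domain of \<open>B\<^sup>2\<close> gives all other \<open>x\<close>.

Finally, the graph norm of \<open>B\<^sup>\<gamma>\<close> controls \<open>y\<close> only if \<open>B\<^sup>-\<^sup>\<gamma>\<close> is injective. If \<open>B\<^sup>-\<^sup>\<gamma> y = 0\<close> with \<open>0 < \<gamma> < 1\<close>, the same holds
for every \<open>T t y\<close>; this is a homogeneous Abel integral equation for the orbit, whose only solution is zero
(\<open>frac_int_injective\<close>).\<close>

section \<open>Separating functionals\<close>

definition sublinear :: "('a::real_normed_vector \<Rightarrow> real) \<Rightarrow> bool" where
  "sublinear q \<longleftrightarrow> (\<forall>x y. q (x + y) \<le> q x + q y) \<and> (\<forall>t\<ge>0. \<forall>x. q (t *\<^sub>R x) = t * q x)"

text \<open>If \<open>q\<close> is sublinear, this is the largest sublinear minorant of \<open>q\<close> that is \<open>- q y\<close> at \<open>- y\<close>. It serves both to make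
a minimal \<open>q\<close> linear and to prescribe the value of a functional at a point.\<close>
definition tilt :: "('a::real_normed_vector \<Rightarrow> real) \<Rightarrow> 'a \<Rightarrow> 'a \<Rightarrow> real" where
  "tilt q y x = (INF t\<in>{0..}. q (x + t *\<^sub>R y) - t * q y)"

lemma sublinear_zero: "sublinear q \<Longrightarrow> q 0 = 0"
  unfolding sublinear_def by (metis mult_zero_left order_refl scaleR_zero_left)

lemma sublinear_ge_minus: "sublinear q \<Longrightarrow> - q (- x) \<le> q x"
  using sublinear_zero[of q] unfolding sublinear_def
  by (metis add.commute add.right_inverse le_minus_iff minus_le_iff neg_le_iff_le add_le_cancel_left ab_left_minus minus_add_cancel diff_le_eq diff_0 )

lemma sublinear_of_homogeneous_le:
  assumes add: "\<And>x y. q (x + y) \<le> q x + q y"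
    and hom: "\<And>t x. 0 < t \<Longrightarrow> q (t *\<^sub>R x) \<le> t * q x" and zero: "q 0 = 0"
  shows "sublinear q"
proof -
  have "q (t *\<^sub>R x) = t * q x" if "0 \<le> t" for t x
  proof (cases "t = 0")
    case False
    then have t: "0 < t" using that by simp
    have "q x \<le> inverse t * q (t *\<^sub>R x)"
      using hom[of "inverse t" "t *\<^sub>R x"] t by simp
    then have "t * q x \<le> q (t *\<^sub>R x)" using t by (simp add: field_simps)
    then show ?thesis using hom[OF t, of x] by simp
  qed (simp add: zero)
  then show ?thesis using add unfolding sublinear_def by blast
qed

lemma tilt_bdd:
  assumes "sublinear q"
  shows "bdd_below ((\<lambda>t. q (x + t *\<^sub>R y) - t * q y) ` {0..})"
proof (rule bdd_belowI2)
  fix t :: real assume "t \<in> {0..}"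
  then have "t * q y = q (t *\<^sub>R y)" using assms by (simp add: sublinear_def)
  also have "\<dots> = q ((x + t *\<^sub>R y) + (- x))" by simp
  also have "\<dots> \<le> q (x + t *\<^sub>R y) + q (- x)" using assms unfolding sublinear_def by blast
  finally show "- q (- x) \<le> q (x + t *\<^sub>R y) - t * q y" by simp
qed

lemma tilt_le:
  assumes "sublinear q" "0 \<le> t"
  shows "tilt q y x \<le> q (x + t *\<^sub>R y) - t * q y"
  unfolding tilt_def by (rule cINF_lower[OF tilt_bdd[OF assms(1)]]) (use assms(2) in simp)

lemma le_tilt: "(\<And>t. 0 \<le> t \<Longrightarrow> c \<le> q (x + t *\<^sub>R y) - t * q y) \<Longrightarrow> c \<le> tilt q y x"
  unfolding tilt_def by (rule cINF_greatest) auto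

lemma sublinear_tilt:
  assumes q: "sublinear q"
  shows "sublinear (tilt q y)"
proof (rule sublinear_of_homogeneous_le)
  have qadd: "\<And>x y. q (x + y) \<le> q x + q y" and qhom: "\<And>t x. t \<ge> 0 \<Longrightarrow> q (t *\<^sub>R x) = t * q x"
    using q unfolding sublinear_def by auto
  show "tilt q y (x + x') \<le> tilt q y x + tilt q y x'" for x x'
  proof -
    have "tilt q y (x + x') - (q (x + s *\<^sub>R y) - s * q y) \<le> q (x' + t *\<^sub>R y) - t * q y"
      if "0 \<le> s" "0 \<le> t" for s t
      using tilt_le[OF q, of "s + t" y "x + x'"] qadd[of "x + s *\<^sub>R y" "x' + t *\<^sub>R y"] that
      by (simp add: algebra_simps)
    then have "tilt q y (x + x') - (q (x + s *\<^sub>R y) - s * q y) \<le> tilt q y x'" if "0 \<le> s" for s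
      using that by (intro le_tilt) auto
    then have "tilt q y (x + x') - tilt q y x' \<le> q (x + s *\<^sub>R y) - s * q y" if "0 \<le> s" for s
      using that by fastforce
    then have "tilt q y (x + x') - tilt q y x' \<le> tilt q y x" by (intro le_tilt)
    then show ?thesis by simp
  qed
  show "tilt q y (c *\<^sub>R x) \<le> c * tilt q y x" if c: "0 < c" for c x
  proof -
    have "tilt q y (c *\<^sub>R x) / c \<le> q (x + t *\<^sub>R y) - t * q y" if "0 \<le> t" for t
    proof -
      have "q (c *\<^sub>R x + (c * t) *\<^sub>R y) = c * q (x + t *\<^sub>R y)"
        using qhom[of c "x + t *\<^sub>R y"] c by (simp add: algebra_simps)
      then show ?thesis using tilt_le[OF q, of "c * t" y "c *\<^sub>R x"] c that
        by (simp add: field_simps)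
    qed
    then have "tilt q y (c *\<^sub>R x) / c \<le> tilt q y x" by (rule le_tilt)
    then show ?thesis using c by (simp add: field_simps)
  qed
  show "tilt q y 0 = 0"
  proof (rule antisym)
    show "tilt q y 0 \<le> 0" using tilt_le[OF q, of 0 y 0] sublinear_zero[OF q] by simp
    show "0 \<le> tilt q y 0" by (rule le_tilt) (simp add: qhom)
  qed
qed

text \<open>A minimal \<open>q\<close> equals each of its tilts, and \<open>tilt q y = q\<close> says \<open>q x + q y \<le> q (x + y)\<close>.\<close>
lemma linear_of_minimal_sublinear:
  assumes q: "sublinear q" and min: "\<And>r. sublinear r \<Longrightarrow> (\<And>x. r x \<le> q x) \<Longrightarrow> r = q"
  shows "linear q"
proof -
  have tilt: "tilt q y = q" for y
    by (rule min[OF sublinear_tilt[OF q]]) (use tilt_le[OF q, of 0] in simp)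
  have add: "q (x + y) = q x + q y" for x y
  proof (rule antisym)
    show "q (x + y) \<le> q x + q y" using q unfolding sublinear_def by blast
    show "q x + q y \<le> q (x + y)" using tilt_le[OF q, of 1 y x] tilt by simp
  qed
  have neg: "q (- x) = - q x" for x using add[of x "- x"] sublinear_zero[OF q] by simp
  have "q (t *\<^sub>R x) = t * q x" for t x
  proof (cases "0 \<le> t")
    case False
    then have "q ((- t) *\<^sub>R x) = - t * q x" using q unfolding sublinear_def by (meson le_cases neg_0_le_iff_le)
    then show ?thesis using neg[of "t *\<^sub>R x"] by simp
  qed (use q in \<open>simp add: sublinear_def\<close>)
  then show ?thesis using add by (simp add: linear_iff)
qed

text \<open>Zorn's lemma: the pointwise infimum of a chain of sublinear functionals is sublinear, and it is finite because every
member \<open>q\<close> of the chain satisfies \<open>- p (- x) \<le> q x\<close>.\<close>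
lemma minimal_sublinear_exists:
  assumes p: "sublinear p"
  obtains q where "sublinear q" "\<And>x. q x \<le> p x" "\<And>r. sublinear r \<Longrightarrow> (\<And>x. r x \<le> q x) \<Longrightarrow> r = q"
proof -
  define S where "S = {q. sublinear q \<and> (\<forall>x. q x \<le> p x)}"
  have "\<exists>m\<in>S. \<forall>a\<in>S. a \<le> m \<longrightarrow> a = m"
  proof (rule predicate_Zorn)
    show "partial_order_on S (relation_of (\<lambda>f g. g \<le> f) S)"
      by (rule partial_order_on_relation_ofI) auto
    fix C assume C: "C \<in> Chains (relation_of (\<lambda>f g. g \<le> f) S)"
    then have CS: "C \<subseteq> S" and tot: "\<And>f g. f \<in> C \<Longrightarrow> g \<in> C \<Longrightarrow> f \<le> g \<or> g \<le> f"
      unfolding Chains_def relation_of_def by auto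
    show "\<exists>u\<in>S. \<forall>a\<in>C. u \<le> a"
    proof (cases "C = {}")
      case True
      then show ?thesis using p by (auto simp: S_def)
    next
      case False
      define m where "m x = (INF q\<in>C. q x)" for x
      have bdd: "bdd_below ((\<lambda>q. q x) ` C)" for x
      proof (rule bdd_belowI2)
        fix q assume "q \<in> C"
        then have "sublinear q" "q (- x) \<le> p (- x)" using CS by (auto simp: S_def)
        then show "- p (- x) \<le> q x" using sublinear_ge_minus[of q x] by simp
      qed
      have m_le: "m x \<le> q x" if "q \<in> C" for q x
        unfolding m_def by (rule cINF_lower[OF bdd that])
      have le_m: "c \<le> m x" if "\<And>q. q \<in> C \<Longrightarrow> c \<le> q x" for c x
        unfolding m_def by (rule cINF_greatest[OF False that])
      have sub: "sublinear q" if "q \<in> C" for q using that CS by (auto simp: S_def)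
      have "sublinear m"
      proof (rule sublinear_of_homogeneous_le)
        show "m (x + y) \<le> m x + m y" for x y
        proof -
          have "m (x + y) - q x \<le> r y" if qr: "q \<in> C" "r \<in> C" for q r
          proof -
            obtain s where s: "s \<in> C" "s \<le> q" "s \<le> r" using tot[OF qr] qr by blast
            have "m (x + y) \<le> s (x + y)" by (rule m_le[OF s(1)])
            also have "\<dots> \<le> s x + s y" using sub[OF s(1)] unfolding sublinear_def by blast
            also have "\<dots> \<le> q x + r y" using s by (auto simp: le_fun_def intro: add_mono)
            finally show ?thesis by simp
          qed
          then have "m (x + y) - q x \<le> m y" if "q \<in> C" for q using that by (intro le_m)
          then have "m (x + y) - m y \<le> m x" by (intro le_m) fastforce
          then show ?thesis by simp
        qed
        show "m (t *\<^sub>R x) \<le> t * m x" if t: "0 < t" for t x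
        proof -
          have "m (t *\<^sub>R x) / t \<le> m x"
          proof (rule le_m)
            fix q assume q: "q \<in> C"
            have "q (t *\<^sub>R x) = t * q x" using sub[OF q] t unfolding sublinear_def by simp
            then show "m (t *\<^sub>R x) / t \<le> q x" using m_le[OF q, of "t *\<^sub>R x"] t by (simp add: field_simps)
          qed
          then show ?thesis using t by (simp add: field_simps)
        qed
        have "(\<lambda>q. q 0) ` C = {0}" using False sub sublinear_zero by fastforce
        then show "m 0 = 0" by (simp add: m_def)
      qed
      moreover have "m x \<le> p x" for x
      proof -
        obtain q where "q \<in> C" using False by blast
        then have "m x \<le> q x" "q x \<le> p x" using m_le[of q x] CS by (auto simp: S_def)
        then show ?thesis by simp
      qed
      ultimately show ?thesis using m_le by (intro bexI[of _ m]) (auto simp: S_def le_fun_def)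
    qed
  qed
  then obtain q where q: "q \<in> S" and min: "\<And>a. a \<in> S \<Longrightarrow> a \<le> q \<Longrightarrow> a = q" by blast
  show ?thesis
  proof (rule that)
    show "sublinear q" "q x \<le> p x" for x using q by (auto simp: S_def)
    show "r = q" if "sublinear r" "\<And>x. r x \<le> q x" for r
    proof (rule min)
      show "r \<in> S" using that q by (auto simp: S_def intro: order_trans)
      show "r \<le> q" using that by (simp add: le_fun_def)
    qed
  qed
qed

text \<open>A minimal sublinear functional below the norm tilted along \<open>v\<close> is linear, is dominated by the norm, and is at most
\<open>- norm v\<close> at \<open>- v\<close>.\<close>
lemma separating_real_functional:
  fixes v :: "'a::real_normed_vector"
  obtains \<psi> :: "'a \<Rightarrow> real" where "bounded_linear \<psi>" "norm v \<le> \<psi> v"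
proof -
  have n: "sublinear (norm :: 'a \<Rightarrow> real)" by (simp add: sublinear_def norm_triangle_ineq)
  obtain q where q: "sublinear q" and le: "\<And>x. q x \<le> tilt norm v x"
    and min: "\<And>r. sublinear r \<Longrightarrow> (\<And>x. r x \<le> q x) \<Longrightarrow> r = q"
    using minimal_sublinear_exists[OF sublinear_tilt[OF n, of v]] by blast
  have lin: "linear q" by (rule linear_of_minimal_sublinear[OF q min])
  have q_le: "q x \<le> norm x" for x using le[of x] tilt_le[OF n, of 0 v x] by simp
  have "bounded_linear q"
  proof (rule bounded_linear_intro[of _ 1])
    show "norm (q x) \<le> norm x * 1" for x
      using q_le[of x] q_le[of "- x"] linear_neg[OF lin, of x] by (simp add: abs_le_iff)
  qed (use lin in \<open>simp_all add: linear_iff\<close>)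
  moreover have "norm v \<le> q v"
    using le[of "- v"] tilt_le[OF n, of 1 v "- v"] linear_neg[OF lin, of v] by simp
  ultimately show ?thesis using that by blast
qed

text \<open>A real functional \<open>\<psi>\<close> is the real part of the complex functional \<open>\<psi> x - \<i> \<psi> (\<i> x)\<close>.\<close>
lemma eq_zero_of_functionals:
  fixes v :: "'a::complex_normed_vector"
  assumes "\<And>\<phi>::'a \<Rightarrow> complex. bounded_clinear \<phi> \<Longrightarrow> \<phi> v = 0"
  shows "v = 0"
proof (rule ccontr)
  assume "v \<noteq> 0"
  obtain \<psi> :: "'a \<Rightarrow> real" where \<psi>: "bounded_linear \<psi>" "norm v \<le> \<psi> v"
    using separating_real_functional .
  interpret bounded_linear \<psi> by fact
  have I: "bounded_linear (\<lambda>x::'a. \<i> *\<^sub>C x)"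
    by (rule bounded_linear_intro[of _ 1])
      (simp_all add: scaleC_add_right norm_scaleC scaleC_scaleC mult.commute flip: scaleC_of_real)
  define \<phi> where "\<phi> x = complex_of_real (\<psi> x) - \<i> * complex_of_real (\<psi> (\<i> *\<^sub>C x))" for x
  have "bounded_linear \<phi>"
    unfolding \<phi>_def
    by (intro bounded_linear_sub bounded_linear_const_mult bounded_linear_compose[OF bounded_linear_of_real]
        bounded_linear_compose[OF \<psi>(1) I] \<psi>(1))
  moreover have "\<phi> (c *\<^sub>C x) = c *\<^sub>C \<phi> x" for c x
  proof -
    have *: "c *\<^sub>C y = Re c *\<^sub>R y + Im c *\<^sub>R (\<i> *\<^sub>C y)" for y :: 'a
    proof -
      have "c *\<^sub>C y = (of_real (Re c) + of_real (Im c) * \<i>) *\<^sub>C y"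
        using complex_eq[of c] by (simp add: mult.commute)
      then show ?thesis by (simp add: scaleC_add_left scaleC_of_real flip: scaleC_scaleC)
    qed
    have ii: "\<i> *\<^sub>C (\<i> *\<^sub>C x) = - x"
      using scaleC_of_real[of "-1" x] by (simp add: scaleC_scaleC)
    have "\<psi> (c *\<^sub>C x) = Re c * \<psi> x + Im c * \<psi> (\<i> *\<^sub>C x)"
      by (simp add: *[of x] add scaleR)
    moreover have "\<psi> (\<i> *\<^sub>C (c *\<^sub>C x)) = Re c * \<psi> (\<i> *\<^sub>C x) - Im c * \<psi> x"
    proof -
      have "\<i> *\<^sub>C (c *\<^sub>C x) = c *\<^sub>C (\<i> *\<^sub>C x)" by (simp add: scaleC_scaleC mult.commute)
      then show ?thesis by (simp add: *[of "\<i> *\<^sub>C x"] ii add scaleR diff neg)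
    qed
    ultimately show ?thesis
      by (simp add: \<phi>_def scaleC_complex_def complex_eq_iff algebra_simps)
  qed
  ultimately have "\<phi> v = 0" using assms by (simp add: bounded_clinear_def)
  then have "Re (\<phi> v) = 0" by simp
  then have "\<psi> v = 0" by (simp add: \<phi>_def)
  then show False using \<psi>(2) \<open>v \<noteq> 0\<close> by simp
qed

section \<open>Fourier inversion and vertical contour shifts\<close>

lemma lborel_integral_affine:
  fixes f :: "real \<Rightarrow> 'a::{banach, second_countable_topology}"
  shows "c \<noteq> 0 \<Longrightarrow> (\<integral>x. f (t + c * x) \<partial>lborel) = (1 / \<bar>c\<bar>) *\<^sub>R (\<integral>x. f x \<partial>lborel)"
  using lborel_integral_real_affine[of c f t] by simp

text \<open>A rescaling of the characteristic function of the standard normal distribution, which is itself a Gaussian.\<close>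
lemma fourier_gaussian:
  fixes u e :: real
  assumes "0 < e"
  shows "(\<integral>x. cis (x * u) * complex_of_real (sqrt (2 * pi) * std_normal_density (e * x)) \<partial>lborel)
    = complex_of_real ((2 * pi / e) * std_normal_density (u / e))"
proof -
  have "exp (- ((u / e)\<^sup>2) / 2) = (\<integral>x. cis (u / e * x) * complex_of_real (std_normal_density x) \<partial>lborel)"
    using fun_cong[OF char_std_normal_distribution, of "u / e"]
    unfolding char_def
    by (subst (asm) integral_density) (auto simp: scaleR_conv_of_real cis_conv_exp ac_simps)
  also have "\<dots> = complex_of_real e * (\<integral>x. cis (x * u) * complex_of_real (std_normal_density (e * x)) \<partial>lborel)"
    using lborel_integral_affine[of e "\<lambda>x. cis (u / e * x) * complex_of_real (std_normal_density x)" 0] assms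
    by (simp add: scaleR_conv_of_real field_simps)
  finally have *: "(\<integral>x. cis (x * u) * complex_of_real (std_normal_density (e * x)) \<partial>lborel) = complex_of_real (exp (- ((u / e)\<^sup>2) / 2)) / e"
    using assms by (simp add: field_simps)
  have "(\<integral>x. cis (x * u) * complex_of_real (sqrt (2 * pi) * std_normal_density (e * x)) \<partial>lborel)
     = complex_of_real (sqrt (2 * pi)) * (\<integral>x. cis (x * u) * complex_of_real (std_normal_density (e * x)) \<partial>lborel)"
    by (subst integral_mult_right_zero[symmetric]) (simp only: of_real_mult ac_simps)
  also have "\<dots> = complex_of_real (sqrt (2 * pi) * (exp (- ((u / e)\<^sup>2) / 2) / e))"
    unfolding * by simp
  also have "sqrt (2 * pi) * (exp (- ((u / e)\<^sup>2) / 2) / e) = (2 * pi / e) * std_normal_density (u / e)"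
  proof -
    have "2 * pi / sqrt (2 * pi) = sqrt (2 * pi)" by (rule real_div_sqrt) simp
    moreover have "(2 * pi / e) * std_normal_density (u / e) = 2 * pi / sqrt (2 * pi) * (exp (- ((u / e)\<^sup>2) / 2) / e)"
      by (simp add: normal_density_def)
    ultimately show ?thesis by (simp only: times_divide_eq_right)
  qed
  finally show ?thesis .
qed

text \<open>Insert the Gaussian factor \<open>exp (- (e \<xi>)\<^sup>2 / 2)\<close>. By Fubini's theorem the regularised integral of \<open>F\<close> is an average of \<open>f\<close>
around \<open>s\<close> with normal weights of variance \<open>e\<^sup>2\<close>; both sides converge as \<open>e\<close> tends to 0.\<close>
lemma fourier_inversion:
  fixes f :: "real \<Rightarrow> complex"
  assumes cont: "continuous_on UNIV f" and int: "integrable lborel f" and bdd: "\<And>x. cmod (f x) \<le> B"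
    and int2: "integrable lborel F" and F: "\<And>\<xi>. F \<xi> = (\<integral>r. cis (- (\<xi> * r)) * f r \<partial>lborel)"
  shows "(\<integral>\<xi>. cis (\<xi> * s) * F \<xi> \<partial>lborel) = 2 * pi * f s"
proof -
  define W where "W e x = sqrt (2 * pi) * std_normal_density (e * x)" for e x :: real
  have W: "W e x = exp (- (e * x)\<^sup>2 / 2)" for e x by (simp add: W_def normal_density_def)
  have [measurable]: "f \<in> borel_measurable borel" by (rule borel_measurable_continuous_onI[OF cont])
  have [measurable]: "F \<in> borel_measurable borel" using int2 by auto
  have [measurable]: "(\<lambda>x. cis (g x)) \<in> borel_measurable borel" if [measurable]: "g \<in> borel_measurable borel" for g :: "real \<Rightarrow> real"
    unfolding cis_conv_exp by measurable
  have [measurable]: "(\<lambda>x. cis (g x)) \<in> borel_measurable (lborel \<Otimes>\<^sub>M lborel)" if [measurable]: "g \<in> borel_measurable (lborel \<Otimes>\<^sub>M lborel)" for g :: "real \<times> real \<Rightarrow> real"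
    unfolding cis_conv_exp by measurable
  have Wint: "integrable lborel (W e)" if "0 < e" for e
  proof -
    have "integrable lborel (\<lambda>x. std_normal_density (0 + e * x))"
      by (rule lborel_integrable_real_affine) (use that in auto)
    then show ?thesis unfolding W_def by simp
  qed
  have key: "(\<integral>\<xi>. W e \<xi> *\<^sub>R (cis (\<xi> * s) * F \<xi>) \<partial>lborel) = 2 * pi * (\<integral>u. std_normal_density u *\<^sub>R f (s - e * u) \<partial>lborel)"
    if e: "0 < e" for e
  proof -
    have "(\<integral>\<xi>. W e \<xi> *\<^sub>R (cis (\<xi> * s) * F \<xi>) \<partial>lborel)
        = (\<integral>\<xi>. (\<integral>r. W e \<xi> *\<^sub>R (cis (\<xi> * (s - r)) * f r) \<partial>lborel) \<partial>lborel)"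
      unfolding F
      by (intro Bochner_Integration.integral_cong refl)
        (simp add: cis_mult algebra_simps flip: integral_mult_right_zero integral_scaleR_right mult.assoc)
    also have "\<dots> = (\<integral>r. (\<integral>\<xi>. W e \<xi> *\<^sub>R (cis (\<xi> * (s - r)) * f r) \<partial>lborel) \<partial>lborel)"
    proof (rule lborel_pair.Fubini_integral[symmetric])
      have [measurable]: "W e \<in> borel_measurable borel" unfolding W_def by measurable
      have "integrable (lborel \<Otimes>\<^sub>M lborel) (\<lambda>(x, y). W e x *\<^sub>R f y)"
      proof (rule lborel_pair.Fubini_integrable)
        show "integrable lborel (\<lambda>x. \<integral>y. norm (case (x, y) of (x, y) \<Rightarrow> W e x *\<^sub>R f y) \<partial>lborel)"
          using integrable_abs[OF Wint[OF e]] by simp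
        show "AE x in lborel. integrable lborel (\<lambda>y. case (x, y) of (x, y) \<Rightarrow> W e x *\<^sub>R f y)"
          using int by simp
      qed measurable
      then show "integrable (lborel \<Otimes>\<^sub>M lborel) (\<lambda>(\<xi>, r). W e \<xi> *\<^sub>R (cis (\<xi> * (s - r)) * f r))"
        by (rule Bochner_Integration.integrable_bound) (measurable, auto simp: norm_mult)
    qed
    also have "\<dots> = (\<integral>r. ((2 * pi / e) * std_normal_density ((s - r) / e)) *\<^sub>R f r \<partial>lborel)"
    proof (intro Bochner_Integration.integral_cong refl)
      fix r
      have "(\<integral>\<xi>. W e \<xi> *\<^sub>R (cis (\<xi> * (s - r)) * f r) \<partial>lborel) = (\<integral>\<xi>. (cis (\<xi> * (s - r)) * complex_of_real (W e \<xi>)) * f r \<partial>lborel)"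
        by (simp add: scaleR_conv_of_real ac_simps)
      also have "\<dots> = complex_of_real ((2 * pi / e) * std_normal_density ((s - r) / e)) * f r"
        unfolding W_def by (subst integral_mult_left_zero) (simp only: fourier_gaussian[OF e])
      finally show "(\<integral>\<xi>. W e \<xi> *\<^sub>R (cis (\<xi> * (s - r)) * f r) \<partial>lborel) = ((2 * pi / e) * std_normal_density ((s - r) / e)) *\<^sub>R f r"
        by (simp add: scaleR_conv_of_real)
    qed
    also have "\<dots> = e *\<^sub>R (\<integral>u. ((2 * pi / e) * std_normal_density u) *\<^sub>R f (s - e * u) \<partial>lborel)"
      using lborel_integral_affine[of "- e" "\<lambda>r. ((2 * pi / e) * std_normal_density ((s - r) / e)) *\<^sub>R f r" s] e
      by (simp add: field_simps)
    also have "\<dots> = 2 * pi * (\<integral>u. std_normal_density u *\<^sub>R f (s - e * u) \<partial>lborel)"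
      using e by (subst integral_mult_right_zero[symmetric], subst integral_scaleR_right[symmetric])
        (simp add: scaleR_conv_of_real mult.assoc)
    finally show ?thesis .
  qed
  define E where "E n = 1 / real (Suc n)" for n
  have E: "0 < E n" for n by (simp add: E_def)
  have E0: "E \<longlonglongrightarrow> 0" unfolding E_def by (rule LIMSEQ_Suc[OF lim_1_over_n])
  have "(\<lambda>n. \<integral>\<xi>. W (E n) \<xi> *\<^sub>R (cis (\<xi> * s) * F \<xi>) \<partial>lborel) \<longlonglongrightarrow> (\<integral>\<xi>. cis (\<xi> * s) * F \<xi> \<partial>lborel)"
  proof (rule integral_dominated_convergence[where w="\<lambda>\<xi>. cmod (F \<xi>)"])
    show "AE \<xi> in lborel. (\<lambda>n. W (E n) \<xi> *\<^sub>R (cis (\<xi> * s) * F \<xi>)) \<longlonglongrightarrow> cis (\<xi> * s) * F \<xi>"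
    proof (intro AE_I2)
      fix \<xi>
      have "(\<lambda>n. exp (- (E n * \<xi>)\<^sup>2 / 2) *\<^sub>R (cis (\<xi> * s) * F \<xi>)) \<longlonglongrightarrow> exp (- (0 * \<xi>)\<^sup>2 / 2) *\<^sub>R (cis (\<xi> * s) * F \<xi>)"
        by (intro tendsto_intros E0) auto
      then show "(\<lambda>n. W (E n) \<xi> *\<^sub>R (cis (\<xi> * s) * F \<xi>)) \<longlonglongrightarrow> cis (\<xi> * s) * F \<xi>" by (simp add: W)
    qed
    show "AE x in lborel. norm (W (E n) x *\<^sub>R (cis (x * s) * F x)) \<le> cmod (F x)" for n
      by (auto simp: W norm_mult mult_left_le_one_le)
    show "(\<lambda>x. W (E n) x *\<^sub>R (cis (x * s) * F x)) \<in> borel_measurable lborel" for n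
      unfolding W_def by measurable
  qed (use int2 in auto)
  moreover have "(\<lambda>n. \<integral>\<xi>. W (E n) \<xi> *\<^sub>R (cis (\<xi> * s) * F \<xi>) \<partial>lborel) \<longlonglongrightarrow> 2 * pi * f s"
  proof -
    have "(\<lambda>n. \<integral>u. std_normal_density u *\<^sub>R f (s - E n * u) \<partial>lborel) \<longlonglongrightarrow> (\<integral>u. std_normal_density u *\<^sub>R f s \<partial>lborel)"
    proof (rule integral_dominated_convergence[where w="\<lambda>u. std_normal_density u * B"])
      show "AE u in lborel. (\<lambda>n. std_normal_density u *\<^sub>R f (s - E n * u)) \<longlonglongrightarrow> std_normal_density u *\<^sub>R f s"
      proof (intro AE_I2 tendsto_intros)
        fix u
        have "(\<lambda>n. s - E n * u) \<longlonglongrightarrow> s - 0 * u" by (intro tendsto_intros E0)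
        then show "(\<lambda>n. f (s - E n * u)) \<longlonglongrightarrow> f s"
          using cont isCont_tendsto_compose[of s f] by (simp add: continuous_on_eq_continuous_within)
      qed
      show "AE x in lborel. norm (std_normal_density x *\<^sub>R f (s - E n * x)) \<le> std_normal_density x * B" for n
        by (auto intro!: mult_left_mono bdd)
    qed auto
    also have "(\<integral>u. std_normal_density u *\<^sub>R f s \<partial>lborel) = f s"
      by (subst integral_scaleR_left) auto
    finally show ?thesis unfolding key[OF E] by (intro tendsto_intros)
  qed
  ultimately show ?thesis using LIMSEQ_unique by blast
qed

text \<open>On a convex open set \<open>f\<close> has a primitive \<open>H\<close>. The integrals over two vertical segments differ by the increments of \<open>H\<close>
along the two horizontal sides of the rectangle, and these are small where \<open>f\<close> is small.\<close>
lemma integral_vertical_line_shift: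
  fixes f :: "complex \<Rightarrow> complex"
  assumes hol: "f holomorphic_on S" and S: "convex S" "open S"
    and strip: "\<And>z. a \<le> Re z \<Longrightarrow> Re z \<le> b \<Longrightarrow> z \<in> S" and ab: "a \<le> b"
    and bd: "\<And>z. a \<le> Re z \<Longrightarrow> Re z \<le> b \<Longrightarrow> cmod (f z) \<le> C / (1 + (Im z)\<^sup>2)"
    and ia: "integrable lborel (\<lambda>y. f (Complex a y))" and ib: "integrable lborel (\<lambda>y. f (Complex b y))"
  shows "(\<integral>y. f (Complex a y) \<partial>lborel) = (\<integral>y. f (Complex b y) \<partial>lborel)"
proof -
  obtain H where H: "\<And>z. z \<in> S \<Longrightarrow> (H has_field_derivative f z) (at z)"
    using holomorphic_convex_primitive'[OF S hol] S by (metis at_within_open)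
  have FTC: "integral {- N..N} (\<lambda>y. f (Complex x y)) = - \<i> * (H (Complex x N) - H (Complex x (- N)))"
    if "0 \<le> N" "a \<le> x" "x \<le> b" for x N
  proof (rule integral_unique)
    have "((\<lambda>y. f (Complex x y)) has_integral (- \<i> * H (Complex x N)) - (- \<i> * H (Complex x (- N)))) {- N..N}"
    proof (rule fundamental_theorem_of_calculus)
      fix y
      have "((\<lambda>y. Complex x y) has_vector_derivative \<i>) (at y within {- N..N})"
        unfolding Complex_eq by (auto intro!: derivative_eq_intros)
      then have "(H \<circ> (\<lambda>y. Complex x y) has_vector_derivative \<i> * f (Complex x y)) (at y within {- N..N})"
        by (rule field_vector_diff_chain_within) (use that strip in \<open>auto intro!: has_field_derivative_at_within H\<close>)
      then show "((\<lambda>y. - \<i> * H (Complex x y)) has_vector_derivative f (Complex x y)) (at y within {- N..N})"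
        using has_vector_derivative_mult_right[of "\<lambda>y. H (Complex x y)" "\<i> * f (Complex x y)" "at y within {- N..N}" "- \<i>"]
        by (simp add: o_def mult.assoc[symmetric])
    qed (use that in simp)
    then show "((\<lambda>y. f (Complex x y)) has_integral - \<i> * (H (Complex x N) - H (Complex x (- N)))) {- N..N}"
      by (simp add: algebra_simps)
  qed
  have side: "cmod (H (Complex b y) - H (Complex a y)) \<le> C / (1 + y\<^sup>2) * (b - a)" for y
  proof -
    have seg: "z \<in> closed_segment (Complex a y) (Complex b y) \<Longrightarrow> a \<le> Re z \<and> Re z \<le> b \<and> Im z = y" for z
      using ab by (auto simp: closed_segment_same_Im closed_segment_eq_real_ivl)
    have "cmod (H (Complex b y) - H (Complex a y)) \<le> C / (1 + y\<^sup>2) * cmod (Complex b y - Complex a y)"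
      by (rule field_differentiable_bound[where S="closed_segment (Complex a y) (Complex b y)" and f'=f])
        (use seg strip bd in \<open>force intro: has_field_derivative_at_within H\<close>)+
    then show ?thesis using ab by (simp add: cmod_def)
  qed
  have lim: "(\<lambda>n. integral {- real n..real n} g) \<longlonglongrightarrow> (\<integral>y. g y \<partial>lborel)" if g: "integrable lborel g" for g :: "real \<Rightarrow> complex"
  proof -
    have "(\<lambda>n. \<integral>y. indicat_real {- real n..real n} y *\<^sub>R g y \<partial>lborel) \<longlonglongrightarrow> (\<integral>y. g y \<partial>lborel)"
    proof (rule integral_dominated_convergence[where w="\<lambda>y. cmod (g y)"])
      show "AE y in lborel. (\<lambda>n. indicat_real {- real n..real n} y *\<^sub>R g y) \<longlonglongrightarrow> g y"
      proof (intro AE_I2 tendsto_eventually)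
        fix y :: real
        show "\<forall>\<^sub>F n in sequentially. indicat_real {- real n..real n} y *\<^sub>R g y = g y"
          using eventually_ge_at_top[of "nat \<lceil>\<bar>y\<bar>\<rceil>"] 
        proof eventually_elim
          case (elim n)
          then have "\<bar>y\<bar> \<le> real n" by linarith
          then show ?case by (auto simp: indicator_def abs_le_iff)
        qed
      qed
    qed (use g in \<open>auto split: split_indicator\<close>)
    moreover have "(\<integral>y. indicat_real {- real n..real n} y *\<^sub>R g y \<partial>lborel) = integral {- real n..real n} g" for n
      using set_borel_integral_eq_integral(2)[of "{- real n..real n}" g] g
      by (simp add: set_lebesgue_integral_def set_integrable_def integrable_mult_indicator)
    ultimately show ?thesis by (simp only: times_divide_eq_right)
  qed
  have "(\<lambda>n. integral {- real n..real n} (\<lambda>y. f (Complex b y)) - integral {- real n..real n} (\<lambda>y. f (Complex a y))) \<longlonglongrightarrow> 0"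
  proof (rule Lim_null_comparison)
    show "\<forall>\<^sub>F n in sequentially. norm (integral {- real n..real n} (\<lambda>y. f (Complex b y)) - integral {- real n..real n} (\<lambda>y. f (Complex a y)))
        \<le> 2 * C * (b - a) / (1 + (real n)\<^sup>2)"
    proof (intro always_eventually allI)
      fix n
      have "norm (integral {- real n..real n} (\<lambda>y. f (Complex b y)) - integral {- real n..real n} (\<lambda>y. f (Complex a y)))
        = cmod (\<i> * ((H (Complex b n) - H (Complex a n)) - (H (Complex b (- n)) - H (Complex a (- n)))))"
        using ab by (simp add: FTC norm_mult algebra_simps flip: norm_minus_commute)
      also have "\<dots> \<le> cmod (H (Complex b n) - H (Complex a n)) + cmod (H (Complex b (- n)) - H (Complex a (- n)))"
        by (simp add: norm_mult norm_triangle_ineq4)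
      also have "\<dots> \<le> 2 * C * (b - a) / (1 + (real n)\<^sup>2)"
        using side[of n] side[of "- n"] by simp
      finally show "norm (integral {- real n..real n} (\<lambda>y. f (Complex b y)) - integral {- real n..real n} (\<lambda>y. f (Complex a y)))
        \<le> 2 * C * (b - a) / (1 + (real n)\<^sup>2)" .
    qed
    show "(\<lambda>n. 2 * C * (b - a) / (1 + (real n)\<^sup>2)) \<longlonglongrightarrow> 0" by real_asymp
  qed
  moreover have "(\<lambda>n. integral {- real n..real n} (\<lambda>y. f (Complex b y)) - integral {- real n..real n} (\<lambda>y. f (Complex a y)))
      \<longlonglongrightarrow> (\<integral>y. f (Complex b y) \<partial>lborel) - (\<integral>y. f (Complex a y) \<partial>lborel)"
    by (intro tendsto_intros lim ia ib)
  ultimately show ?thesis using LIMSEQ_unique by fastforce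
qed

section \<open>Power kernels and the Abel integral equation\<close>

lemma nonneg_has_integral_lborel:
  fixes f :: "real \<Rightarrow> real"
  assumes f: "f \<in> borel_measurable borel" and nonneg: "\<And>x. x \<in> S \<Longrightarrow> 0 \<le> f x" and I: "(f has_integral I) S"
    and S: "S \<in> sets borel"
  shows "integrable lborel (\<lambda>x. indicator S x * f x)" "(\<integral>x. indicator S x * f x \<partial>lborel) = I"
proof -
  note [measurable] = f S
  have "((\<lambda>x. indicator S x * f x) has_integral I) UNIV"
  proof -
    have "(\<lambda>x. indicator S x * f x) = (\<lambda>x. if x \<in> S then f x else 0)" by auto
    then show ?thesis using I has_integral_restrict_UNIV[of S f I] by simp
  qed
  then have nn: "(\<integral>\<^sup>+x. ennreal (indicator S x * f x) \<partial>lborel) = ennreal I"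
    by (intro nn_integral_has_integral_lborel) (auto simp: nonneg split: split_indicator)
  have "0 \<le> I" by (rule has_integral_nonneg[OF I nonneg])
  show int: "integrable lborel (\<lambda>x. indicator S x * f x)"
    by (rule integrableI_nonneg) (use nonneg nn in \<open>auto split: split_indicator\<close>)
  show "(\<integral>x. indicator S x * f x \<partial>lborel) = I"
    using nn nn_integral_eq_integral[OF int] nonneg \<open>0 \<le> I\<close>
    by (subst integral_eq_nn_integral) (auto split: split_indicator)
qed

text \<open>The kernel of the fractional integral of order \<open>a\<close>, without its factor \<open>1 / Gamma a\<close>.\<close>
definition pow_kernel :: "real \<Rightarrow> real \<Rightarrow> real" where
  "pow_kernel a s = indicator {0<..} s * s powr (a - 1)"

lemma pow_kernel_nonneg [simp]: "0 \<le> pow_kernel a s" by (simp add: pow_kernel_def)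

lemma pow_kernel_measurable [measurable]: "pow_kernel a \<in> borel_measurable borel"
  unfolding pow_kernel_def by measurable

lemma pow_kernel_scale: "0 < c \<Longrightarrow> pow_kernel a (c * s) = c powr (a - 1) * pow_kernel a s"
  by (auto simp: pow_kernel_def powr_mult zero_less_mult_iff split: split_indicator)

lemma integrable_pow_kernel_exp:
  assumes "0 < a" "0 < r"
  shows "integrable lborel (\<lambda>s. pow_kernel a s * exp (- (r * s)))"
    and "(\<integral>s. pow_kernel a s * exp (- (r * s)) \<partial>lborel) = Gamma a * r powr - a"
proof -
  define f where "f s = pow_kernel a s * exp (- s)" for s
  have eq: "(\<lambda>s. indicator {0..} s * (s powr (a - 1) / exp s)) = f"
    by (auto simp: f_def pow_kernel_def fun_eq_iff exp_minus field_simps split: split_indicator)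
  have f: "integrable lborel f" "integral\<^sup>L lborel f = Gamma a"
    using nonneg_has_integral_lborel[OF _ _ Gamma_integral_real[OF assms(1)]] by (simp_all only: eq, simp_all)
  have *: "pow_kernel a s * exp (- (r * s)) = r powr (1 - a) * f (0 + r * s)" for s
    using assms by (simp add: f_def pow_kernel_scale powr_diff field_simps)
  show "integrable lborel (\<lambda>s. pow_kernel a s * exp (- (r * s)))"
    unfolding * by (intro integrable_mult_right lborel_integrable_real_affine f) (use assms in simp)
  have "(\<integral>s. pow_kernel a s * exp (- (r * s)) \<partial>lborel) = r powr (1 - a) * (\<integral>s. f (0 + r * s) \<partial>lborel)"
    unfolding * by simp
  also have "\<dots> = r powr (1 - a) * (Gamma a / r)"
    using lborel_integral_real_affine[of r f 0] assms f by (simp add: field_simps)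
  also have "\<dots> = Gamma a * r powr - a" using assms by (simp add: powr_diff powr_minus field_simps)
  finally show "(\<integral>s. pow_kernel a s * exp (- (r * s)) \<partial>lborel) = Gamma a * r powr - a" .
qed

text \<open>Scaling \<open>t\<close> by \<open>v\<close> shows that the convolution of the kernels of orders \<open>1 - \<theta>\<close> and \<open>\<theta>\<close> is constant on the half-line;
the constant is a Beta integral.\<close>
lemma pow_kernel_convolution:
  assumes "0 < \<theta>" "\<theta> < 1" "0 < v"
  shows "(\<integral>t. pow_kernel (1 - \<theta>) t * pow_kernel \<theta> (v - t) \<partial>lborel) = Beta (1 - \<theta>) \<theta>"
proof -
  have "(\<lambda>t. indicator {0..1} t * (t powr ((1 - \<theta>) - 1) * (1 - t) powr (\<theta> - 1))) = (\<lambda>t. pow_kernel (1 - \<theta>) t * pow_kernel \<theta> (1 - t))"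
    by (auto simp: pow_kernel_def fun_eq_iff split: split_indicator)
  then have 1: "(\<integral>t. pow_kernel (1 - \<theta>) t * pow_kernel \<theta> (1 - t) \<partial>lborel) = Beta (1 - \<theta>) \<theta>"
    using nonneg_has_integral_lborel(2)[OF _ _ has_integral_Beta_real[of "1 - \<theta>" \<theta>]] assms by simp
  have "(\<integral>t. pow_kernel (1 - \<theta>) t * pow_kernel \<theta> (v - t) \<partial>lborel)
      = v * (\<integral>t. pow_kernel (1 - \<theta>) (v * t) * pow_kernel \<theta> (v * (1 - t)) \<partial>lborel)"
    using lborel_integral_real_affine[of v "\<lambda>t. pow_kernel (1 - \<theta>) t * pow_kernel \<theta> (v - t)" 0] assms
    by (simp add: right_diff_distrib)
  also have "\<dots> = v * (v powr (- \<theta>) * v powr (\<theta> - 1) * (\<integral>t. pow_kernel (1 - \<theta>) t * pow_kernel \<theta> (1 - t) \<partial>lborel))"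
  proof -
    have "pow_kernel (1 - \<theta>) (v * t) * pow_kernel \<theta> (v * (1 - t))
        = (v powr (- \<theta>) * v powr (\<theta> - 1)) * (pow_kernel (1 - \<theta>) t * pow_kernel \<theta> (1 - t))" for t
      by (simp add: pow_kernel_scale[OF assms(3)])
    then show ?thesis by (simp only: integral_mult_right_zero)
  qed
  also have "v powr (- \<theta>) * v powr (\<theta> - 1) = 1 / v" 
  proof -
    have "v powr (- \<theta>) * v powr (\<theta> - 1) = v powr (- 1)" by (subst powr_add[symmetric]) simp
    then show ?thesis using assms by (simp add: powr_minus_divide)
  qed
  finally show ?thesis using 1 assms by simp
qed

text \<open>The Laplace transform of \<open>s\<^sup>-\<^sup>\<theta>\<close> is \<open>Gamma (1 - \<theta>) * r powr (\<theta> - 1)\<close>. This turns Balakrishnan's integral of a resolvent,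
which is a Laplace transform of the orbit, into a fractional integral of the orbit.\<close>
lemma stieltjes_eq_pow_kernel:
  fixes w :: "real \<Rightarrow> complex"
  assumes th: "0 < \<theta>" "\<theta> < 1" and \<delta>: "0 < \<delta>" and [measurable]: "w \<in> borel_measurable borel"
    and bd: "\<And>r. 0 < r \<Longrightarrow> cmod (w r) \<le> C * exp (- (\<delta> * r))"
  shows "(\<integral>s. pow_kernel (1 - \<theta>) s *\<^sub>R (\<integral>r. (indicator {0<..} r * exp (- (r * s))) *\<^sub>R w r \<partial>lborel) \<partial>lborel)
     = complex_of_real (Gamma (1 - \<theta>)) * (\<integral>r. pow_kernel \<theta> r *\<^sub>R w r \<partial>lborel)"
proof -
  let ?k = "\<lambda>r s. pow_kernel (1 - \<theta>) s * (indicator {0<..} r * exp (- (r * s)))"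
  have inner: "(\<integral>s. ?k r s \<partial>lborel) = Gamma (1 - \<theta>) * pow_kernel \<theta> r"
    and innerI: "integrable lborel (\<lambda>s. ?k r s)" for r
    using integrable_pow_kernel_exp[of "1 - \<theta>" r] th
    by (cases "0 < r"; simp add: pow_kernel_def)+
  have wI: "integrable lborel (\<lambda>r. pow_kernel \<theta> r *\<^sub>R w r)"
  proof (rule Bochner_Integration.integrable_bound)
    show "integrable lborel (\<lambda>r. C * (pow_kernel \<theta> r * exp (- (\<delta> * r))))"
      using integrable_pow_kernel_exp(1)[OF th(1) \<delta>] by simp
    show "AE r in lborel. norm (pow_kernel \<theta> r *\<^sub>R w r) \<le> norm (C * (pow_kernel \<theta> r * exp (- (\<delta> * r))))"
    proof (intro AE_I2)
      fix r :: real
      show "norm (pow_kernel \<theta> r *\<^sub>R w r) \<le> norm (C * (pow_kernel \<theta> r * exp (- (\<delta> * r))))"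
      proof (cases "0 < r")
        case True
        then have "pow_kernel \<theta> r * cmod (w r) \<le> pow_kernel \<theta> r * (C * exp (- (\<delta> * r)))" using bd by (intro mult_left_mono) auto
        also have "\<dots> \<le> norm (C * (pow_kernel \<theta> r * exp (- (\<delta> * r))))" by (simp add: ac_simps)
        finally show ?thesis by simp
      qed (simp add: pow_kernel_def)
    qed
  qed measurable
  have "(\<integral>s. pow_kernel (1 - \<theta>) s *\<^sub>R (\<integral>r. (indicator {0<..} r * exp (- (r * s))) *\<^sub>R w r \<partial>lborel) \<partial>lborel)
      = (\<integral>s. (\<integral>r. ?k r s *\<^sub>R w r \<partial>lborel) \<partial>lborel)"
    by (simp flip: integral_scaleR_right scaleR_scaleR)
  also have "\<dots> = (\<integral>r. (\<integral>s. ?k r s *\<^sub>R w r \<partial>lborel) \<partial>lborel)"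
  proof (rule lborel_pair.Fubini_integral)
    show "integrable (lborel \<Otimes>\<^sub>M lborel) (\<lambda>(r, s). ?k r s *\<^sub>R w r)"
    proof (rule lborel_pair.Fubini_integrable)
      have "(\<lambda>r. \<integral>s. norm (case (r, s) of (r, s) \<Rightarrow> ?k r s *\<^sub>R w r) \<partial>lborel)
         = (\<lambda>r. Gamma (1 - \<theta>) * norm (pow_kernel \<theta> r *\<^sub>R w r))"
      proof
        fix r
        have "norm (case (r, s) of (r, s) \<Rightarrow> ?k r s *\<^sub>R w r)
          = ?k r s * cmod (w r)" for s
          by (simp add: abs_mult)
        then have "(\<integral>s. norm (case (r, s) of (r, s) \<Rightarrow> ?k r s *\<^sub>R w r) \<partial>lborel)
          = Gamma (1 - \<theta>) * pow_kernel \<theta> r * cmod (w r)"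
          by (simp only: integral_mult_left_zero inner)
        then show "(\<integral>s. norm (case (r, s) of (r, s) \<Rightarrow> ?k r s *\<^sub>R w r) \<partial>lborel)
          = Gamma (1 - \<theta>) * norm (pow_kernel \<theta> r *\<^sub>R w r)" by simp
      qed
      then show "integrable lborel (\<lambda>r. \<integral>s. norm (case (r, s) of (r, s) \<Rightarrow> ?k r s *\<^sub>R w r) \<partial>lborel)"
        using integrable_norm[OF wI] by simp
      show "AE r in lborel. integrable lborel (\<lambda>s. case (r, s) of (r, s) \<Rightarrow> ?k r s *\<^sub>R w r)"
        using innerI by (intro AE_I2) (simp only: prod.case, rule integrable_scaleR_left)
    qed measurable
  qed
  also have "\<dots> = (\<integral>r. Gamma (1 - \<theta>) * (pow_kernel \<theta> r *\<^sub>R w r) \<partial>lborel)"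
  proof (intro Bochner_Integration.integral_cong refl)
    fix r
    have "(\<integral>s. ?k r s *\<^sub>R w r \<partial>lborel) = (Gamma (1 - \<theta>) * pow_kernel \<theta> r) *\<^sub>R w r"
      by (subst integral_scaleR_left) (simp_all only: inner innerI)
    then show "(\<integral>s. ?k r s *\<^sub>R w r \<partial>lborel) = Gamma (1 - \<theta>) * (pow_kernel \<theta> r *\<^sub>R w r)"
      by (simp add: scaleR_conv_of_real)
  qed
  also have "\<dots> = complex_of_real (Gamma (1 - \<theta>)) * (\<integral>r. pow_kernel \<theta> r *\<^sub>R w r \<partial>lborel)"
    by (rule integral_mult_right_zero)
  finally show ?thesis .
qed

lemma Beta_ne_zero:
  assumes "0 < \<theta>" "\<theta> < (1::real)"
  shows "Beta (1 - \<theta>) \<theta> \<noteq> 0"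
proof -
  have "0 < Gamma \<theta>" "0 < Gamma (1 - \<theta>)" using assms by (simp_all add: Gamma_real_pos)
  then show ?thesis by (simp add: Beta_def)
qed

text \<open>A solution of the homogeneous Abel equation of order \<open>\<theta>\<close>: integrating it once more, against the kernel of the
complementary order \<open>1 - \<theta>\<close>, gives an integral of order 1, that is, a multiple of the integral of \<open>u\<close>.\<close>
lemma abel_transform_zero:
  fixes u :: "real \<Rightarrow> complex"
  assumes th: "0 < \<theta>" "\<theta> < 1" and \<delta>: "0 < \<delta>" and [measurable]: "u \<in> borel_measurable borel"
    and bd: "\<And>r. 0 < r \<Longrightarrow> cmod (u r) \<le> C * exp (- (\<delta> * r))"
    and zero: "\<And>t. 0 < t \<Longrightarrow> (\<integral>r. pow_kernel \<theta> r *\<^sub>R u (r + t) \<partial>lborel) = 0"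
  shows "(\<integral>v. indicator {0<..} v *\<^sub>R u v \<partial>lborel) = 0"
proof -
  define \<alpha> where "\<alpha> = pow_kernel \<theta>"
  define \<beta> where "\<beta> = pow_kernel (1 - \<theta>)"
  have [measurable]: "\<alpha> \<in> borel_measurable borel" "\<beta> \<in> borel_measurable borel" by (simp_all add: \<alpha>_def \<beta>_def)
  have nn[simp]: "0 \<le> \<alpha> r" "0 \<le> \<beta> r" for r by (simp_all add: \<alpha>_def \<beta>_def)
  have supp: "\<alpha> r = 0" "\<beta> r = 0" if "r \<le> 0" for r using that by (simp_all add: \<alpha>_def \<beta>_def pow_kernel_def)
  note E\<alpha> = integrable_pow_kernel_exp[OF th(1) \<delta>, folded \<alpha>_def]
  note E\<beta> = integrable_pow_kernel_exp(1)[of "1 - \<theta>", OF _ \<delta>, folded \<beta>_def]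
  have "integrable (lborel \<Otimes>\<^sub>M lborel) (\<lambda>(t, r). (\<beta> t * exp (- (\<delta> * t))) * (\<alpha> r * exp (- (\<delta> * r))))"
  proof (rule lborel_pair.Fubini_integrable)
    show "integrable lborel (\<lambda>t. \<integral>r. norm (case (t, r) of (t, r) \<Rightarrow> (\<beta> t * exp (- (\<delta> * t))) * (\<alpha> r * exp (- (\<delta> * r)))) \<partial>lborel)"
      using E\<beta> th by (simp add: abs_mult)
    show "AE t in lborel. integrable lborel (\<lambda>r. case (t, r) of (t, r) \<Rightarrow> (\<beta> t * exp (- (\<delta> * t))) * (\<alpha> r * exp (- (\<delta> * r))))"
      using E\<alpha>(1) by simp
  qed measurable
  then have I1: "integrable (lborel \<Otimes>\<^sub>M lborel) (\<lambda>(t, r). (\<beta> t * \<alpha> r) *\<^sub>R u (r + t))"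
  proof (rule Bochner_Integration.integrable_bound[OF integrable_mult_right[of C]])
    show "AE x in lborel \<Otimes>\<^sub>M lborel. norm (case x of (t, r) \<Rightarrow> (\<beta> t * \<alpha> r) *\<^sub>R u (r + t))
        \<le> norm (C * (case x of (t, r) \<Rightarrow> \<beta> t * exp (- (\<delta> * t)) * (\<alpha> r * exp (- (\<delta> * r)))))"
    proof (intro AE_I2, clarify)
      fix t r :: real
      show "norm ((\<beta> t * \<alpha> r) *\<^sub>R u (r + t)) \<le> norm (C * (\<beta> t * exp (- (\<delta> * t)) * (\<alpha> r * exp (- (\<delta> * r)))))"
      proof (cases "0 < t \<and> 0 < r")
        case True
        then have "norm ((\<beta> t * \<alpha> r) *\<^sub>R u (r + t)) \<le> (\<beta> t * \<alpha> r) * (C * exp (- (\<delta> * (r + t))))"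
          using bd[of "r + t"] by (simp add: abs_mult mult_left_mono)
        also have "\<dots> = C * (\<beta> t * exp (- (\<delta> * t)) * (\<alpha> r * exp (- (\<delta> * r))))"
          by (simp add: distrib_left exp_diff exp_minus field_simps exp_add)
        finally show ?thesis by simp
      qed (auto simp: supp)
    qed
  qed (measurable)
  have "0 = (\<integral>t. (\<integral>r. (\<beta> t * \<alpha> r) *\<^sub>R u (r + t) \<partial>lborel) \<partial>lborel)"
  proof -
    have "(\<integral>r. (\<beta> t * \<alpha> r) *\<^sub>R u (r + t) \<partial>lborel) = \<beta> t *\<^sub>R (\<integral>r. \<alpha> r *\<^sub>R u (r + t) \<partial>lborel)" for t
      by (simp flip: scaleR_scaleR)
    moreover have "\<beta> t *\<^sub>R (\<integral>r. \<alpha> r *\<^sub>R u (r + t) \<partial>lborel) = 0" for t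
      using zero[of t] supp(2)[of t] by (cases "0 < t") (auto simp: \<alpha>_def)
    ultimately show ?thesis by simp
  qed
  also have "\<dots> = (\<integral>t. (\<integral>v. (\<beta> t * \<alpha> (v - t)) *\<^sub>R u v \<partial>lborel) \<partial>lborel)"
  proof (rule Bochner_Integration.integral_cong[OF refl])
    fix t
    show "(\<integral>r. (\<beta> t * \<alpha> r) *\<^sub>R u (r + t) \<partial>lborel) = (\<integral>v. (\<beta> t * \<alpha> (v - t)) *\<^sub>R u v \<partial>lborel)"
      using lborel_integral_real_affine[of 1 "\<lambda>v. (\<beta> t * \<alpha> (v - t)) *\<^sub>R u v" t] by (simp add: add.commute)
  qed
  also have "\<dots> = (\<integral>v. (\<integral>t. (\<beta> t * \<alpha> (v - t)) *\<^sub>R u v \<partial>lborel) \<partial>lborel)"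
  proof (rule lborel_pair.Fubini_integral[symmetric])
    show "integrable (lborel \<Otimes>\<^sub>M lborel) (\<lambda>(t, v). (\<beta> t * \<alpha> (v - t)) *\<^sub>R u v)"
    proof (rule lborel_pair.Fubini_integrable)
      have "(\<integral>r. norm ((\<beta> t * \<alpha> r) *\<^sub>R u (r + t)) \<partial>lborel) = (\<integral>v. norm ((\<beta> t * \<alpha> (v - t)) *\<^sub>R u v) \<partial>lborel)" for t
        using lborel_integral_real_affine[of 1 "\<lambda>v. norm ((\<beta> t * \<alpha> (v - t)) *\<^sub>R u v)" t] by (simp add: add.commute)
      then show "integrable lborel (\<lambda>t. \<integral>v. norm (case (t, v) of (t, v) \<Rightarrow> (\<beta> t * \<alpha> (v - t)) *\<^sub>R u v) \<partial>lborel)"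
        using lborel_pair.integrable_fst'[OF integrable_norm[OF I1]] by (simp add: case_prod_beta)
      have "AE t in lborel. integrable lborel (\<lambda>r. (\<beta> t * \<alpha> r) *\<^sub>R u (r + t))"
        using lborel_pair.AE_integrable_fst'[OF I1] by simp
      then show "AE t in lborel. integrable lborel (\<lambda>v. case (t, v) of (t, v) \<Rightarrow> (\<beta> t * \<alpha> (v - t)) *\<^sub>R u v)"
      proof eventually_elim
        case (elim t)
        show ?case using lborel_integrable_real_affine[OF elim, of 1 "- t"] by simp
      qed
    qed measurable
  qed
  also have "\<dots> = (\<integral>v. Beta (1 - \<theta>) \<theta> *\<^sub>R (indicator {0<..} v *\<^sub>R u v) \<partial>lborel)"
  proof (intro Bochner_Integration.integral_cong refl)
    fix v :: real
    show "(\<integral>t. (\<beta> t * \<alpha> (v - t)) *\<^sub>R u v \<partial>lborel) = Beta (1 - \<theta>) \<theta> *\<^sub>R (indicator {0<..} v *\<^sub>R u v)"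
    proof (cases "0 < v")
      case True
      have B: "(\<integral>t. \<beta> t * \<alpha> (v - t) \<partial>lborel) = Beta (1 - \<theta>) \<theta>"
        unfolding \<alpha>_def \<beta>_def by (rule pow_kernel_convolution[OF th True])
      have "Beta (1 - \<theta>) \<theta> \<noteq> 0" by (rule Beta_ne_zero[OF th])
      then have "integrable lborel (\<lambda>t. \<beta> t * \<alpha> (v - t))" using B not_integrable_integral_eq by metis
      then show ?thesis using B True by simp
    next
      case False
      then have "(\<lambda>t. (\<beta> t * \<alpha> (v - t)) *\<^sub>R u v) = (\<lambda>_. 0)"
        using supp by (auto simp: fun_eq_iff not_less) (metis diff_le_0_iff_le linorder_le_cases order_trans)
      then show ?thesis using False by simp
    qed
  qed
  also have "\<dots> = Beta (1 - \<theta>) \<theta> *\<^sub>R (\<integral>v. indicator {0<..} v *\<^sub>R u v \<partial>lborel)"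
    by (rule integral_scaleR_right)
  finally have "Beta (1 - \<theta>) \<theta> *\<^sub>R (\<integral>v. indicator {0<..} v *\<^sub>R u v \<partial>lborel) = 0" by simp
  moreover have "Beta (1 - \<theta>) \<theta> \<noteq> 0" by (rule Beta_ne_zero[OF th])
  ultimately show ?thesis by (simp del: Beta_commute)
qed

section \<open>Vector-valued integrals and Lebesgue spaces on the line\<close>

text \<open>Cauchy's criterion: the integral of \<open>f\<close> over the difference of two nested intervals is bounded by that of \<open>h\<close>. The
Henstock-Kurzweil integral is used for vectors because it asks for no separability.\<close>
lemma continuous_dominated_integrable_on_UNIV:
  fixes f :: "real \<Rightarrow> 'a::banach"
  assumes cont: "continuous_on UNIV f" and h: "h integrable_on UNIV" and le: "\<And>x. norm (f x) \<le> h x"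
  shows "f integrable_on UNIV"
proof (subst integrable_alt_subset, intro conjI allI impI)
  have fI: "f integrable_on {a..b}" and hI: "h integrable_on {a..b}" for a b
    using integrable_continuous_real[OF continuous_on_subset[OF cont]] integrable_on_subinterval[OF h] by auto
  show "(\<lambda>x. if x \<in> UNIV then f x else 0) integrable_on cbox a b" for a b using fI by simp
  fix e :: real assume "0 < e"
  then obtain B where B: "0 < B" and hB: "\<And>a b c d. ball 0 B \<subseteq> cbox a b \<Longrightarrow> cbox a b \<subseteq> cbox c d \<Longrightarrow>
      norm (integral (cbox a b) h - integral (cbox c d) h) < e"
    using conjunct2[OF integrable_alt_subset[THEN iffD1, OF h], rule_format, OF \<open>0 < e\<close>]
    by (simp only: UNIV_I if_True) metis
  show "\<exists>B>0. \<forall>a b c d. ball 0 B \<subseteq> cbox a b \<and> cbox a b \<subseteq> cbox c d \<longrightarrow>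
      norm (integral (cbox a b) (\<lambda>x. if x \<in> UNIV then f x else 0) - integral (cbox c d) (\<lambda>x. if x \<in> UNIV then f x else 0)) < e"
  proof (intro exI[of _ B] conjI B allI impI, elim conjE)
    fix a b c d :: real assume sub: "ball 0 B \<subseteq> cbox a b" "cbox a b \<subseteq> cbox c d"
    have "0 \<in> cbox a b" using sub(1) B centre_in_ball[of 0 B] by blast
    then have ord: "c \<le> a" "a \<le> b" "b \<le> d" using sub(2) by auto
    have split: "integral {c..d} g = integral {c..a} g + integral {a..b} g + integral {b..d} g"
      if "\<And>a b. g integrable_on {a..b}" for g :: "real \<Rightarrow> 'x::banach"
    proof -
      have "integral {c..a} g + integral {a..d} g = integral {c..d} g" "integral {a..b} g + integral {b..d} g = integral {a..d} g"
        using ord that by (intro Henstock_Kurzweil_Integration.integral_combine; simp)+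
      then show ?thesis by (metis add.assoc)
    qed
    have "norm (integral {a..b} f - integral {c..d} f) = norm (integral {c..a} f + integral {b..d} f)"
      using split[OF fI] by (metis add_diff_cancel_right' add.assoc add.commute norm_minus_commute)
    also have "\<dots> \<le> integral {c..a} h + integral {b..d} h"
      by (intro norm_triangle_le add_mono integral_norm_bound_integral fI hI le)
    also have "\<dots> = norm (integral {a..b} h - integral {c..d} h)"
    proof -
      have "0 \<le> integral {x..y} h" for x y by (rule integral_nonneg[OF hI]) (use le norm_ge_zero order_trans in blast)
      from this[of c a] this[of b d] show ?thesis using split[OF hI] by simp
    qed
    also have "\<dots> < e" using hB[OF sub] by simp
    finally show "norm (integral (cbox a b) (\<lambda>x. if x \<in> UNIV then f x else 0) - integral (cbox c d) (\<lambda>x. if x \<in> UNIV then f x else 0)) < e"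
      by simp
  qed
qed

text \<open>Sampling \<open>f\<close> on a finite grid of mesh \<open>1 / Suc i\<close> gives simple functions that converge pointwise, whether or not the
space is separable.\<close>
lemma strongly_measurable_continuous:
  fixes f :: "real \<Rightarrow> 'a::real_normed_vector"
  assumes cont: "continuous_on UNIV f"
  shows "strongly_measurable f"
proof -
  define q where "q i t = max (- real i) (min (real i) (real_of_int \<lfloor>t * real (Suc i)\<rfloor> / real (Suc i)))" for i t
  have "simple_function lborel (q i)" for i
  proof (rule simple_function_borel_measurable)
    show "q i \<in> borel_measurable lborel" unfolding q_def by measurable
    define F where "F = (\<lambda>k. real_of_int k / real (Suc i)) ` {- (int i * int (Suc i))..int i * int (Suc i)}"
    have "q i t \<in> F" for t
    proof -
      define k where "k = max (- (int i * int (Suc i))) (min (int i * int (Suc i)) \<lfloor>t * real (Suc i)\<rfloor>)"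
      have "q i t = real_of_int k / real (Suc i)"
        unfolding q_def k_def of_int_max of_int_min
        by (simp add: max_divide_distrib_right min_divide_distrib_right del: of_nat_Suc)
      moreover have "k \<in> {- (int i * int (Suc i))..int i * int (Suc i)}" unfolding k_def by auto
      ultimately show ?thesis unfolding F_def by blast
    qed
    moreover have "finite F" by (simp add: F_def)
    ultimately show "finite (q i ` space lborel)" by (metis finite_subset image_subsetI)
  qed
  then have "simple_function lborel (\<lambda>t. f (q i t))" for i
    using simple_function_compose[of lborel "q i" f] by (simp add: o_def)
  moreover have "(\<lambda>i. f (q i t)) \<longlonglongrightarrow> f t" for t
  proof -
    have floor_ge: "t - 1 / real (Suc i) \<le> real_of_int \<lfloor>t * real (Suc i)\<rfloor> / real (Suc i)"
      and floor_le: "real_of_int \<lfloor>t * real (Suc i)\<rfloor> / real (Suc i) \<le> t" for i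
    proof -
      have "t * real (Suc i) - 1 \<le> real_of_int \<lfloor>t * real (Suc i)\<rfloor>" by linarith
      then have "(t * real (Suc i) - 1) / real (Suc i) \<le> real_of_int \<lfloor>t * real (Suc i)\<rfloor> / real (Suc i)"
        by (rule divide_right_mono) simp
      then show "t - 1 / real (Suc i) \<le> real_of_int \<lfloor>t * real (Suc i)\<rfloor> / real (Suc i)"
        by (simp add: diff_divide_distrib del: of_nat_Suc)
      show "real_of_int \<lfloor>t * real (Suc i)\<rfloor> / real (Suc i) \<le> t"
        by (subst pos_divide_le_eq) (simp_all del: of_nat_Suc)
    qed
    have "(\<lambda>i. q i t) \<longlonglongrightarrow> t"
    proof (rule Lim_transform_eventually)
      show "(\<lambda>i. real_of_int \<lfloor>t * real (Suc i)\<rfloor> / real (Suc i)) \<longlonglongrightarrow> t"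
      proof (rule real_tendsto_sandwich)
        show "\<forall>\<^sub>F i in sequentially. t - 1 / real (Suc i) \<le> real_of_int \<lfloor>t * real (Suc i)\<rfloor> / real (Suc i)"
          "\<forall>\<^sub>F i in sequentially. real_of_int \<lfloor>t * real (Suc i)\<rfloor> / real (Suc i) \<le> t" using floor_ge floor_le by auto
        show "(\<lambda>i. t - 1 / real (Suc i)) \<longlonglongrightarrow> t"
          using tendsto_diff[OF tendsto_const[of t] LIMSEQ_Suc[OF lim_1_over_n]] by simp
      qed auto
      show "\<forall>\<^sub>F i in sequentially. real_of_int \<lfloor>t * real (Suc i)\<rfloor> / real (Suc i) = q i t"
        using eventually_ge_at_top[of "nat \<lceil>\<bar>t\<bar> + 1\<rceil>"]
      proof eventually_elim
        case (elim i)
        then have i: "\<bar>t\<bar> + 1 \<le> real i" by linarith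
        have "1 / real (Suc i) \<le> 1" by simp
        then show ?case unfolding q_def using i floor_ge[of i] floor_le[of i] by linarith
      qed
    qed
    then show ?thesis using cont isCont_tendsto_compose[of t f] by (simp add: continuous_on_eq_continuous_within)
  qed
  ultimately show ?thesis unfolding strongly_measurable_def by (intro exI[of _ "\<lambda>i t. f (q i t)"]) auto
qed

lemma strongly_measurable_norm:
  assumes "strongly_measurable f"
  shows "(\<lambda>t. norm (f t)) \<in> borel_measurable borel"
proof -
  obtain s where s: "\<And>i. simple_function lborel (s i)" and lim: "\<And>t. (\<lambda>i::nat. s i t) \<longlonglongrightarrow> f t"
    using assms unfolding strongly_measurable_def by blast
  have "(\<lambda>t. norm (s i t)) \<in> borel_measurable lborel" for i
    by (rule borel_measurable_simple_function) (use simple_function_compose[OF s, of norm] in \<open>simp add: o_def\<close>)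
  then have "(\<lambda>t. norm (s i t)) \<in> borel_measurable borel" for i by simp
  then show ?thesis by (rule borel_measurable_LIMSEQ_real[rotated]) (rule tendsto_norm[OF lim])
qed

lemma Lq_norm_infinity_AE:
  assumes f: "f \<in> Lq_space \<infinity>"
  shows "AE t in lborel. norm (f t) \<le> Lq_norm \<infinity> f"
proof -
  have [measurable]: "(\<lambda>t. norm (f t)) \<in> borel_measurable borel"
    using f strongly_measurable_norm by (auto simp: Lq_space_def)
  have fin: "esssup lborel (\<lambda>t. ereal (norm (f t))) < \<infinity>" using f by (simp add: Lq_space_def)
  have "AE t in lborel. ereal (norm (f t)) \<le> esssup lborel (\<lambda>t. ereal (norm (f t)))" by (rule esssup_AE)
  then show ?thesis
  proof eventually_elim
    case (elim t)
    then show ?case using fin unfolding Lq_norm_def by (cases "esssup lborel (\<lambda>t. ereal (norm (f t)))") auto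
  qed
qed

text \<open>This covers finite \<open>q\<close> and \<open>q = \<infinity>\<close> at once, so that the main argument need not separate \<open>p = 1\<close> from \<open>p > 1\<close>.\<close>
lemma Lq_norm_ge_on_unit_interval:
  assumes f: "f \<in> Lq_space q" and q: "q = \<infinity> \<or> (\<exists>r>0. q = ereal r)" and d: "0 \<le> d"
    and ge: "\<And>t. t \<in> {c..c + 1} \<Longrightarrow> d \<le> norm (f t)"
  shows "d \<le> Lq_norm q f"
proof (cases "q = \<infinity>")
  case True
  have AE: "AE t in lborel. norm (f t) \<le> Lq_norm \<infinity> f" using Lq_norm_infinity_AE f True by blast
  have "\<exists>t\<in>{c..c + 1}. norm (f t) \<le> Lq_norm \<infinity> f"
  proof (rule ccontr)
    assume "\<not> ?thesis"
    then have "AE t in lborel. t \<notin> {c..c + 1}" using AE by (auto elim!: eventually_mono)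
    then have "emeasure lborel {c..c + 1} = 0"
      by (subst (asm) AE_iff_measurable[of "{c..c + 1}"]) auto
    then show False by simp
  qed
  then show ?thesis using True ge order_trans by blast
next
  case False
  then obtain r where r: "0 < r" "q = ereal r" using q by blast
  have int: "integrable lborel (\<lambda>t. norm (f t) powr r)" using f r by (simp add: Lq_space_def)
  have "d powr r = (\<integral>t. indicator {c..c + 1} t * d powr r \<partial>lborel)" by simp
  also have "\<dots> \<le> (\<integral>t. norm (f t) powr r \<partial>lborel)"
    by (rule integral_mono[OF _ int]) (use ge d r in \<open>auto split: split_indicator intro!: powr_mono2\<close>)
  finally have "(d powr r) powr (1 / r) \<le> (\<integral>t. norm (f t) powr r \<partial>lborel) powr (1 / r)"
    using r by (intro powr_mono2) auto
  then show ?thesis using r d by (simp add: Lq_norm_def powr_powr)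
qed

lemma Lq_norm_nonneg: "f \<in> Lq_space q \<Longrightarrow> 0 \<le> Lq_norm q f"
  by (cases "q = \<infinity>") (simp_all add: Lq_norm_ge_on_unit_interval[where c=0 and d=0], simp add: Lq_norm_def)

lemma Lq_norm_powr:
  assumes "0 < r" "f \<in> Lq_space (ereal r)"
  shows "(\<integral>t. norm (f t) powr r \<partial>lborel) = Lq_norm (ereal r) f powr r"
  using assms by (simp add: Lq_norm_def powr_powr)

lemma integrable_one_plus_abs_powr:
  fixes c :: real
  assumes "1 < c"
  shows "integrable lborel (\<lambda>x. (1 + \<bar>x\<bar>) powr - c)"
proof -
  define g where "g x = indicator {1..} x * x powr - c" for x :: real
  have [measurable]: "g \<in> borel_measurable borel" unfolding g_def by measurable
  have g: "integrable lborel g"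
    using nonneg_has_integral_lborel(1)[OF _ _ has_integral_powr_to_inf[of "- c" 1]] assms
    unfolding g_def by simp
  have "integrable lborel (\<lambda>x. g (1 + 1 * x) + g (1 + (-1) * x))"
    by (intro Bochner_Integration.integrable_add lborel_integrable_real_affine g) auto
  then show ?thesis
    by (rule Bochner_Integration.integrable_bound) (auto simp: g_def abs_if split: split_indicator)
qed

text \<open>Young's inequality without its constants. If \<open>b powr q\<close> is the smaller of the two summands then \<open>b \<le> a powr (r / q)\<close>, and
\<open>p * (1 + r / q) = r\<close>.\<close>
lemma powr_product_le_sum:
  fixes a b :: real
  assumes "0 < p" "0 < q" "0 < r" "1 / p = 1 / q + 1 / r" "0 \<le> a" "0 \<le> b"
  shows "(a * b) powr p \<le> a powr r + b powr q"
proof -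
  have pr: "p * (1 + r / q) = r" "p * (1 + q / r) = q"
  proof -
    have "p * (1 + r / q) = p * r * (1 / q + 1 / r)" "p * (1 + q / r) = p * q * (1 / q + 1 / r)"
      using assms(2,3) by (simp_all add: distrib_left)
    then show "p * (1 + r / q) = r" "p * (1 + q / r) = q"
      using assms(1) unfolding assms(4)[symmetric] by simp_all
  qed
  show ?thesis
  proof (cases "b powr q \<le> a powr r")
    case True
    have "b = (b powr q) powr (1 / q)" using assms by (simp add: powr_powr)
    also have "\<dots> \<le> (a powr r) powr (1 / q)" using True assms by (intro powr_mono2) auto
    finally have "a * b \<le> a * a powr (r / q)" using assms by (simp add: powr_powr mult_left_mono)
    also have "\<dots> = a powr (1 + r / q)" using assms by (simp add: powr_mult_base)
    finally have "(a * b) powr p \<le> (a powr (1 + r / q)) powr p" using assms by (intro powr_mono2) auto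
    also have "\<dots> = a powr r" using pr by (simp add: powr_powr mult.commute)
    finally show ?thesis by (simp add: add_increasing2)
  next
    case False
    have "a = (a powr r) powr (1 / r)" using assms by (simp add: powr_powr)
    also have "\<dots> \<le> (b powr q) powr (1 / r)" using False assms by (intro powr_mono2) auto
    finally have "b * a \<le> b * b powr (q / r)" using assms by (simp add: powr_powr mult_left_mono)
    also have "\<dots> = b powr (1 + q / r)" using assms by (simp add: powr_mult_base)
    finally have "(b * a) powr p \<le> (b powr (1 + q / r)) powr p" using assms by (intro powr_mono2) auto
    also have "\<dots> = b powr q" using pr by (simp add: powr_powr mult.commute)
    finally show ?thesis by (simp add: add_increasing mult.commute)
  qed
qed

lemma inverse_ereal_eq: "r \<noteq> 0 \<Longrightarrow> 1 / ereal r = ereal (1 / r)"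
  unfolding one_ereal_def by (simp only: ereal_divide simp_thms if_False)

text \<open>Hoelder's inequality in the form of Young's: the weight lies in \<open>L\<^sup>r\<close> with \<open>1 / r = 1 / p - 1 / p'\<close> because \<open>\<delta> * r > 1\<close>.
For \<open>p = 1\<close> the exponent \<open>p'\<close> is infinite and \<open>r = 1\<close>; for \<open>p = 2\<close> it is \<open>r\<close> that is infinite, and a bounded weight is
enough.\<close>
lemma weighted_Lq_imp_Lp:
  fixes p \<delta> L :: real
  assumes p: "1 \<le> p" "p \<le> 2" and \<delta>: "1 / ereal p - 1 / hoelder_conj p < ereal \<delta> \<or> p = 2 \<and> \<delta> = 0"
  obtains K where "0 \<le> K"
    "\<And>G :: real \<Rightarrow> 'a::real_normed_vector. G \<in> Lq_space (hoelder_conj p) \<Longrightarrow> Lq_norm (hoelder_conj p) G \<le> L \<Longrightarrow>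
      integrable lborel (\<lambda>x. ((1 + \<bar>x\<bar>) powr - \<delta> * norm (G x)) powr p) \<and>
      (\<integral>x. ((1 + \<bar>x\<bar>) powr - \<delta> * norm (G x)) powr p \<partial>lborel) \<le> K"
proof -
  let ?F = "\<lambda>(G :: real \<Rightarrow> 'a) x. ((1 + \<bar>x\<bar>) powr - \<delta> * norm (G x)) powr p"
  have meas: "(\<lambda>x. norm (G x)) \<in> borel_measurable borel" if "G \<in> Lq_space (hoelder_conj p)" for G :: "real \<Rightarrow> 'a"
    using that strongly_measurable_norm by (auto simp: Lq_space_def)
  consider "p = 1" | "p = 2" | "1 < p" "p < 2" using p by linarith
  then show ?thesis
  proof cases
    case 1
    then have \<delta>1: "1 < \<delta>" using \<delta> inverse_ereal_eq[of 1] by (simp add: hoelder_conj_def)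
    note m = integrable_one_plus_abs_powr[OF \<delta>1]
    show ?thesis
    proof (rule that[of "\<bar>\<integral>x. L * (1 + \<bar>x\<bar>) powr - \<delta> \<partial>lborel\<bar>"], simp)
      fix G :: "real \<Rightarrow> 'a" assume G: "G \<in> Lq_space (hoelder_conj p)" "Lq_norm (hoelder_conj p) G \<le> L"
      note [measurable] = meas[OF G(1)]
      have "AE x in lborel. norm (G x) \<le> L"
        using Lq_norm_infinity_AE[of G] G 1 by (auto simp: hoelder_conj_def elim!: eventually_mono)
      then have AE: "AE x in lborel. ?F G x \<le> L * (1 + \<bar>x\<bar>) powr - \<delta>"
        by eventually_elim (use 1 in \<open>simp add: mult.commute mult_right_mono\<close>)
      have I: "integrable lborel (?F G)"
        by (rule Bochner_Integration.integrable_bound[OF integrable_mult_right[OF m, of L]])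
          (measurable, use AE in \<open>auto elim!: eventually_mono\<close>)
      have "(\<integral>x. ?F G x \<partial>lborel) \<le> (\<integral>x. L * (1 + \<bar>x\<bar>) powr - \<delta> \<partial>lborel)"
        by (rule integral_mono_AE[OF I _ AE]) (use m in simp)
      then show "integrable lborel (?F G) \<and>
          (\<integral>x. ?F G x \<partial>lborel) \<le> \<bar>\<integral>x. L * (1 + \<bar>x\<bar>) powr - \<delta> \<partial>lborel\<bar>"
        using I by linarith
    qed
  next
    case 2
    have "hoelder_conj p = ereal p" using 2 by (simp add: hoelder_conj_def)
    then have \<delta>0: "0 \<le> \<delta>" using \<delta> 2 inverse_ereal_eq[of p] by auto
    show ?thesis
    proof (rule that[of "\<bar>L\<bar> powr p"], simp)
      fix G :: "real \<Rightarrow> 'a" assume G: "G \<in> Lq_space (hoelder_conj p)" "Lq_norm (hoelder_conj p) G \<le> L"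
      note [measurable] = meas[OF G(1)]
      have hp: "hoelder_conj p = ereal p" using 2 by (simp add: hoelder_conj_def)
      have int: "integrable lborel (\<lambda>x. norm (G x) powr p)" using G hp by (simp add: Lq_space_def)
      have le: "?F G x \<le> norm (G x) powr p" for x
      proof (rule powr_mono2)
        have "(1 + \<bar>x\<bar>) powr - \<delta> \<le> 1 powr - \<delta>" using \<delta>0 by (intro powr_mono2') auto
        then show "(1 + \<bar>x\<bar>) powr - \<delta> * norm (G x) \<le> norm (G x)" by (simp add: mult_left_le_one_le)
      qed (use p in auto)
      have I: "integrable lborel (?F G)"
        by (rule Bochner_Integration.integrable_bound[OF int]) (measurable, use le in auto)
      have "(\<integral>x. ?F G x \<partial>lborel) \<le> (\<integral>x. norm (G x) powr p \<partial>lborel)"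
        by (rule integral_mono[OF I int le])
      also have "\<dots> = Lq_norm (ereal p) G powr p" by (rule Lq_norm_powr) (use p G hp in auto)
      also have "\<dots> \<le> \<bar>L\<bar> powr p" using G hp p Lq_norm_nonneg[OF G(1)] by (intro powr_mono2) auto
      finally show "integrable lborel (?F G) \<and>
          (\<integral>x. ?F G x \<partial>lborel) \<le> \<bar>L\<bar> powr p" using I by simp
    qed
  next
    case 3
    define q where "q = p / (p - 1)"
    define r where "r = p / (2 - p)"
    have hp: "hoelder_conj p = ereal q" using 3 by (simp add: hoelder_conj_def q_def)
    have pos: "0 < q" "0 < r" using 3 by (simp_all add: q_def r_def)
    have pqr: "1 / p = 1 / q + 1 / r"
    proof -
      have "1 / q + 1 / r = ((p - 1) + (2 - p)) / p" unfolding add_divide_distrib by (simp add: q_def r_def)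
      then show ?thesis by simp
    qed
    have "1 / p - 1 / q < \<delta>" using \<delta> pos 3 unfolding hp by (simp add: inverse_ereal_eq)
    then have "1 / r < \<delta>" using pqr by simp
    then have \<delta>r: "1 < \<delta> * r" using pos by (simp add: pos_divide_less_eq)
    have m: "integrable lborel (\<lambda>x. ((1 + \<bar>x\<bar>) powr - \<delta>) powr r)"
      using integrable_one_plus_abs_powr[OF \<delta>r] by (simp add: powr_powr)
    show ?thesis
    proof (rule that[of "\<bar>\<integral>x. ((1 + \<bar>x\<bar>) powr - \<delta>) powr r \<partial>lborel\<bar> + \<bar>L\<bar> powr q"], simp)
      fix G :: "real \<Rightarrow> 'a" assume G: "G \<in> Lq_space (hoelder_conj p)" "Lq_norm (hoelder_conj p) G \<le> L"
      note [measurable] = meas[OF G(1)]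
      have int: "integrable lborel (\<lambda>x. norm (G x) powr q)" using G hp by (simp add: Lq_space_def)
      have le: "?F G x \<le> ((1 + \<bar>x\<bar>) powr - \<delta>) powr r + norm (G x) powr q" for x
        by (rule powr_product_le_sum) (use 3 pos pqr in auto)
      have int2: "integrable lborel (\<lambda>x. ((1 + \<bar>x\<bar>) powr - \<delta>) powr r + norm (G x) powr q)"
        using m int by simp
      have I: "integrable lborel (?F G)"
        by (rule Bochner_Integration.integrable_bound[OF int2]) (measurable, use le in auto)
      have "(\<integral>x. ?F G x \<partial>lborel)
          \<le> (\<integral>x. ((1 + \<bar>x\<bar>) powr - \<delta>) powr r + norm (G x) powr q \<partial>lborel)"
        by (rule integral_mono[OF I int2 le])
      also have "\<dots> = (\<integral>x. ((1 + \<bar>x\<bar>) powr - \<delta>) powr r \<partial>lborel) + Lq_norm (ereal q) G powr q"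
        using m int Lq_norm_powr[OF pos(1), of G] G hp by simp
      also have "\<dots> \<le> \<bar>\<integral>x. ((1 + \<bar>x\<bar>) powr - \<delta>) powr r \<partial>lborel\<bar> + \<bar>L\<bar> powr q"
        using G hp pos Lq_norm_nonneg[OF G(1)] by (intro add_mono powr_mono2) auto
      finally show "integrable lborel (?F G) \<and>
          (\<integral>x. ?F G x \<partial>lborel) \<le> \<bar>\<integral>x. ((1 + \<bar>x\<bar>) powr - \<delta>) powr r \<partial>lborel\<bar> + \<bar>L\<bar> powr q"
        using I by simp
    qed
  qed
qed

lemma Lq_space_continuous:
  fixes f :: "real \<Rightarrow> 'a::real_normed_vector"
  assumes f: "continuous_on UNIV f" and q: "integrable lborel q" and le: "\<And>t. norm (f t) powr r \<le> q t"
  shows "f \<in> Lq_space (ereal r)"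
proof -
  have "(\<lambda>t. norm (f t)) \<in> borel_measurable borel"
    by (intro borel_measurable_continuous_onI continuous_intros f)
  then have "integrable lborel (\<lambda>t. norm (f t) powr r)"
    by (intro Bochner_Integration.integrable_bound[OF q]) (auto intro!: AE_I2 order_trans[OF le abs_ge_self])
  then show ?thesis using strongly_measurable_continuous[OF f] by (simp add: Lq_space_def)
qed

text \<open>On a unit interval a bound on the values is a bound on every \<open>L\<^sup>r\<close> norm, with constant 1.\<close>
lemma Lq_norm_unit_support:
  fixes f :: "real \<Rightarrow> 'a::real_normed_vector"
  assumes f: "continuous_on UNIV f" and supp: "\<And>s. s \<notin> {0..1} \<Longrightarrow> f s = 0" and D: "\<And>s. norm (f s) \<le> D" and r: "1 \<le> r"
  shows "f \<in> Lq_space (ereal r)" "Lq_norm (ereal r) f \<le> D"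
proof -
  have D0: "0 \<le> D" using order_trans[OF norm_ge_zero D] .
  have q: "integrable lborel (\<lambda>s::real. indicator {0..1} s * D powr r)"
    by (intro integrable_mult_left integrable_real_indicator) auto
  have le: "norm (f s) powr r \<le> indicator {0..1} s * D powr r" for s
    using D[of s] supp[of s] r by (auto split: split_indicator intro!: powr_mono2)
  show L: "f \<in> Lq_space (ereal r)" by (rule Lq_space_continuous[OF f q le])
  have "(\<integral>s. norm (f s) powr r \<partial>lborel) \<le> (\<integral>s. indicator {0..1::real} s * D powr r \<partial>lborel)"
    by (rule integral_mono[OF _ q le]) (use L in \<open>simp add: Lq_space_def\<close>)
  then have "(\<integral>s. norm (f s) powr r \<partial>lborel) powr (1 / r) \<le> (D powr r) powr (1 / r)"
    using r by (intro powr_mono2) auto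
  then show "Lq_norm (ereal r) f \<le> D" using D0 r by (simp add: Lq_norm_def powr_powr)
qed

text \<open>The sum is at most \<open>Suc N\<close> times its largest term.\<close>
lemma sum_powr_le:
  fixes a :: "nat \<Rightarrow> real"
  assumes a: "\<And>i. 0 \<le> a i" and p: "0 < p"
  shows "(\<Sum>i\<le>N. a i) powr p \<le> real (Suc N) powr p * (\<Sum>i\<le>N. a i powr p)"
proof -
  obtain k where k: "k \<le> N" "\<And>i. i \<le> N \<Longrightarrow> a i \<le> a k"
  proof -
    have "Max (a ` {..N}) \<in> a ` {..N}" by (rule Max_in) auto
    then obtain k where "Max (a ` {..N}) = a k" "k \<in> {..N}" by (rule imageE)
    then show ?thesis by (intro that[of k]) (auto simp flip: \<open>Max (a ` {..N}) = a k\<close>)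
  qed
  have "(\<Sum>i\<le>N. a i) \<le> (\<Sum>i\<le>N. a k)" by (rule sum_mono) (use k in auto)
  then have "(\<Sum>i\<le>N. a i) powr p \<le> (real (Suc N) * a k) powr p"
    using a p by (intro powr_mono2) (auto intro: sum_nonneg)
  also have "\<dots> = real (Suc N) powr p * a k powr p" by (simp add: powr_mult a)
  also have "a k powr p \<le> (\<Sum>i\<le>N. a i powr p)" by (rule member_le_sum) (use k in auto)
  finally show ?thesis by (simp add: mult_left_mono)
qed

lemma hoelder_conj_cases:
  assumes "1 \<le> p"
  shows "hoelder_conj p = \<infinity> \<or> (\<exists>r>0. hoelder_conj p = ereal r)"
  using assms by (auto simp: hoelder_conj_def)

section \<open>Power weights against a decaying family\<close>

text \<open>An explicitly integrable bound for \<open>s powr - \<theta> / (s + m)\<close>: the denominator is replaced by \<open>m\<close> for \<open>s \<le> m\<close> and by \<open>s\<close> for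
\<open>s \<ge> m\<close>. What matters is that its integral is a constant times \<open>m powr - \<theta>\<close>.\<close>
definition pow_majorant :: "real \<Rightarrow> real \<Rightarrow> real \<Rightarrow> real" where
  "pow_majorant \<theta> m s = (if s \<in> {0..m} then s powr - \<theta> / m else 0) + (if s \<in> {m..} then s powr (- \<theta> - 1) else 0)"

lemma pow_majorant_has_integral:
  assumes "0 < \<theta>" "\<theta> < 1" "0 < m"
  shows "(pow_majorant \<theta> m has_integral (1 / (1 - \<theta>) + 1 / \<theta>) * m powr - \<theta>) {0<..}"
proof -
  have "((\<lambda>s. s powr - \<theta> / m) has_integral (m powr (- \<theta> + 1) / (- \<theta> + 1)) / m) {0..m}"
    using has_integral_powr_from_0[of "- \<theta>" m] assms by (intro has_integral_divide) auto
  moreover have "((\<lambda>s. s powr (- \<theta> - 1)) has_integral - (m powr (- \<theta> - 1 + 1)) / (- \<theta> - 1 + 1)) {m..}"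
    using assms by (intro has_integral_powr_to_inf) auto
  ultimately have "(pow_majorant \<theta> m has_integral (m powr (- \<theta> + 1) / (- \<theta> + 1)) / m + - (m powr (- \<theta> - 1 + 1)) / (- \<theta> - 1 + 1)) UNIV"
    unfolding pow_majorant_def[abs_def] by (intro has_integral_add) (simp_all only: has_integral_restrict_UNIV)
  moreover have "(m powr (- \<theta> + 1) / (- \<theta> + 1)) / m + - (m powr (- \<theta> - 1 + 1)) / (- \<theta> - 1 + 1) = (1 / (1 - \<theta>) + 1 / \<theta>) * m powr - \<theta>"
  proof -
    have "m powr (- \<theta> + 1) = m powr - \<theta> * m" using powr_add[of m "- \<theta>" 1] assms by simp
    then have "(m powr (- \<theta> + 1) / (- \<theta> + 1)) / m = 1 / (1 - \<theta>) * m powr - \<theta>" using assms by simp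
    moreover have "- (m powr (- \<theta> - 1 + 1)) / (- \<theta> - 1 + 1) = 1 / \<theta> * m powr - \<theta>" using assms by simp
    ultimately show ?thesis by (simp only: distrib_right)
  qed
  ultimately have "(pow_majorant \<theta> m has_integral (1 / (1 - \<theta>) + 1 / \<theta>) * m powr - \<theta>) UNIV" by simp
  moreover have "(\<lambda>s. if s \<in> {0<..} then pow_majorant \<theta> m s else 0) = pow_majorant \<theta> m"
    using assms by (auto simp: pow_majorant_def fun_eq_iff)
  ultimately show ?thesis using has_integral_restrict_UNIV[of "{0<..}" "pow_majorant \<theta> m"] by simp
qed

lemma pow_majorant_ge:
  assumes "0 < s" "0 < m"
  shows "s powr - \<theta> / (s + m) \<le> pow_majorant \<theta> m s"
proof (cases "s \<le> m")
  case True
  have "s powr - \<theta> / (s + m) \<le> s powr - \<theta> / m" using assms by (intro divide_left_mono) auto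
  then show ?thesis using True assms by (auto simp: pow_majorant_def intro: add_increasing2)
next
  case False
  have "s powr - \<theta> / (s + m) \<le> s powr - \<theta> / s" using assms by (intro divide_left_mono) auto
  also have "\<dots> = s powr (- \<theta> - 1)" using assms by (simp add: powr_diff)
  finally show ?thesis using False assms by (auto simp: pow_majorant_def)
qed

text \<open>At the singularity the integrand is, up to a continuous function, the derivative of the continuous function
\<open>s powr (1 - \<theta>) / (1 - \<theta>) *\<^sub>R G s\<close>, so the fundamental theorem of calculus applies. At infinity the integrand is dominated
by a multiple of \<open>s powr (- 1 - \<theta>)\<close>.\<close>
lemma powr_scaled_integrable_on:
  fixes G G' :: "real \<Rightarrow> 'a::banach"
  assumes th: "0 < \<theta>" "\<theta> < 1"
    and G: "\<And>s. 0 \<le> s \<Longrightarrow> (G has_vector_derivative G' s) (at s within {0..})" and G': "continuous_on {0..} G'"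
    and bd: "\<And>s. 1 \<le> s \<Longrightarrow> norm (G s) \<le> C / s"
  shows "(\<lambda>s. s powr - \<theta> *\<^sub>R G s) integrable_on {0<..}"
proof -
  define f where "f s = s powr - \<theta> *\<^sub>R G s" for s
  have Gc: "continuous_on {0..} G"
    using G by (meson atLeast_iff continuous_on_vector_derivative)
  have C: "0 \<le> C" using order_trans[OF norm_ge_zero bd[of 1]] by simp
  have cp: "continuous_on {0..1} (\<lambda>s. s powr (1 - \<theta>) / (1 - \<theta>))"
    using th by (intro continuous_on_divide continuous_on_powr' continuous_intros) auto
  have "((\<lambda>s. (s powr (1 - \<theta>) / (1 - \<theta>)) *\<^sub>R G' s + (s powr - \<theta>) *\<^sub>R G s) has_integral
      (1 powr (1 - \<theta>) / (1 - \<theta>)) *\<^sub>R G 1 - (0 powr (1 - \<theta>) / (1 - \<theta>)) *\<^sub>R G 0) {0..1}"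
  proof (rule fundamental_theorem_of_calculus_interior)
    show "continuous_on {0..1} (\<lambda>s. (s powr (1 - \<theta>) / (1 - \<theta>)) *\<^sub>R G s)"
      by (intro continuous_on_scaleR cp continuous_on_subset[OF Gc]) auto
    fix s :: real assume s: "s \<in> {0<..<1}"
    have "((\<lambda>s. s powr (1 - \<theta>) / (1 - \<theta>)) has_real_derivative s powr - \<theta>) (at s)"
      using s th by (auto intro!: derivative_eq_intros)
    moreover have "(G has_vector_derivative G' s) (at s)"
    proof -
      have "(G has_vector_derivative G' s) (at s within {0<..})"
        by (rule has_vector_derivative_within_subset[OF G]) (use s in auto)
      then show ?thesis using at_within_open[of s "{0<..}"] s by simp
    qed
    ultimately show "((\<lambda>s. (s powr (1 - \<theta>) / (1 - \<theta>)) *\<^sub>R G s) has_vector_derivative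
        (s powr (1 - \<theta>) / (1 - \<theta>)) *\<^sub>R G' s + (s powr - \<theta>) *\<^sub>R G s) (at s)"
      by (intro has_vector_derivative_scaleR)
  qed simp
  then have 1: "(\<lambda>s. (s powr (1 - \<theta>) / (1 - \<theta>)) *\<^sub>R G' s + f s) integrable_on {0..1}"
    unfolding f_def by blast
  have 2: "(\<lambda>s. (s powr (1 - \<theta>) / (1 - \<theta>)) *\<^sub>R G' s) integrable_on {0..1}"
    by (intro integrable_continuous_real continuous_on_scaleR cp continuous_on_subset[OF G']) auto
  have "(\<lambda>s. f s - s *\<^sub>R f 1) integrable_on {0..1}"
    using integrable_diff[OF integrable_diff[OF 1 2] integrable_continuous_real[of 0 1 "\<lambda>s. s *\<^sub>R f 1"]]
    by (simp add: continuous_intros)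
  then have near: "(\<lambda>s. if s \<in> {0..1} then f s - s *\<^sub>R f 1 else 0) integrable_on UNIV"
    by (simp only: integrable_restrict_UNIV)
  \<comment> \<open>the factor \<open>max 0 (min 1 s)\<close> continues \<open>f\<close> continuously to the whole line\<close>
  have far: "(\<lambda>s. max 0 (min 1 s) *\<^sub>R f (max 1 s)) integrable_on UNIV"
  proof (rule continuous_dominated_integrable_on_UNIV)
    have "continuous_on UNIV (\<lambda>s. G (max 1 s))"
      by (rule continuous_on_compose2[OF Gc]) (auto intro!: continuous_intros)
    then show "continuous_on UNIV (\<lambda>s. max 0 (min 1 s) *\<^sub>R f (max 1 s))"
      unfolding f_def by (intro continuous_intros) (auto intro!: continuous_intros)
    show "(\<lambda>s. (2 powr (1 + \<theta>) * C) * (1 + \<bar>s\<bar>) powr - (1 + \<theta>)) integrable_on UNIV"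
      using integrable_one_plus_abs_powr[of "1 + \<theta>"] th
      by (intro integrable_on_mult_right integrable_on_lborel) auto
    show "norm (max 0 (min 1 s) *\<^sub>R f (max 1 s)) \<le> (2 powr (1 + \<theta>) * C) * (1 + \<bar>s\<bar>) powr - (1 + \<theta>)" for s
    proof (cases "0 \<le> s")
      case True
      define r where "r = max 1 s"
      have r: "1 \<le> r" "(1 + \<bar>s\<bar>) / 2 \<le> r" using True by (auto simp: r_def)
      have "norm (max 0 (min 1 s) *\<^sub>R f (max 1 s)) \<le> norm (f r)"
        by (auto simp: r_def mult_left_le_one_le)
      also have "\<dots> \<le> r powr - \<theta> * (C / r)" unfolding f_def using mult_left_mono[OF bd[OF r(1)], of "r powr - \<theta>"] by simp
      also have "\<dots> = C * r powr - (1 + \<theta>)" using r by (simp add: powr_diff powr_minus divide_simps powr_add)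
      also have "\<dots> \<le> C * ((1 + \<bar>s\<bar>) / 2) powr - (1 + \<theta>)"
        using r th C by (intro mult_left_mono powr_mono2') auto
      also have "\<dots> = (2 powr (1 + \<theta>) * C) * (1 + \<bar>s\<bar>) powr - (1 + \<theta>)"
        by (simp add: powr_divide powr_minus field_simps powr_add powr_diff)
      finally show ?thesis .
    qed (use C in simp)
  qed
  have "(\<lambda>s. (if s \<in> {0..1} then f s - s *\<^sub>R f 1 else 0) + max 0 (min 1 s) *\<^sub>R f (max 1 s)) = (\<lambda>s. if s \<in> {0<..} then f s else 0)"
    by (rule ext) (auto simp: f_def max_def min_def not_le)
  then have "(\<lambda>s. if s \<in> {0<..} then f s else 0) integrable_on UNIV"
    using integrable_add[OF near far] by simp
  then show ?thesis by (simp only: integrable_restrict_UNIV f_def)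
qed

section \<open>Ramp functions built from polynomials\<close>

lemma power_Suc_dvd_pderiv:
  fixes p q :: "real poly"
  assumes "p ^ Suc k dvd q"
  shows "p ^ k dvd pderiv q"
proof -
  obtain r where "q = p ^ Suc k * r" using assms by (auto elim: dvdE)
  then have "pderiv q = p ^ Suc k * pderiv r + r * pderiv (p ^ Suc k)" by (simp only: pderiv_mult)
  moreover have "p ^ k dvd p ^ Suc k" by (rule le_imp_power_dvd) simp
  moreover have "pderiv (p ^ Suc k) = p ^ k * smult (of_nat (Suc k)) (pderiv p)"
    unfolding pderiv_power_Suc by (simp only: mult_smult_left mult_smult_right)
  ultimately show ?thesis by (metis dvd_add dvd_mult dvd_mult2 dvd_triv_left)
qed

text \<open>The \<open>j\<close>-th derivative of \<open>s\<^sup>J\<^sup>+\<^sup>1 (1 - s)\<^sup>J\<^sup>+\<^sup>1\<close>. The derivatives of order at most \<open>J\<close> vanish at 0 and 1, which is all the smoothness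
that finitely many integrations by parts on \<open>{0..1}\<close> ask for.\<close>
definition bump :: "nat \<Rightarrow> nat \<Rightarrow> real \<Rightarrow> real" where
  "bump J j = poly ((pderiv ^^ j) ([:0, 1:] ^ Suc J * [:1, -1:] ^ Suc J))"

lemma bump_has_derivative: "(bump J j has_real_derivative bump J (Suc j) s) (at s)"
  by (simp add: bump_def poly_DERIV)

lemma bump_continuous: "continuous_on S (bump J j)"
  by (rule DERIV_continuous_on[OF has_field_derivative_at_within[OF bump_has_derivative]])

lemma bump_ends:
  assumes "j \<le> J"
  shows "bump J j 0 = 0 \<and> bump J j 1 = 0"
proof -
  have *: "q ^ (Suc J - i) dvd (pderiv ^^ i) ([:0, 1:] ^ Suc J * [:1, -1:] ^ Suc J)"
    if "i \<le> Suc J" "q = [:0, 1:] \<or> q = [:1, -1:]" for i and q :: "real poly"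
    using that(1)
  proof (induction i)
    case 0
    then show ?case using that(2) by (auto simp del: power_Suc)
  next
    case (Suc i)
    then have "q ^ Suc (Suc J - Suc i) dvd (pderiv ^^ i) ([:0, 1:] ^ Suc J * [:1, -1:] ^ Suc J)"
      by (simp add: Suc_diff_le del: power_Suc)
    then show ?case using power_Suc_dvd_pderiv by simp
  qed
  have "q dvd (pderiv ^^ j) ([:0, 1:] ^ Suc J * [:1, -1:] ^ Suc J)" if "q = [:0, 1:] \<or> q = [:1, -1:]" for q :: "real poly"
  proof (rule dvd_trans)
    show "q dvd q ^ (Suc J - j)" by (rule dvd_power) (use assms in simp)
    show "q ^ (Suc J - j) dvd (pderiv ^^ j) ([:0, 1:] ^ Suc J * [:1, -1:] ^ Suc J)"
      by (rule *) (use assms that in auto)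
  qed
  moreover have "poly r x = 0" if "q dvd r" "poly q x = 0" for q r :: "real poly" and x
    using that by (auto elim: dvdE)
  ultimately show ?thesis unfolding bump_def by (metis poly_pCons mult_zero_left mult_zero_right poly_0 add_0 mult_1 add_0_right right_minus)
qed

lemma bump_pos: "0 < s \<Longrightarrow> s < 1 \<Longrightarrow> 0 < bump J 0 s"
  by (simp add: bump_def del: power_Suc)

definition cutoff :: "(real \<Rightarrow> real) \<Rightarrow> real \<Rightarrow> real" where
  "cutoff k s = k (max 0 (min 1 s))"

lemma cutoff_eq: "k 0 = 0 \<Longrightarrow> k 1 = 0 \<Longrightarrow> cutoff k s = (if s \<in> {0..1} then k s else 0)"
  by (auto simp: cutoff_def max_def min_def)

lemma cutoff_continuous: "continuous_on UNIV k \<Longrightarrow> continuous_on UNIV (cutoff k)"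
  unfolding cutoff_def by (rule continuous_on_compose2[of UNIV k]) (auto intro!: continuous_intros)

text \<open>The primitive of the bump on the half-line: zero up to 0 and constant from 1 on. The constant is not normalised.\<close>
definition ramp :: "nat \<Rightarrow> real \<Rightarrow> real" where
  "ramp J s = integral {0..max 0 s} (cutoff (bump J 0))"

lemma cutoff_bump:
  "continuous_on S (cutoff (bump J 0))" "cutoff (bump J 0) integrable_on {u..v}" "0 \<le> cutoff (bump J 0) s"
  "s \<in> {0..1} \<Longrightarrow> cutoff (bump J 0) s = bump J 0 s" "1 < s \<Longrightarrow> cutoff (bump J 0) s = 0"
proof -
  have e: "bump J 0 0 = 0" "bump J 0 1 = 0" using bump_ends[of 0 J] by simp_all
  show c: "continuous_on S (cutoff (bump J 0))" for S
    using cutoff_continuous[OF bump_continuous] continuous_on_subset by blast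
  show "cutoff (bump J 0) integrable_on {u..v}" by (rule integrable_continuous_real[OF c])
  show "0 \<le> cutoff (bump J 0) s"
  proof (cases "0 < s \<and> s < 1")
    case True
    then show ?thesis using bump_pos[of s J] by (simp add: cutoff_eq[of "bump J 0"] e)
  next
    case False
    then show ?thesis by (auto simp: cutoff_def max_def min_def e)
  qed
  show "s \<in> {0..1} \<Longrightarrow> cutoff (bump J 0) s = bump J 0 s" "1 < s \<Longrightarrow> cutoff (bump J 0) s = 0"
    by (simp_all add: cutoff_eq[of "bump J 0"] e)
qed

lemma ramp_has_derivative:
  assumes "0 \<le> s"
  shows "(ramp J has_real_derivative cutoff (bump J 0) s) (at s within {0..})"
proof -
  have "((\<lambda>x. integral {0..x} (cutoff (bump J 0))) has_real_derivative cutoff (bump J 0) s) (at s within {0..s + 1})"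
    using assms by (intro integral_has_real_derivative cutoff_bump) auto
  moreover have "at s within {0..s + 1} = at s within {0..}"
    by (rule at_within_nhd[of s "{..<s + 1}"]) auto
  ultimately have "((\<lambda>x. integral {0..x} (cutoff (bump J 0))) has_real_derivative cutoff (bump J 0) s) (at s within {0..})" by simp
  then show ?thesis
    by (rule has_field_derivative_transform_within[OF _ zero_less_one]) (use assms in \<open>auto simp: ramp_def\<close>)
qed

lemma ramp_nonpos: "s \<le> 0 \<Longrightarrow> ramp J s = 0"
  by (simp add: ramp_def)

lemma ramp_continuous: "continuous_on UNIV (ramp J)"
proof -
  have "continuous_on {0..} (ramp J)" by (rule DERIV_continuous_on[OF ramp_has_derivative]) simp
  then have "continuous_on UNIV (\<lambda>s. ramp J (max 0 s))"
    by (rule continuous_on_compose2) (auto intro!: continuous_intros)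
  then show ?thesis by (simp add: ramp_def)
qed

lemma ramp_mono: "s \<le> t \<Longrightarrow> ramp J s \<le> ramp J t"
  unfolding ramp_def by (rule integral_subset_le) (auto intro: cutoff_bump)

lemma ramp_eventually_const:
  assumes "1 \<le> s"
  shows "ramp J s = ramp J 1"
proof -
  have "integral {0..s} (cutoff (bump J 0)) = integral {0..1} (cutoff (bump J 0)) + integral {1..s} (cutoff (bump J 0))"
    using assms by (intro Henstock_Kurzweil_Integration.integral_combine[symmetric] cutoff_bump) auto
  also have "integral {1..s} (cutoff (bump J 0)) = integral {1..s} (\<lambda>_. 0)"
    by (rule integral_spike[of "{1}"]) (auto simp: cutoff_bump)
  finally show ?thesis using assms by (simp add: ramp_def)
qed

lemma ramp_bounds: "0 \<le> ramp J s" "\<bar>ramp J s\<bar> \<le> ramp J 1"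
proof -
  show 0: "0 \<le> ramp J s" for s unfolding ramp_def by (rule integral_nonneg) (auto intro: cutoff_bump)
  show "\<bar>ramp J s\<bar> \<le> ramp J 1"
    using 0[of s] ramp_mono[of s 1 J] ramp_eventually_const[of s J] by (cases "s \<le> 1") auto
qed

lemma ramp_pos: "0 < ramp J 1"
proof -
  have "ramp J 1 \<noteq> 0"
  proof
    assume "ramp J 1 = 0"
    then have "(cutoff (bump J 0) has_integral 0) (cbox 0 1)"
      using integrable_integral[OF cutoff_bump(2)[of J 0 1]] by (simp add: ramp_def)
    then have "cutoff (bump J 0) (1/2) = 0"
      by (rule has_integral_0_cbox_imp_0[rotated 2]) (auto intro: cutoff_bump)
    then show False using bump_pos[of "1/2" J] by (simp add: cutoff_bump)
  qed
  then show ?thesis using ramp_bounds(1)[of J 1] by simp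
qed

section \<open>Semigroups with a resolvent bound on the right half-plane\<close>

text \<open>This makes the product rule and the continuity rules available for scalar multiplication.\<close>
lemma bounded_bilinear_scaleC: "bounded_bilinear (scaleC :: complex \<Rightarrow> 'a::complex_normed_vector \<Rightarrow> 'a)"
proof
  show "\<exists>K. \<forall>a b. norm (a *\<^sub>C (b::'a)) \<le> norm a * norm b * K"
    by (intro exI[of _ 1]) (simp add: norm_scaleC)
qed (simp_all add: scaleC_add_left scaleC_add_right scaleR_conv_of_real scaleC_scaleC mult.commute flip: scaleC_of_real)

interpretation scaleC: bounded_bilinear "scaleC :: complex \<Rightarrow> 'a::complex_normed_vector \<Rightarrow> 'a"
  by (rule bounded_bilinear_scaleC)

lemmas [continuous_intros] = scaleC.continuous scaleC.continuous_on
lemmas [tendsto_intros] = scaleC.tendsto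

lemma bounded_clinear_scaleC: "bounded_clinear S \<Longrightarrow> S (c *\<^sub>C x) = c *\<^sub>C S x"
  by (simp add: bounded_clinear_def)

lemma bounded_clinearD: "bounded_clinear S \<Longrightarrow> bounded_linear S"
  by (simp add: bounded_clinear_def)

text \<open>The difference quotient is the form in which semigroup and resolvent identities present derivatives.\<close>
lemma has_vector_derivative_of_quotient:
  fixes f :: "real \<Rightarrow> 'a::real_normed_vector"
  assumes "((\<lambda>r. (1 / (r - s)) *\<^sub>R (f r - f s)) \<longlongrightarrow> d) (at s within S)"
  shows "(f has_vector_derivative d) (at s within S)"
proof -
  have "((\<lambda>r. (1 / norm (r - s)) *\<^sub>R (f r - (f s + (r - s) *\<^sub>R d))) \<longlongrightarrow> 0) (at s within S)"
  proof (rule tendsto_norm_zero_cancel, rule Lim_transform_eventually)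
    show "((\<lambda>r. norm ((1 / (r - s)) *\<^sub>R (f r - f s) - d)) \<longlongrightarrow> 0) (at s within S)"
      using tendsto_norm_zero[OF LIM_zero[OF assms]] .
    have "norm ((1 / (r - s)) *\<^sub>R (f r - f s) - d) = norm ((1 / norm (r - s)) *\<^sub>R (f r - (f s + (r - s) *\<^sub>R d)))"
      if "r \<noteq> s" for r
    proof -
      have "(1 / (r - s)) *\<^sub>R (f r - f s) - d = (1 / (r - s)) *\<^sub>R (f r - (f s + (r - s) *\<^sub>R d))"
        using that by (simp add: scaleR_diff_right scaleR_add_right)
      then show ?thesis by simp
    qed
    then show "\<forall>\<^sub>F r in at s within S. norm ((1 / (r - s)) *\<^sub>R (f r - f s) - d) = norm ((1 / norm (r - s)) *\<^sub>R (f r - (f s + (r - s) *\<^sub>R d)))"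
      by (auto simp: eventually_at intro!: exI[of _ 1])
  qed
  then show ?thesis
    unfolding has_vector_derivative_def has_derivative_within by (simp add: bounded_linear_scaleR_left)
qed

text \<open>A \<open>C\<^sub>0\<close>-semigroup whose generator is \<open>- A\<close>, where \<open>A\<close> is given only through the operators \<open>R z = (z + A)\<^sup>-\<^sup>1\<close> for
\<open>Re z > 0\<close>. The growth exponent \<open>w\<close> may be larger than the growth bound; it is taken nonnegative so that \<open>R\<close> is
available to the right of it.\<close>
locale resolvent_semigroup =
  fixes T :: "real \<Rightarrow> 'a::complex_banach \<Rightarrow> 'a" and R :: "complex \<Rightarrow> 'a \<Rightarrow> 'a"
    and M w :: real and g :: "real \<Rightarrow> real"
  assumes semigroup: "C0_semigroup T"
    and growth: "\<And>t x. 0 \<le> t \<Longrightarrow> norm (T t x) \<le> M * exp (w * t) * norm x"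
    and M_nonneg: "0 \<le> M" and w_nonneg: "0 \<le> w"
    and R_clinear: "\<And>z. 0 < Re z \<Longrightarrow> bounded_clinear (R z)"
    and R_in_generator: "\<And>z y. 0 < Re z \<Longrightarrow> (R z y, z *\<^sub>C R z y - y) \<in> generator T"
    and R_of_generator: "\<And>z x y. 0 < Re z \<Longrightarrow> (x, y) \<in> generator T \<Longrightarrow> R z (z *\<^sub>C x - y) = x"
    and R_bound: "\<And>z x. 0 < Re z \<Longrightarrow> norm (R z x) \<le> g (inverse (Re z)) * norm x"
    and g_mono: "mono_on {0<..} g"
begin

lemma T_linear: "0 \<le> t \<Longrightarrow> bounded_linear (T t)"
  and T_scaleC: "0 \<le> t \<Longrightarrow> T t (c *\<^sub>C x) = c *\<^sub>C T t x"
  using semigroup unfolding C0_semigroup_def bounded_clinear_def by blast+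

lemma T_zero [simp]: "T 0 x = x"
  and T_add: "0 \<le> s \<Longrightarrow> 0 \<le> t \<Longrightarrow> T (s + t) x = T s (T t x)"
  and T_tendsto_0: "((\<lambda>t. T t x) \<longlongrightarrow> x) (at_right 0)"
  using semigroup unfolding C0_semigroup_def by auto

lemma T_diff: "0 \<le> t \<Longrightarrow> T t (x - y) = T t x - T t y"
  by (rule bounded_linear.linear[OF T_linear, THEN linear_diff])

lemma T_scaleR: "0 \<le> t \<Longrightarrow> T t (c *\<^sub>R x) = c *\<^sub>R T t x"
  by (rule bounded_linear.linear[OF T_linear, THEN linear_scale])

lemma R_linear: "0 < Re z \<Longrightarrow> bounded_linear (R z)"
  and R_scaleC: "0 < Re z \<Longrightarrow> R z (c *\<^sub>C x) = c *\<^sub>C R z x"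
  using R_clinear unfolding bounded_clinear_def by blast+

lemma R_diff: "0 < Re z \<Longrightarrow> R z (x - y) = R z x - R z y"
  by (rule bounded_linear.linear[OF R_linear, THEN linear_diff])

lemma R_add: "0 < Re z \<Longrightarrow> R z (x + y) = R z x + R z y"
  by (rule bounded_linear.linear[OF R_linear, THEN linear_add])

lemma R_scaleR: "0 < Re z \<Longrightarrow> R z (c *\<^sub>R x) = c *\<^sub>R R z x"
  by (rule bounded_linear.linear[OF R_linear, THEN linear_scale])

lemma growth_upto: "0 \<le> t \<Longrightarrow> t \<le> L \<Longrightarrow> norm (T t x) \<le> M * exp (w * L) * norm x"
  by (rule order_trans[OF growth]) (use w_nonneg M_nonneg in \<open>auto intro!: mult_right_mono mult_left_mono\<close>)

lemma R_bound_right: "0 < a \<Longrightarrow> a \<le> Re z \<Longrightarrow> norm (R z x) \<le> g (inverse a) * norm x"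
  by (rule order_trans[OF R_bound])
    (auto intro!: mult_right_mono mono_onD[OF g_mono] le_imp_inverse_le)

lemma resolvent_identity:
  assumes "0 < Re z" "0 < Re \<mu>"
  shows "R z y - R \<mu> y = (\<mu> - z) *\<^sub>C R z (R \<mu> y)"
proof -
  have "R z (z *\<^sub>C R \<mu> y - (\<mu> *\<^sub>C R \<mu> y - y)) = R \<mu> y"
    by (rule R_of_generator[OF assms(1) R_in_generator[OF assms(2)]])
  moreover have "z *\<^sub>C R \<mu> y - (\<mu> *\<^sub>C R \<mu> y - y) = y - (\<mu> - z) *\<^sub>C R \<mu> y"
    by (simp add: scaleC.diff_left)
  ultimately have "R z y - (\<mu> - z) *\<^sub>C R z (R \<mu> y) = R \<mu> y" using assms by (simp add: R_diff R_scaleC)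
  then have "R z y = R \<mu> y + (\<mu> - z) *\<^sub>C R z (R \<mu> y)" by (simp only: diff_eq_eq)
  then show ?thesis by simp
qed

lemma R_commute:
  assumes "0 < Re z" "0 < Re \<mu>"
  shows "R z (R \<mu> y) = R \<mu> (R z y)"
proof (cases "z = \<mu>")
  case False
  have "(\<mu> - z) *\<^sub>C R z (R \<mu> y) = (\<mu> - z) *\<^sub>C R \<mu> (R z y)"
    using resolvent_identity[OF assms, of y] resolvent_identity[OF assms(2,1), of y]
    by (metis minus_diff_eq scaleC.minus_left)
  then have "(1 / (\<mu> - z)) *\<^sub>C ((\<mu> - z) *\<^sub>C R z (R \<mu> y)) = (1 / (\<mu> - z)) *\<^sub>C ((\<mu> - z) *\<^sub>C R \<mu> (R z y))" by simp
  then show ?thesis using False by (simp add: scaleC_scaleC scaleC_one)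
qed simp

lemma R_injective:
  assumes "0 < Re z" "R z y = 0"
  shows "y = 0"
proof -
  have "(0, - y) \<in> generator T" using R_in_generator[OF assms(1), of y] assms(2) by (simp add: scaleC.zero_right)
  moreover have "(0, 0) \<in> generator T"
  proof -
    have "\<forall>\<^sub>F t in at_right (0::real). (1 / t) *\<^sub>R (T t 0 - 0) = 0"
      unfolding eventually_at_right_field
      by (auto intro!: exI[of _ 1] simp: linear_0[OF bounded_linear.linear[OF T_linear]])
    then show ?thesis unfolding generator_def by (simp add: tendsto_eventually)
  qed
  ultimately have "- y = 0"
    unfolding generator_def using tendsto_unique[OF trivial_limit_at_right_real] by blast
  then show ?thesis by simp
qed

lemma T_generator:
  assumes "0 \<le> s" "(x, y) \<in> generator T"
  shows "(T s x, T s y) \<in> generator T"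
proof -
  have "((\<lambda>t. T s ((1 / t) *\<^sub>R (T t x - x))) \<longlongrightarrow> T s y) (at_right 0)"
    using assms by (intro bounded_linear.tendsto[OF T_linear]) (auto simp: generator_def)
  moreover have "\<forall>\<^sub>F t in at_right (0::real). T s ((1 / t) *\<^sub>R (T t x - x)) = (1 / t) *\<^sub>R (T t (T s x) - T s x)"
    unfolding eventually_at_right_field
    using assms T_add[of s _ x] T_add[of _ s x] by (auto intro!: exI[of _ 1] simp: T_scaleR T_diff add.commute)
  ultimately show ?thesis unfolding generator_def by (auto elim: Lim_transform_eventually)
qed

lemma R_T_commute:
  assumes "0 < Re z" "0 \<le> s"
  shows "R z (T s y) = T s (R z y)"
proof -
  have "R z (z *\<^sub>C T s (R z y) - T s (z *\<^sub>C R z y - y)) = T s (R z y)"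
    by (rule R_of_generator[OF assms(1) T_generator[OF assms(2) R_in_generator[OF assms(1)]]])
  then show ?thesis using assms by (simp add: T_diff T_scaleC)
qed

lemma T_continuous: "continuous_on {0..} (\<lambda>t. T t x)"
  unfolding continuous_on_iff
proof (intro ballI allI impI)
  fix t0 e :: real assume t0: "t0 \<in> {0..}" and e: "0 < e"
  define L where "L = M * exp (w * (t0 + 1)) + 1"
  have L: "0 < L" using M_nonneg by (simp add: L_def add_nonneg_pos)
  obtain d where d: "0 < d" and hd: "\<And>h. 0 < h \<Longrightarrow> h < d \<Longrightarrow> dist (T h x) x < e / L"
    using tendstoD[OF T_tendsto_0[of x], of "e / L"] e L unfolding eventually_at_right_field by auto
  show "\<exists>d>0. \<forall>t\<in>{0..}. dist t t0 < d \<longrightarrow> dist (T t x) (T t0 x) < e"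
  proof (intro exI[of _ "min d 1"] conjI ballI impI)
    fix t :: real assume t: "t \<in> {0..}" "dist t t0 < min d 1"
    show "dist (T t x) (T t0 x) < e"
    proof (cases "t = t0")
      case False
      define m where "m = min t t0" define h where "h = \<bar>t - t0\<bar>"
      have m: "0 \<le> m" "m \<le> t0 + 1" and h: "0 < h" "h < d" using t t0 False by (auto simp: m_def h_def dist_real_def)
      have "norm (T t x - T t0 x) = norm (T (m + h) x - T m x)"
        by (auto simp: m_def h_def min_def norm_minus_commute)
      also have "\<dots> = norm (T m (T h x - x))" using m h by (simp add: T_add T_diff)
      also have "\<dots> \<le> M * exp (w * (t0 + 1)) * norm (T h x - x)" by (rule growth_upto[OF m])
      also have "\<dots> \<le> L * norm (T h x - x)" by (simp add: L_def mult_right_mono)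
      also have "\<dots> < e" using hd[OF h] L by (simp add: dist_norm field_simps)
      finally show ?thesis by (simp add: dist_norm)
    qed (use e in simp)
  qed (use d in auto)
qed

text \<open>Strong continuity is joint continuity because the semigroup is bounded on bounded time intervals.\<close>
lemma T_tendsto:
  assumes a: "(a \<longlongrightarrow> a0) F" and nn: "\<And>i. 0 \<le> a i" and v: "(v \<longlongrightarrow> v0) F"
  shows "((\<lambda>i. T (a i) (v i)) \<longlongrightarrow> T a0 v0) F"
proof (cases "F = bot")
  case False
  have a0: "0 \<le> a0" by (rule tendsto_lowerbound[OF a _ False]) (use nn in simp)
  define L where "L = M * exp (w * (a0 + 1))"
  have "((\<lambda>i. T (a i) v0) \<longlongrightarrow> T a0 v0) F"
    by (rule continuous_on_tendsto_compose[OF T_continuous a]) (use a0 nn in auto)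
  moreover have "((\<lambda>i. T (a i) (v i) - T (a i) v0) \<longlongrightarrow> 0) F"
  proof (rule Lim_null_comparison)
    have "\<forall>\<^sub>F i in F. a i < a0 + 1" by (rule order_tendstoD(2)[OF a]) simp
    then show "\<forall>\<^sub>F i in F. norm (T (a i) (v i) - T (a i) v0) \<le> L * norm (v i - v0)"
      by eventually_elim (use nn in \<open>simp add: L_def growth_upto flip: T_diff\<close>)
    show "((\<lambda>i. L * norm (v i - v0)) \<longlongrightarrow> 0) F"
      by (rule tendsto_mult_right_zero[OF tendsto_norm_zero[OF LIM_zero[OF v]]])
  qed
  ultimately show ?thesis using tendsto_add by fastforce
qed simp

text \<open>For \<open>r\<close> on either side of \<open>s\<close>, the difference quotient is \<open>T (min r s)\<close> applied to the quotient at 0 of step \<open>\<bar>r - s\<bar>\<close>.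
This gives the two-sided derivative although the generator is defined by a limit from the right.\<close>
lemma T_has_vector_derivative:
  assumes xy: "(x, y) \<in> generator T" and s: "0 \<le> s"
  shows "((\<lambda>t. T t x) has_vector_derivative T s y) (at s within {0..})"
proof (rule has_vector_derivative_of_quotient)
  define q where "q h = (1 / h) *\<^sub>R (T h x - x)" for h
  have q: "(q \<longlongrightarrow> y) (at_right 0)" using xy by (simp add: generator_def q_def[abs_def])
  have abs: "filterlim (\<lambda>r. \<bar>r - s\<bar>) (at_right 0) (at s within {0..})"
    unfolding filterlim_at
  proof
    show "\<forall>\<^sub>F r in at s within {0..}. \<bar>r - s\<bar> \<in> {0<..} \<and> \<bar>r - s\<bar> \<noteq> 0"
      by (auto simp: eventually_at intro!: exI[of _ 1])
    show "((\<lambda>r. \<bar>r - s\<bar>) \<longlongrightarrow> 0) (at s within {0..})" by (auto intro!: tendsto_eq_intros)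
  qed
  have "((\<lambda>r. T (max 0 (min r s)) (q \<bar>r - s\<bar>)) \<longlongrightarrow> T (max 0 (min s s)) y) (at s within {0..})"
    by (intro T_tendsto filterlim_compose[OF q abs] tendsto_intros) auto
  then have lim: "((\<lambda>r. T (max 0 (min r s)) (q \<bar>r - s\<bar>)) \<longlongrightarrow> T s y) (at s within {0..})" using s by simp
  have "T (max 0 (min r s)) (q \<bar>r - s\<bar>) = (1 / (r - s)) *\<^sub>R (T r x - T s x)" if r: "r \<in> {0..}" "r \<noteq> s" for r
  proof (cases "r < s")
    case True
    then have "T r (q (s - r)) = (1 / (s - r)) *\<^sub>R (T s x - T r x)"
      using r s T_add[of r "s - r" x] by (simp add: q_def T_scaleR T_diff)
    also have "\<dots> = (1 / (r - s)) *\<^sub>R (T r x - T s x)"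
    proof -
      have "1 / (s - r) = 1 / (- (r - s))" by simp
      also have "\<dots> = - (1 / (r - s))" by (rule minus_divide_right[symmetric])
      finally show ?thesis by (simp only: scaleR_minus_left scaleR_diff_right) simp
    qed
    finally show ?thesis using True r by simp
  next
    case False
    then show ?thesis using r s T_add[of s "r - s" x] by (simp add: q_def T_scaleR T_diff)
  qed
  then have "\<forall>\<^sub>F r in at s within {0..}. T (max 0 (min r s)) (q \<bar>r - s\<bar>) = (1 / (r - s)) *\<^sub>R (T r x - T s x)"
    by (auto simp: eventually_at intro!: exI[of _ 1])
  then show "((\<lambda>r. (1 / (r - s)) *\<^sub>R (T r x - T s x)) \<longlongrightarrow> T s y) (at s within {0..})"
    by (rule Lim_transform_eventually[OF lim])
qed

lemma weighted_orbit_integrable: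
  fixes k :: "real \<Rightarrow> complex"
  assumes "continuous_on {0..N} k"
  shows "(\<lambda>s. k s *\<^sub>C T s y) integrable_on {0..N}"
  by (intro integrable_continuous_real continuous_intros assms continuous_on_subset[OF T_continuous]) auto

text \<open>Integrate the derivative of \<open>k s *\<^sub>C T s (R \<mu> y)\<close>, which involves only vectors in the domain of the generator, and use that
\<open>R \<mu>\<close> commutes with the integral. Written this way the identity holds for every \<open>y\<close>, without density or closedness
arguments.\<close>
lemma orbit_integration_by_parts:
  fixes k k' :: "real \<Rightarrow> complex"
  assumes N: "0 \<le> N" and \<mu>: "0 < Re \<mu>"
    and k: "\<And>s. s \<in> {0..N} \<Longrightarrow> (k has_vector_derivative k' s) (at s within {0..N})"
    and k': "continuous_on {0..N} k'"
  shows "integral {0..N} (\<lambda>s. k s *\<^sub>C T s y)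
     = R \<mu> (\<mu> *\<^sub>C integral {0..N} (\<lambda>s. k s *\<^sub>C T s y) + integral {0..N} (\<lambda>s. k' s *\<^sub>C T s y)
          - k N *\<^sub>C T N y + k 0 *\<^sub>C y)"
proof -
  have kc: "continuous_on {0..N} k"
    using k by (meson continuous_on_vector_derivative)
  note I = weighted_orbit_integrable[OF kc] and I' = weighted_orbit_integrable[OF k']
  define J J' where "J = integral {0..N} (\<lambda>s. k s *\<^sub>C T s y)" and "J' = integral {0..N} (\<lambda>s. k' s *\<^sub>C T s y)"
  have "((\<lambda>s. k s *\<^sub>C T s (\<mu> *\<^sub>C R \<mu> y - y) + k' s *\<^sub>C T s (R \<mu> y)) has_integral k N *\<^sub>C T N (R \<mu> y) - k 0 *\<^sub>C T 0 (R \<mu> y)) {0..N}"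
  proof (rule fundamental_theorem_of_calculus[OF N])
    fix s assume s: "s \<in> {0..N}"
    have "((\<lambda>t. T t (R \<mu> y)) has_vector_derivative T s (\<mu> *\<^sub>C R \<mu> y - y)) (at s within {0..N})"
      by (rule has_vector_derivative_within_subset[OF T_has_vector_derivative[OF R_in_generator[OF \<mu>]]]) (use s in auto)
    then show "((\<lambda>s. k s *\<^sub>C T s (R \<mu> y)) has_vector_derivative k s *\<^sub>C T s (\<mu> *\<^sub>C R \<mu> y - y) + k' s *\<^sub>C T s (R \<mu> y)) (at s within {0..N})"
      by (rule scaleC.has_vector_derivative[OF k[OF s]])
  qed
  moreover have "((\<lambda>s. R \<mu> (\<mu> *\<^sub>C (k s *\<^sub>C T s y)) - k s *\<^sub>C T s y + R \<mu> (k' s *\<^sub>C T s y)) has_integral R \<mu> (\<mu> *\<^sub>C J) - J + R \<mu> J') {0..N}"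
    unfolding J_def J'_def
    by (intro has_integral_add has_integral_diff integrable_integral I I'
        has_integral_linear[OF _ R_linear[OF \<mu>], unfolded o_def]
        has_integral_linear[OF _ scaleC.bounded_linear_right, unfolded o_def])
  then have "((\<lambda>s. k s *\<^sub>C T s (\<mu> *\<^sub>C R \<mu> y - y) + k' s *\<^sub>C T s (R \<mu> y)) has_integral R \<mu> (\<mu> *\<^sub>C J) - J + R \<mu> J') {0..N}"
  proof (rule has_integral_eq[rotated])
    fix s assume "s \<in> {0..N}"
    then show "R \<mu> (\<mu> *\<^sub>C (k s *\<^sub>C T s y)) - k s *\<^sub>C T s y + R \<mu> (k' s *\<^sub>C T s y) = k s *\<^sub>C T s (\<mu> *\<^sub>C R \<mu> y - y) + k' s *\<^sub>C T s (R \<mu> y)"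
      using \<mu> by (simp add: R_scaleC T_diff T_scaleC R_T_commute scaleC.diff_right scaleC_scaleC mult.commute)
  qed
  ultimately have "k N *\<^sub>C T N (R \<mu> y) - k 0 *\<^sub>C T 0 (R \<mu> y) = R \<mu> (\<mu> *\<^sub>C J) - J + R \<mu> J'"
    by (rule has_integral_unique)
  then have "J = R \<mu> (\<mu> *\<^sub>C J + J' - k N *\<^sub>C T N y + k 0 *\<^sub>C y)"
    using \<mu> N by (simp add: R_add R_diff R_scaleC R_T_commute algebra_simps)
  then show ?thesis unfolding J_def J'_def .
qed

end

section \<open>Truncated Laplace transforms of orbits\<close>

context resolvent_semigroup
begin

text \<open>The Laplace transform of the orbit of \<open>y\<close>, weighted by \<open>k\<close> and truncated at time \<open>N\<close>. It is entire in \<open>z\<close>.\<close>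
definition lap :: "real \<Rightarrow> (real \<Rightarrow> real) \<Rightarrow> complex \<Rightarrow> 'a \<Rightarrow> 'a" where
  "lap N k z y = integral {0..N} (\<lambda>s. (of_real (k s) * exp (- (z * of_real s))) *\<^sub>C T s y)"

lemma lap_integrable:
  assumes "continuous_on {0..N} k"
  shows "(\<lambda>s. (of_real (k s) * exp (- (z * of_real s))) *\<^sub>C T s y) integrable_on {0..N}"
  by (rule weighted_orbit_integrable) (intro continuous_intros assms)

lemma lap_integration_by_parts:
  assumes N: "0 \<le> N" and \<mu>: "0 < Re \<mu>"
    and k: "\<And>s. s \<in> {0..N} \<Longrightarrow> (k has_real_derivative k' s) (at s within {0..N})"
    and k': "continuous_on {0..N} k'"
  shows "lap N k z y = R \<mu> ((\<mu> - z) *\<^sub>C lap N k z y + lap N k' z y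
       - (of_real (k N) * exp (- (z * of_real N))) *\<^sub>C T N y + of_real (k 0) *\<^sub>C y)"
proof -
  have kc: "continuous_on {0..N} k" using k by (meson DERIV_continuous_on)
  define e where "e s = exp (- (z * of_real s))" for s :: real
  have ec: "continuous_on {0..N} e" unfolding e_def by (intro continuous_intros)
  have der: "((\<lambda>s. of_real (k s) * e s) has_vector_derivative of_real (k' s) * e s - z * (of_real (k s) * e s)) (at s within {0..N})"
    if "s \<in> {0..N}" for s
  proof -
    have "((\<lambda>s. complex_of_real (k s)) has_vector_derivative of_real (k' s)) (at s within {0..N})"
      by (rule has_vector_derivative_of_real[OF k[OF that]])
    moreover have "(e has_vector_derivative - z * e s) (at s within {0..N})"
    proof -
      have "((\<lambda>x. exp (- (z * x))) has_field_derivative - z * exp (- (z * of_real s))) (at (of_real s))"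
        by (auto intro!: derivative_eq_intros)
      from has_vector_derivative_real_field[OF this] show ?thesis
        unfolding e_def by (rule has_vector_derivative_at_within)
    qed
    ultimately show ?thesis
      using has_vector_derivative_mult by (fastforce simp: algebra_simps)
  qed
  have int_eq: "integral {0..N} (\<lambda>s. (of_real (k' s) * e s - z * (of_real (k s) * e s)) *\<^sub>C T s y) = lap N k' z y - z *\<^sub>C lap N k z y"
  proof -
    have "((\<lambda>s. (of_real (k' s) * e s) *\<^sub>C T s y - z *\<^sub>C ((of_real (k s) * e s) *\<^sub>C T s y)) has_integral lap N k' z y - z *\<^sub>C lap N k z y) {0..N}"
      unfolding lap_def e_def
      by (intro has_integral_diff has_integral_linear[OF _ scaleC.bounded_linear_right, unfolded o_def] integrable_integral lap_integrable kc k')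
    then show ?thesis by (simp add: integral_unique scaleC.diff_left scaleC_scaleC)
  qed
  have main: "lap N k z y = R \<mu> (\<mu> *\<^sub>C lap N k z y + integral {0..N} (\<lambda>s. (of_real (k' s) * e s - z * (of_real (k s) * e s)) *\<^sub>C T s y)
          - (of_real (k N) * e N) *\<^sub>C T N y + (of_real (k 0) * e 0) *\<^sub>C y)"
    unfolding lap_def e_def[symmetric]
    by (rule orbit_integration_by_parts[OF N \<mu> der], assumption) (intro continuous_intros k' kc ec)
  show ?thesis using main unfolding int_eq by (simp add: e_def scaleC.diff_left algebra_simps)
qed

lemma lap_norm_le:
  assumes N: "0 \<le> N" and k: "continuous_on {0..N} k" and le: "\<And>s. s \<in> {0..N} \<Longrightarrow> \<bar>k s\<bar> \<le> B" and z: "0 \<le> Re z"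
  shows "norm (lap N k z y) \<le> N * (B * (M * exp (w * N) * norm y))"
proof -
  have "norm (lap N k z y) \<le> integral {0..N} (\<lambda>s. B * (M * exp (w * N) * norm y))"
    unfolding lap_def
  proof (rule integral_norm_bound_integral[OF lap_integrable[OF k]])
    fix s assume s: "s \<in> {0..N}"
    have "\<bar>k s\<bar> * norm (exp (- (z * of_real s))) \<le> B * 1"
      using s z le[OF s] by (intro mult_mono) auto
    then show "norm ((of_real (k s) * exp (- (z * of_real s))) *\<^sub>C T s y) \<le> B * (M * exp (w * N) * norm y)"
      unfolding norm_scaleC norm_mult norm_of_real
      using s growth_upto[of s N y] by (intro mult_mono) (auto intro: order_trans[OF abs_ge_zero le[OF s]])
  qed (rule integrable_const_ivl)
  then show ?thesis using N by (simp add: mult_ac)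
qed

lemma lap_R_commute:
  assumes "continuous_on {0..N} k" "0 < Re \<mu>"
  shows "lap N k z (R \<mu> y) = R \<mu> (lap N k z y)"
proof -
  have "((\<lambda>s. R \<mu> ((of_real (k s) * exp (- (z * of_real s))) *\<^sub>C T s y)) has_integral R \<mu> (lap N k z y)) {0..N}"
    unfolding lap_def by (rule has_integral_linear[OF integrable_integral[OF lap_integrable[OF assms(1)]] R_linear[OF assms(2)], unfolded o_def])
  then have "((\<lambda>s. (of_real (k s) * exp (- (z * of_real s))) *\<^sub>C T s (R \<mu> y)) has_integral R \<mu> (lap N k z y)) {0..N}"
    by (rule has_integral_eq[rotated]) (use assms(2) in \<open>simp add: R_scaleC R_T_commute\<close>)
  then show ?thesis unfolding lap_def by (rule integral_unique)
qed

lemma lap_linear: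
  assumes N: "0 \<le> N" and k: "continuous_on {0..N} k" and z: "0 \<le> Re z"
  shows "bounded_linear (lap N k z)"
proof -
  obtain B where "\<forall>x\<in>k ` {0..N}. norm x \<le> B"
    using compact_continuous_image[OF k compact_Icc, THEN compact_imp_bounded] unfolding bounded_iff by blast
  then have B: "\<And>s. s \<in> {0..N} \<Longrightarrow> \<bar>k s\<bar> \<le> B" by simp
  show ?thesis
  proof (rule bounded_linear_intro[where K="N * (B * (M * exp (w * N)))"])
    have "lap N k z (x + y) = integral {0..N} (\<lambda>s. (of_real (k s) * exp (- (z * of_real s))) *\<^sub>C T s x + (of_real (k s) * exp (- (z * of_real s))) *\<^sub>C T s y)" for x y
      unfolding lap_def by (rule integral_cong) (simp add: linear_add[OF bounded_linear.linear[OF T_linear]] scaleC.add_right)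
    then show "lap N k z (x + y) = lap N k z x + lap N k z y" for x y
      unfolding lap_def by (simp add: integral_add lap_integrable[OF k])
    have "lap N k z (r *\<^sub>R x) = integral {0..N} (\<lambda>s. r *\<^sub>R ((of_real (k s) * exp (- (z * of_real s))) *\<^sub>C T s x))" for r x
      unfolding lap_def by (rule integral_cong) (simp add: T_scaleR scaleC.scaleR_right)
    then show "lap N k z (r *\<^sub>R x) = r *\<^sub>R lap N k z x" for r x
      unfolding lap_def by simp
    show "norm (lap N k z x) \<le> norm x * (N * (B * (M * exp (w * N))))" for x
      using lap_norm_le[OF N k B z, of x] by (simp add: ac_simps)
  qed
qed

lemma exp_orbit_tendsto_0:
  assumes "w < Re z"
  shows "(\<lambda>N. exp (- (z * of_real (real N))) *\<^sub>C T (real N) y) \<longlonglongrightarrow> 0"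
proof (rule Lim_null_comparison)
  show "\<forall>\<^sub>F N in sequentially. norm (exp (- (z * of_real (real N))) *\<^sub>C T (real N) y) \<le> (M * norm y) * exp (- ((Re z - w) * real N))"
  proof (intro always_eventually allI)
    fix N
    have "norm (exp (- (z * of_real (real N))) *\<^sub>C T (real N) y) \<le> exp (- (Re z * real N)) * (M * exp (w * real N) * norm y)"
      unfolding norm_scaleC using growth[of "real N" y] by (simp add: norm_exp_eq_Re del: of_real_of_nat_eq)
    also have "\<dots> = (M * norm y) * exp (- ((Re z - w) * real N))" by (simp add: left_diff_distrib exp_diff exp_minus field_simps)
    finally show "norm (exp (- (z * of_real (real N))) *\<^sub>C T (real N) y) \<le> (M * norm y) * exp (- ((Re z - w) * real N))" .
  qed
  have "0 < Re z - w" using assms by simp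
  then show "(\<lambda>N. (M * norm y) * exp (- ((Re z - w) * real N))) \<longlonglongrightarrow> 0" by real_asymp
qed

text \<open>To the right of the growth exponent, the boundary term at time \<open>n\<close> in the integration by parts with \<open>\<mu> = z\<close> tends to
zero. With \<open>k\<close> the ramp this computes the Laplace transform of the cut-off orbit; with \<open>k = 1\<close> it is the Laplace
representation of the resolvent.\<close>
lemma lap_tendsto_resolvent:
  assumes z: "w < Re z" and k: "\<And>s. 0 \<le> s \<Longrightarrow> (k has_real_derivative k' s) (at s within {0..})"
    and k': "continuous_on {0..} k'" and supp: "\<And>s. s > 1 \<Longrightarrow> k' s = 0" "\<And>s. 1 \<le> s \<Longrightarrow> k s = k 1"
  shows "(\<lambda>n. lap (real n) k z y) \<longlonglongrightarrow> R z (lap 1 k' z y + of_real (k 0) *\<^sub>C y)"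
proof -
  have z0: "0 < Re z" using z w_nonneg by simp
  have *: "lap (real n) k z y = R z (lap 1 k' z y + of_real (k 0) *\<^sub>C y - of_real (k 1) *\<^sub>C (exp (- (z * of_real (real n))) *\<^sub>C T (real n) y))" if n: "1 \<le> n" for n
  proof -
    have "lap (real n) k' z y = lap 1 k' z y"
    proof -
      have "lap (real n) k' z y = integral {0..1} (\<lambda>s. (of_real (k' s) * exp (- (z * of_real s))) *\<^sub>C T s y) + integral {1..real n} (\<lambda>s. (of_real (k' s) * exp (- (z * of_real s))) *\<^sub>C T s y)"
        unfolding lap_def by (rule Henstock_Kurzweil_Integration.integral_combine[symmetric]) (use n in \<open>auto intro!: lap_integrable continuous_on_subset[OF k']\<close>)
      also have "integral {1..real n} (\<lambda>s. (of_real (k' s) * exp (- (z * of_real s))) *\<^sub>C T s y) = integral {1..real n} (\<lambda>s. 0)"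
        by (rule integral_spike[of "{1}"]) (auto simp: supp scaleC.zero_left)
      finally show ?thesis by (simp add: lap_def)
    qed
    moreover have "lap (real n) k z y = R z ((z - z) *\<^sub>C lap (real n) k z y + lap (real n) k' z y
       - (of_real (k (real n)) * exp (- (z * of_real (real n)))) *\<^sub>C T (real n) y + of_real (k 0) *\<^sub>C y)"
      by (rule lap_integration_by_parts[OF _ z0]) (auto intro!: has_field_derivative_subset[OF k] continuous_on_subset[OF k'])
    ultimately show ?thesis using n supp(2)[of "real n"] by (simp add: scaleC.zero_left scaleC_scaleC algebra_simps)
  qed
  have "(\<lambda>n. R z (lap 1 k' z y + of_real (k 0) *\<^sub>C y - of_real (k 1) *\<^sub>C (exp (- (z * of_real (real n))) *\<^sub>C T (real n) y)))
      \<longlonglongrightarrow> R z (lap 1 k' z y + of_real (k 0) *\<^sub>C y - of_real (k 1) *\<^sub>C 0)"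
    by (intro bounded_linear.tendsto[OF R_linear[OF z0]] tendsto_intros exp_orbit_tendsto_0[OF z])
  then have "(\<lambda>n. R z (lap 1 k' z y + of_real (k 0) *\<^sub>C y - of_real (k 1) *\<^sub>C (exp (- (z * of_real (real n))) *\<^sub>C T (real n) y)))
      \<longlonglongrightarrow> R z (lap 1 k' z y + of_real (k 0) *\<^sub>C y)"
    by (simp add: scaleC.zero_right)
  then show ?thesis
    by (rule Lim_transform_eventually) (rule eventually_sequentiallyI[of 1], simp only: *)
qed

lemma laplace_tendsto_resolvent:
  assumes "w < Re z"
  shows "(\<lambda>n. lap (real n) (\<lambda>_. 1) z y) \<longlonglongrightarrow> R z y"
proof -
  have "lap 1 (\<lambda>_. 0) z y = 0" by (simp add: lap_def scaleC.zero_left)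
  then show ?thesis
    using lap_tendsto_resolvent[OF assms, of "\<lambda>_. 1" "\<lambda>_. 0" y] by (simp add: scaleC_one)
qed

text \<open>The Hille-Yosida estimate, from the Laplace representation.\<close>
lemma R_decay:
  assumes "w < Re z"
  shows "norm (R z y) \<le> M / (Re z - w) * norm y"
proof (rule tendsto_upperbound[OF tendsto_norm[OF laplace_tendsto_resolvent[OF assms]]])
  show "\<forall>\<^sub>F n in sequentially. norm (lap (real n) (\<lambda>_. 1) z y) \<le> M / (Re z - w) * norm y"
  proof (intro always_eventually allI)
    fix n
    have I: "((\<lambda>s. M * norm y * exp (- (Re z - w) * s)) has_integral M * norm y * (exp (- (Re z - w) * 0) / (Re z - w))) {0..}"
      using has_integral_exp_minus_to_infinity[of "Re z - w" 0] assms by (intro has_integral_mult_right) simp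
    have "norm (lap (real n) (\<lambda>_. 1) z y) \<le> integral {0..real n} (\<lambda>s. M * norm y * exp (- (Re z - w) * s))"
      unfolding lap_def
    proof (rule integral_norm_bound_integral[OF lap_integrable])
      fix s assume s: "s \<in> {0..real n}"
      have "norm ((of_real 1 * exp (- (z * of_real s))) *\<^sub>C T s y) \<le> exp (- (Re z * s)) * (M * exp (w * s) * norm y)"
        unfolding norm_scaleC using growth[of s y] s by (simp add: norm_exp_eq_Re)
      also have "\<dots> = M * norm y * exp (- (Re z - w) * s)" by (simp add: algebra_simps exp_diff exp_minus exp_add divide_simps)
      finally show "norm ((of_real 1 * exp (- (z * of_real s))) *\<^sub>C T s y) \<le> M * norm y * exp (- (Re z - w) * s)" .
    qed (auto intro!: continuous_intros integrable_continuous_real)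
    also have "\<dots> \<le> integral {0..} (\<lambda>s. M * norm y * exp (- (Re z - w) * s))"
      by (rule integral_subset_le) (use I M_nonneg in \<open>auto intro!: continuous_intros integrable_continuous_real\<close>)
    also have "\<dots> = M / (Re z - w) * norm y" using integral_unique[OF I] by simp
    finally show "norm (lap (real n) (\<lambda>_. 1) z y) \<le> M / (Re z - w) * norm y" .
  qed
qed simp

text \<open>By the resolvent identity, since \<open>R\<close> is bounded near \<open>z0\<close>.\<close>
lemma R_tendsto:
  assumes z0: "0 < Re z0"
  shows "((\<lambda>z. R z y) \<longlongrightarrow> R z0 y) (at z0)"
proof -
  have "((\<lambda>z. R z y - R z0 y) \<longlongrightarrow> 0) (at z0)"
  proof (rule Lim_null_comparison)
    have "\<forall>\<^sub>F z in at z0. dist z z0 < Re z0 / 2" 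
      unfolding eventually_at using z0 by (intro exI[of _ "Re z0 / 2"]) auto
    then show "\<forall>\<^sub>F z in at z0. norm (R z y - R z0 y) \<le> cmod (z0 - z) * (g (inverse (Re z0 / 2)) * norm (R z0 y))"
    proof eventually_elim
      case (elim z)
      then have "Re z0 / 2 \<le> Re z" using abs_Re_le_cmod[of "z - z0"] by (simp add: dist_norm abs_le_iff)
      then show ?case using z0 resolvent_identity[of z z0 y] R_bound_right[of "Re z0 / 2" z "R z0 y"]
        by (simp add: norm_scaleC mult_left_mono)
    qed
    show "((\<lambda>z. cmod (z0 - z) * (g (inverse (Re z0 / 2)) * norm (R z0 y))) \<longlongrightarrow> 0) (at z0)"
      by (auto intro!: tendsto_eq_intros)
  qed
  then show ?thesis by (rule LIM_zero_cancel)
qed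

end

section \<open>Decay of truncated Laplace transforms on fractional domains\<close>

context resolvent_semigroup
begin

lemma R_real_derivative:
  assumes \<omega>: "0 < \<omega>" and s: "0 \<le> s"
  shows "((\<lambda>s. R (of_real (\<omega> + s)) y) has_vector_derivative - R (of_real (\<omega> + s)) (R (of_real (\<omega> + s)) y)) (at s within {0..})"
proof (rule has_vector_derivative_of_quotient)
  define x where "x = R (of_real (\<omega> + s)) y"
  have "((\<lambda>r. complex_of_real (\<omega> + r)) \<longlongrightarrow> of_real (\<omega> + s)) (at s within {0..})"
    by (intro tendsto_intros)
  moreover have "isCont (\<lambda>z. R z x) (of_real (\<omega> + s))" using R_tendsto[of "of_real (\<omega> + s)" x] \<omega> s by (simp add: isCont_def)
  ultimately have lim: "((\<lambda>r. - R (of_real (\<omega> + r)) x) \<longlongrightarrow> - R (of_real (\<omega> + s)) x) (at s within {0..})"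
    by (intro tendsto_minus) (rule isCont_tendsto_compose)
  have "- R (of_real (\<omega> + r)) x = (1 / (r - s)) *\<^sub>R (R (of_real (\<omega> + r)) y - x)" if "r \<in> {0..}" "r \<noteq> s" for r
  proof -
    have "R (of_real (\<omega> + r)) y - x = (of_real (\<omega> + s) - of_real (\<omega> + r)) *\<^sub>C R (of_real (\<omega> + r)) x"
      unfolding x_def by (rule resolvent_identity) (use \<omega> s that in auto)
    also have "\<dots> = complex_of_real (s - r) *\<^sub>C R (of_real (\<omega> + r)) x" by simp
    also have "\<dots> = (s - r) *\<^sub>R R (of_real (\<omega> + r)) x" by (rule scaleC_of_real)
    finally have "(1 / (r - s)) *\<^sub>R (R (of_real (\<omega> + r)) y - x) = ((s - r) / (r - s)) *\<^sub>R R (of_real (\<omega> + r)) x" by simp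
    also have "(s - r) / (r - s) = - 1" using that by (simp add: divide_eq_eq)
    finally show ?thesis by simp
  qed
  then have "\<forall>\<^sub>F r in at s within {0..}. - R (of_real (\<omega> + r)) x = (1 / (r - s)) *\<^sub>R (R (of_real (\<omega> + r)) y - x)"
    by (auto simp: eventually_at intro!: exI[of _ 1])
  then show "((\<lambda>r. (1 / (r - s)) *\<^sub>R (R (of_real (\<omega> + r)) y - R (of_real (\<omega> + s)) y)) \<longlongrightarrow> - R (of_real (\<omega> + s)) (R (of_real (\<omega> + s)) y)) (at s within {0..})"
    unfolding x_def[symmetric] by (rule Lim_transform_eventually[OF lim])
qed

lemma R_real_continuous:
  assumes "0 < \<omega>"
  shows "continuous_on {0..} (\<lambda>s. R (of_real (\<omega> + s)) y)"
  by (rule continuous_on_vector_derivative, rule R_real_derivative[OF assms]) simp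

text \<open>Balakrishnan's integral for \<open>(\<omega> + A)\<^sup>-\<^sup>\<theta> y\<close>, without the factor \<open>sin (\<pi> \<theta>) / \<pi>\<close>.\<close>
definition frac_int :: "real \<Rightarrow> real \<Rightarrow> 'a \<Rightarrow> 'a" where
  "frac_int \<omega> \<theta> y = integral {0<..} (\<lambda>s. s powr - \<theta> *\<^sub>R R (of_real (\<omega> + s)) y)"

lemma frac_int_integrable:
  assumes \<omega>: "w < \<omega>" and th: "0 < \<theta>" "\<theta> < 1"
  shows "(\<lambda>s. s powr - \<theta> *\<^sub>R R (of_real (\<omega> + s)) y) integrable_on {0<..}"
proof (rule powr_scaled_integrable_on[OF th])
  have \<omega>0: "0 < \<omega>" using \<omega> w_nonneg by simp
  define G where "G s = R (of_real (\<omega> + s)) y" for s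
  show "((\<lambda>s. R (of_real (\<omega> + s)) y) has_vector_derivative - R (of_real (\<omega> + s)) (R (of_real (\<omega> + s)) y)) (at s within {0..})" if "0 \<le> s" for s
    by (rule R_real_derivative[OF \<omega>0 that])
  show "continuous_on {0..} (\<lambda>s. - R (of_real (\<omega> + s)) (R (of_real (\<omega> + s)) y))"
    unfolding continuous_on_eq_continuous_within
  proof
    fix s :: real assume s: "s \<in> {0..}"
    have c: "((\<lambda>r. R (of_real (\<omega> + r)) x) \<longlongrightarrow> R (of_real (\<omega> + s)) x) (at s within {0..})" for x
      using R_real_continuous[OF \<omega>0, of x] s by (simp add: continuous_on)
    have "((\<lambda>r. R (of_real (\<omega> + r)) (G r - G s)) \<longlongrightarrow> 0) (at s within {0..})"
    proof (rule Lim_null_comparison)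
      show "\<forall>\<^sub>F r in at s within {0..}. norm (R (of_real (\<omega> + r)) (G r - G s)) \<le> g (inverse \<omega>) * norm (G r - G s)"
        using R_bound_right[OF \<omega>0] by (auto simp: eventually_at intro!: exI[of _ 1])
      show "((\<lambda>r. g (inverse \<omega>) * norm (G r - G s)) \<longlongrightarrow> 0) (at s within {0..})"
        by (intro tendsto_mult_right_zero tendsto_norm_zero LIM_zero) (use c[of y] in \<open>simp add: G_def\<close>)
    qed
    from tendsto_add[OF this c[of "G s"]]
    have "((\<lambda>r. R (of_real (\<omega> + r)) (G r - G s) + R (of_real (\<omega> + r)) (G s)) \<longlongrightarrow> R (of_real (\<omega> + s)) (G s)) (at s within {0..})" by simp
    moreover have "\<forall>\<^sub>F r in at s within {0..}. R (of_real (\<omega> + r)) (G r - G s) + R (of_real (\<omega> + r)) (G s) = R (of_real (\<omega> + r)) (G r)"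
      using \<omega>0 by (auto simp: eventually_at R_diff intro!: exI[of _ 1])
    ultimately have "((\<lambda>r. R (of_real (\<omega> + r)) (G r)) \<longlongrightarrow> R (of_real (\<omega> + s)) (G s)) (at s within {0..})"
      by (rule Lim_transform_eventually)
    then show "continuous (at s within {0..}) (\<lambda>s. - R (of_real (\<omega> + s)) (R (of_real (\<omega> + s)) y))"
      unfolding continuous_within G_def by (rule tendsto_minus)
  qed
  show "norm (R (of_real (\<omega> + s)) y) \<le> (M * norm y) / s" if "1 \<le> s" for s
  proof -
    have "norm (R (of_real (\<omega> + s)) y) \<le> M / (\<omega> + s - w) * norm y"
      using R_decay[of "of_real (\<omega> + s)" y] \<omega> that by simp
    also have "\<dots> \<le> M / s * norm y" using \<omega> that M_nonneg by (intro mult_right_mono divide_left_mono) auto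
    finally show ?thesis by simp
  qed
qed

lemma frac_int_commute:
  assumes \<omega>: "w < \<omega>" and th: "0 < \<theta>" "\<theta> < 1" and S: "bounded_linear S"
    and comm: "\<And>s. 0 < s \<Longrightarrow> S (R (of_real (\<omega> + s)) y) = R (of_real (\<omega> + s)) (S y)"
  shows "S (frac_int \<omega> \<theta> y) = frac_int \<omega> \<theta> (S y)"
proof -
  have "((\<lambda>s. S (s powr - \<theta> *\<^sub>R R (of_real (\<omega> + s)) y)) has_integral S (frac_int \<omega> \<theta> y)) {0<..}"
    unfolding frac_int_def by (rule has_integral_linear[OF integrable_integral[OF frac_int_integrable[OF \<omega> th]] S, unfolded o_def])
  then have "((\<lambda>s. s powr - \<theta> *\<^sub>R R (of_real (\<omega> + s)) (S y)) has_integral S (frac_int \<omega> \<theta> y)) {0<..}"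
    by (rule has_integral_eq[rotated]) (simp add: linear_scale[OF bounded_linear.linear[OF S]] comm del: of_real_add)
  then show ?thesis unfolding frac_int_def by (simp add: integral_unique)
qed

lemma frac_int_bounded_linear:
  assumes \<omega>: "w < \<omega>" and th: "0 < \<theta>" "\<theta> < 1"
  shows "bounded_linear (frac_int \<omega> \<theta>)"
proof (rule bounded_linear_intro)
  note I = frac_int_integrable[OF \<omega> th]
  have \<omega>0: "0 < \<omega>" using \<omega> w_nonneg by simp
  show "frac_int \<omega> \<theta> (x + y) = frac_int \<omega> \<theta> x + frac_int \<omega> \<theta> y" for x y
  proof -
    have "frac_int \<omega> \<theta> (x + y) = integral {0<..} (\<lambda>s. s powr - \<theta> *\<^sub>R R (of_real (\<omega> + s)) x + s powr - \<theta> *\<^sub>R R (of_real (\<omega> + s)) y)"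
      unfolding frac_int_def by (rule integral_cong) (use \<omega>0 in \<open>simp add: R_add scaleR_add_right\<close>)
    then show ?thesis using integral_add[OF I[of x] I[of y]] by (simp add: frac_int_def)
  qed
  show "frac_int \<omega> \<theta> (r *\<^sub>R x) = r *\<^sub>R frac_int \<omega> \<theta> x" for r x
  proof -
    have "frac_int \<omega> \<theta> (r *\<^sub>R x) = integral {0<..} (\<lambda>s. r *\<^sub>R (s powr - \<theta> *\<^sub>R R (of_real (\<omega> + s)) x))"
      unfolding frac_int_def by (rule integral_cong) (use \<omega>0 in \<open>simp add: R_scaleR\<close>)
    then show ?thesis unfolding frac_int_def by (simp only: integral_cmul)
  qed
  show "norm (frac_int \<omega> \<theta> y) \<le> norm y * (M * ((1 / (1 - \<theta>) + 1 / \<theta>) * (\<omega> - w) powr - \<theta>))" for y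
  proof -
    have P: "((\<lambda>s. (M * norm y) * pow_majorant \<theta> (\<omega> - w) s) has_integral (M * norm y) * ((1 / (1 - \<theta>) + 1 / \<theta>) * (\<omega> - w) powr - \<theta>)) {0<..}"
      by (intro has_integral_mult_right pow_majorant_has_integral th) (use \<omega> in simp)
    have "norm (frac_int \<omega> \<theta> y) \<le> integral {0<..} (\<lambda>s. (M * norm y) * pow_majorant \<theta> (\<omega> - w) s)"
      unfolding frac_int_def
    proof (rule integral_norm_bound_integral[OF I has_integral_integrable[OF P]])
      fix s :: real assume s: "s \<in> {0<..}"
      have "norm (s powr - \<theta> *\<^sub>R R (of_real (\<omega> + s)) y) \<le> s powr - \<theta> * (M / (\<omega> + s - w) * norm y)"
        using mult_left_mono[OF R_decay[of "of_real (\<omega> + s)" y], of "s powr - \<theta>"] \<omega> s by simp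
      also have "\<dots> = (M * norm y) * (s powr - \<theta> / (s + (\<omega> - w)))" by (simp add: algebra_simps)
      also have "\<dots> \<le> (M * norm y) * pow_majorant \<theta> (\<omega> - w) s"
        using s \<omega> M_nonneg by (intro mult_left_mono pow_majorant_ge) auto
      finally show "norm (s powr - \<theta> *\<^sub>R R (of_real (\<omega> + s)) y) \<le> (M * norm y) * pow_majorant \<theta> (\<omega> - w) s" .
    qed
    then show ?thesis unfolding integral_unique[OF P] by (simp only: ac_simps)
  qed
qed

text \<open>When \<open>k\<close> vanishes at 0 and 1, integration by parts with \<open>\<mu> = \<omega> + s\<close> reads
\<open>(\<mu> - z) R \<mu> (lap 1 k z y) = lap 1 k z y - R \<mu> (lap 1 k' z y)\<close>. As \<open>Re z \<le> b < \<omega>\<close>, the modulus of \<open>\<mu> - z\<close> is at least a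
constant times \<open>s + 1 + \<bar>Im z\<bar>\<close>; this is why the line \<open>Re z = a\<close> has to stay to the left of \<open>\<omega>\<close>.\<close>
lemma lap_resolvent_decay:
  assumes z: "0 < Re z" "Re z \<le> b" and b: "b < \<omega>" and s: "0 \<le> s"
    and k: "\<And>s. s \<in> {0..1} \<Longrightarrow> (k has_real_derivative k' s) (at s within {0..1})"
    and k': "continuous_on {0..1} k'" and k01: "k 0 = 0" "k 1 = 0"
  shows "norm (lap 1 k z (R (of_real (\<omega> + s)) y))
    \<le> (2 * (1 + \<bar>g (inverse \<omega>)\<bar>) / min 1 (\<omega> - b)) / (s + (1 + \<bar>Im z\<bar>)) * (norm (lap 1 k z y) + norm (lap 1 k' z y))"
proof -
  define \<mu> where "\<mu> = complex_of_real (\<omega> + s)"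
  define \<kappa> where "\<kappa> = \<bar>g (inverse \<omega>)\<bar>"
  define c where "c = min 1 (\<omega> - b)"
  have \<omega>: "0 < \<omega>" using z b by simp
  have \<mu>: "0 < Re \<mu>" using \<omega> s by (simp add: \<mu>_def)
  have c: "0 < c" "c \<le> 1" "c \<le> \<omega> - b" using b by (auto simp: c_def)
  have kc: "continuous_on {0..1} k" using k by (meson DERIV_continuous_on)
  define v where "v = lap 1 k z y"
  define v' where "v' = lap 1 k' z y"
  have "v = R \<mu> ((\<mu> - z) *\<^sub>C v + v')"
    using lap_integration_by_parts[OF _ \<mu> k k', of z y] k01
    by (simp add: v_def v'_def scaleC.zero_left)
  then have "(\<mu> - z) *\<^sub>C R \<mu> v = v - R \<mu> v'" using \<mu> by (simp add: R_add R_scaleC eq_diff_eq)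
  then have "cmod (\<mu> - z) * norm (R \<mu> v) = norm (v - R \<mu> v')" by (metis norm_scaleC)
  also have "\<dots> \<le> norm v + norm (R \<mu> v')" by (rule norm_triangle_ineq4)
  also have "\<dots> \<le> norm v + \<kappa> * norm v'"
  proof -
    have "norm (R \<mu> v') \<le> g (inverse \<omega>) * norm v'" by (rule R_bound_right[OF \<omega>]) (use s in \<open>simp add: \<mu>_def\<close>)
    also have "\<dots> \<le> \<kappa> * norm v'" unfolding \<kappa>_def by (intro mult_right_mono) auto
    finally show ?thesis by simp
  qed
  also have "\<dots> \<le> (1 + \<kappa>) * (norm v + norm v')" by (simp add: \<kappa>_def algebra_simps)
  finally have 1: "cmod (\<mu> - z) * norm (R \<mu> v) \<le> (1 + \<kappa>) * (norm v + norm v')" .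
  have "c * (s + (1 + \<bar>Im z\<bar>)) \<le> c + s + \<bar>Im z\<bar>"
    using c s mult_right_mono[of c 1 s] mult_right_mono[of c 1 "\<bar>Im z\<bar>"] by (simp add: distrib_left)
  also have "\<dots> \<le> \<bar>Re (\<mu> - z)\<bar> + \<bar>Im (\<mu> - z)\<bar>" using c z s by (simp add: \<mu>_def)
  also have "\<dots> \<le> 2 * cmod (\<mu> - z)" using abs_Re_le_cmod[of "\<mu> - z"] abs_Im_le_cmod[of "\<mu> - z"] by linarith
  finally have "c / 2 * (s + (1 + \<bar>Im z\<bar>)) * norm (R \<mu> v) \<le> cmod (\<mu> - z) * norm (R \<mu> v)" by (intro mult_right_mono) auto
  also note 1
  finally have 2: "c / 2 * (s + (1 + \<bar>Im z\<bar>)) * norm (R \<mu> v) \<le> (1 + \<kappa>) * (norm v + norm v')" .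
  define d where "d = s + (1 + \<bar>Im z\<bar>)"
  have d: "0 < d" using s by (simp add: d_def)
  have "norm (R \<mu> v) \<le> (1 + \<kappa>) * (norm v + norm v') / (c / 2 * d)"
    using 2 c d unfolding d_def[symmetric] by (subst pos_le_divide_eq) (simp_all add: ac_simps)
  also have "\<dots> = (2 * (1 + \<kappa>) / c) / d * (norm v + norm v')" using c d by (simp add: field_simps)
  finally have "norm (R \<mu> v) \<le> (2 * (1 + \<kappa>) / c) / (s + (1 + \<bar>Im z\<bar>)) * (norm v + norm v')"
    unfolding d_def .
  moreover have "lap 1 k z (R \<mu> y) = R \<mu> v" unfolding v_def by (rule lap_R_commute[OF kc \<mu>])
  ultimately show ?thesis unfolding \<mu>_def v_def v'_def \<kappa>_def c_def by simp
qed

text \<open>Integrate the previous bound in \<open>s\<close>: the integral of \<open>s powr - \<theta> / (s + m)\<close> is of order \<open>m powr - \<theta>\<close>.\<close>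
lemma lap_frac_int_decay:
  assumes z: "0 < Re z" "Re z \<le> b" and b: "b < \<omega>" and \<omega>: "w < \<omega>" and th: "0 < \<theta>" "\<theta> < 1"
    and k: "\<And>s. s \<in> {0..1} \<Longrightarrow> (k has_real_derivative k' s) (at s within {0..1})"
    and k': "continuous_on {0..1} k'" and k01: "k 0 = 0" "k 1 = 0"
  shows "norm (lap 1 k z (frac_int \<omega> \<theta> y))
    \<le> (2 * (1 + \<bar>g (inverse \<omega>)\<bar>) / min 1 (\<omega> - b)) * (1 / (1 - \<theta>) + 1 / \<theta>) * (1 + \<bar>Im z\<bar>) powr - \<theta>
       * (norm (lap 1 k z y) + norm (lap 1 k' z y))"
proof -
  define D where "D = 2 * (1 + \<bar>g (inverse \<omega>)\<bar>) / min 1 (\<omega> - b)"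
  define E where "E = norm (lap 1 k z y) + norm (lap 1 k' z y)"
  define m where "m = 1 + \<bar>Im z\<bar>"
  have m: "0 < m" by (simp add: m_def)
  have DE: "0 \<le> D * E" using b by (simp add: D_def E_def)
  have kc: "continuous_on {0..1} k" using k by (meson DERIV_continuous_on)
  have lin: "bounded_linear (lap 1 k z)" by (rule lap_linear[OF _ kc]) (use z in auto)
  have I: "((\<lambda>s. lap 1 k z (s powr - \<theta> *\<^sub>R R (of_real (\<omega> + s)) y)) has_integral lap 1 k z (frac_int \<omega> \<theta> y)) {0<..}"
    unfolding frac_int_def by (rule has_integral_linear[OF integrable_integral[OF frac_int_integrable[OF \<omega> th]] lin, unfolded o_def])
  have P: "((\<lambda>s. (D * E) * pow_majorant \<theta> m s) has_integral (D * E) * ((1 / (1 - \<theta>) + 1 / \<theta>) * m powr - \<theta>)) {0<..}"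
    by (intro has_integral_mult_right pow_majorant_has_integral th m)
  have "norm (lap 1 k z (frac_int \<omega> \<theta> y)) \<le> (D * E) * ((1 / (1 - \<theta>) + 1 / \<theta>) * m powr - \<theta>)"
    unfolding integral_unique[OF I, symmetric] integral_unique[OF P, symmetric]
  proof (rule integral_norm_bound_integral[OF has_integral_integrable[OF I] has_integral_integrable[OF P]])
    fix s :: real assume s: "s \<in> {0<..}"
    have "norm (lap 1 k z (s powr - \<theta> *\<^sub>R R (of_real (\<omega> + s)) y)) = s powr - \<theta> * norm (lap 1 k z (R (of_real (\<omega> + s)) y))"
      by (simp add: linear_scale[OF bounded_linear.linear[OF lin]])
    also have "\<dots> \<le> s powr - \<theta> * (D / (s + m) * E)"
      unfolding D_def m_def E_def by (intro mult_left_mono lap_resolvent_decay[OF z b _ k k' k01]) (use s in auto)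
    also have "\<dots> = (D * E) * (s powr - \<theta> / (s + m))" by simp
    also have "\<dots> \<le> (D * E) * pow_majorant \<theta> m s"
      using s m DE by (intro mult_left_mono pow_majorant_ge) auto
    finally show "norm (lap 1 k z (s powr - \<theta> *\<^sub>R R (of_real (\<omega> + s)) y)) \<le> (D * E) * pow_majorant \<theta> m s" .
  qed
  then show ?thesis unfolding D_def E_def m_def by (simp add: ac_simps)
qed

text \<open>The operator \<open>(\<omega> + A)\<^sup>-\<^sup>n\<^sup>-\<^sup>\<theta>\<close>.\<close>
definition res_power :: "real \<Rightarrow> nat \<Rightarrow> real \<Rightarrow> 'a \<Rightarrow> 'a" where
  "res_power \<omega> n \<theta> y = (R (of_real \<omega>) ^^ n) (if \<theta> = 0 then y else (sin (pi * \<theta>) / pi) *\<^sub>R frac_int \<omega> \<theta> y)"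

lemma res_power_Suc: "res_power \<omega> (Suc n) \<theta> y = R (of_real \<omega>) (res_power \<omega> n \<theta> y)"
  by (simp add: res_power_def)

lemma res_power_bounded_linear:
  assumes \<omega>: "w < \<omega>" and th: "0 \<le> \<theta>" "\<theta> < 1"
  shows "bounded_linear (res_power \<omega> n \<theta>)"
proof (induction n)
  case 0
  show ?case
  proof (cases "\<theta> = 0")
    case False
    then show ?thesis
      using bounded_linear_const_scaleR[OF frac_int_bounded_linear[OF \<omega>], of \<theta> "sin (pi * \<theta>) / pi"] th
      by (simp add: res_power_def[abs_def])
  qed (simp add: res_power_def[abs_def] bounded_linear_ident)
next
  case (Suc n)
  have "0 < Re (complex_of_real \<omega>)" using \<omega> w_nonneg by simp
  then show ?case unfolding res_power_Suc[abs_def]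
    by (rule bounded_linear_compose[OF R_linear Suc.IH])
qed

lemma res_power_commute:
  assumes \<omega>: "w < \<omega>" and th: "0 \<le> \<theta>" "\<theta> < 1" and S: "bounded_linear S"
    and comm: "\<And>s y. 0 \<le> s \<Longrightarrow> S (R (of_real (\<omega> + s)) y) = R (of_real (\<omega> + s)) (S y)"
  shows "S (res_power \<omega> n \<theta> y) = res_power \<omega> n \<theta> (S y)"
proof (induction n)
  case 0
  show ?case using th frac_int_commute[OF \<omega> _ th(2) S comm]
    by (auto simp: res_power_def linear_scale[OF bounded_linear.linear[OF S]])
next
  case (Suc n)
  show ?case using comm[of 0] Suc.IH by (simp add: res_power_Suc)
qed

text \<open>Every factor \<open>(\<omega> + A)\<^sup>-\<^sup>1\<close> gains one power of \<open>1 + \<bar>Im z\<bar>\<close>, the fractional factor gains the power \<open>\<theta>\<close>, and each of them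
costs one more derivative of the weight. Keeping the terms \<open>lap 1 (\<psi> (j + i)) z y\<close> on the right, instead of bounding
them by \<open>norm y\<close>, is essential: the Fourier type controls them in mean.\<close>
lemma lap_res_power_decay:
  fixes \<psi> :: "nat \<Rightarrow> real \<Rightarrow> real"
  assumes b: "b < \<omega>" and \<omega>: "w < \<omega>" and th: "0 \<le> \<theta>" "\<theta> < 1"
    and \<psi>: "\<And>j s. (\<psi> j has_real_derivative \<psi> (Suc j) s) (at s)"
    and \<psi>01: "\<And>j. j \<le> J \<Longrightarrow> \<psi> j 0 = 0 \<and> \<psi> j 1 = 0"
  shows "\<exists>C\<ge>0. \<forall>j z y. j + n \<le> J \<longrightarrow> 0 < Re z \<longrightarrow> Re z \<le> b \<longrightarrow>
    norm (lap 1 (\<psi> j) z (res_power \<omega> n \<theta> y)) \<le> C * (1 + \<bar>Im z\<bar>) powr - (real n + \<theta>) * (\<Sum>i\<le>Suc n. norm (lap 1 (\<psi> (j + i)) z y))"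
proof (induction n)
  case 0
  have cont: "continuous_on S (\<psi> j)" for S j using \<psi> by (meson DERIV_continuous_on has_field_derivative_at_within)
  show ?case
  proof (cases "\<theta> = 0")
    case True
    then show ?thesis by (intro exI[of _ 1]) (auto simp: res_power_def add_increasing2)
  next
    case False
    define D where "D = (2 * (1 + \<bar>g (inverse \<omega>)\<bar>) / min 1 (\<omega> - b)) * (1 / (1 - \<theta>) + 1 / \<theta>)"
    have D: "0 \<le> D" using b th by (simp add: D_def)
    show ?thesis
    proof (intro exI[of _ "\<bar>sin (pi * \<theta>) / pi\<bar> * D"] conjI allI impI)
      fix j z y assume j: "j + 0 \<le> J" and z: "0 < Re z" "Re z \<le> b"
      have "norm (lap 1 (\<psi> j) z (frac_int \<omega> \<theta> y)) \<le> D * (1 + \<bar>Im z\<bar>) powr - \<theta> * (norm (lap 1 (\<psi> j) z y) + norm (lap 1 (\<psi> (Suc j)) z y))"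
        unfolding D_def by (rule lap_frac_int_decay[OF z b \<omega>]) (use th False \<psi> \<psi>01 j cont in \<open>auto intro: has_field_derivative_at_within\<close>)
      then have "\<bar>sin (pi * \<theta>) / pi\<bar> * norm (lap 1 (\<psi> j) z (frac_int \<omega> \<theta> y)) \<le> \<bar>sin (pi * \<theta>) / pi\<bar> * (D * (1 + \<bar>Im z\<bar>) powr - \<theta> * (norm (lap 1 (\<psi> j) z y) + norm (lap 1 (\<psi> (Suc j)) z y)))"
        by (rule mult_left_mono) simp
      moreover have "bounded_linear (lap 1 (\<psi> j) z)" by (rule lap_linear[OF _ cont]) (use z in auto)
      ultimately show "norm (lap 1 (\<psi> j) z (res_power \<omega> 0 \<theta> y)) \<le> \<bar>sin (pi * \<theta>) / pi\<bar> * D * (1 + \<bar>Im z\<bar>) powr - (real 0 + \<theta>) * (\<Sum>i\<le>Suc 0. norm (lap 1 (\<psi> (j + i)) z y))"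
        using False by (simp add: res_power_def linear_scale[OF bounded_linear.linear] mult.assoc abs_mult)
    qed (use D in simp)
  qed
next
  case (Suc n)
  have cont: "continuous_on S (\<psi> j)" for S j using \<psi> by (meson DERIV_continuous_on has_field_derivative_at_within)
  obtain C where C: "0 \<le> C" and hC: "\<And>j z y. j + n \<le> J \<Longrightarrow> 0 < Re z \<Longrightarrow> Re z \<le> b \<Longrightarrow>
    norm (lap 1 (\<psi> j) z (res_power \<omega> n \<theta> y)) \<le> C * (1 + \<bar>Im z\<bar>) powr - (real n + \<theta>) * (\<Sum>i\<le>Suc n. norm (lap 1 (\<psi> (j + i)) z y))"
    using Suc.IH by blast
  define D where "D = 2 * (1 + \<bar>g (inverse \<omega>)\<bar>) / min 1 (\<omega> - b)"
  have D: "0 \<le> D" using b by (simp add: D_def)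
  show ?case
  proof (intro exI[of _ "2 * D * C"] conjI allI impI)
    fix j z y assume j: "j + Suc n \<le> J" and z: "0 < Re z" "Re z \<le> b"
    define m where "m = 1 + \<bar>Im z\<bar>"
    have m: "0 < m" by (simp add: m_def)
    define Q where "Q = (\<Sum>i\<le>Suc (Suc n). norm (lap 1 (\<psi> (j + i)) z y))"
    define x where "x = res_power \<omega> n \<theta> y"
    have Q1: "(\<Sum>i\<le>Suc n. norm (lap 1 (\<psi> (j + i)) z y)) \<le> Q" by (simp add: Q_def)
    have Q2: "(\<Sum>i\<le>Suc n. norm (lap 1 (\<psi> (Suc j + i)) z y)) \<le> Q"
      unfolding Q_def by (subst (2) sum.atMost_Suc_shift) simp
    have "norm (lap 1 (\<psi> j) z (res_power \<omega> (Suc n) \<theta> y)) \<le> D / m * (norm (lap 1 (\<psi> j) z x) + norm (lap 1 (\<psi> (Suc j)) z x))"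
      using lap_resolvent_decay[OF z b, of 0 "\<psi> j" "\<psi> (Suc j)" x] \<psi> \<psi>01[of j] j cont
      by (simp add: res_power_Suc x_def D_def m_def has_field_derivative_at_within)
    also have "\<dots> \<le> D / m * (C * m powr - (real n + \<theta>) * Q + C * m powr - (real n + \<theta>) * Q)"
    proof (intro mult_left_mono add_mono)
      show "norm (lap 1 (\<psi> j) z x) \<le> C * m powr - (real n + \<theta>) * Q"
        using hC[of j z y] j z mult_left_mono[OF Q1, of "C * m powr - (real n + \<theta>)"] C
        unfolding x_def m_def by simp
      show "norm (lap 1 (\<psi> (Suc j)) z x) \<le> C * m powr - (real n + \<theta>) * Q"
        using hC[of "Suc j" z y] j z mult_left_mono[OF Q2, of "C * m powr - (real n + \<theta>)"] C
        unfolding x_def m_def by simp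
    qed (use D m in simp)
    also have "\<dots> = 2 * D * C * (m powr - (real n + \<theta>) / m) * Q" by (simp add: field_simps)
    also have "m powr - (real n + \<theta>) / m = m powr - (real (Suc n) + \<theta>)"
    proof -
      have e: "- (real (Suc n) + \<theta>) = - (real n + \<theta>) - 1" by simp
      show ?thesis unfolding e powr_diff using m by simp
    qed
    finally show "norm (lap 1 (\<psi> j) z (res_power \<omega> (Suc n) \<theta> y)) \<le> 2 * D * C * (1 + \<bar>Im z\<bar>) powr - (real (Suc n) + \<theta>) * (\<Sum>i\<le>Suc (Suc n). norm (lap 1 (\<psi> (j + i)) z y))"
      unfolding m_def Q_def .
  qed (use C D in simp)
qed

end

section \<open>Injectivity of the negative fractional powers\<close>

context resolvent_semigroup
begin

lemma T_max_continuous: "continuous_on UNIV (\<lambda>r. T (max 0 r) y)"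
  by (rule continuous_on_compose2[OF T_continuous]) (auto intro!: continuous_intros)

text \<open>The same constant has to serve for all \<open>z\<close> and \<open>y\<close>, which is why it is produced together with the bound of \<open>\<phi>\<close>.\<close>
lemma functional_orbit_decay:
  fixes \<phi> :: "'a \<Rightarrow> complex"
  assumes "bounded_clinear \<phi>"
  obtains L where "0 \<le> L" "\<And>x. norm (\<phi> x) \<le> L * norm x"
    "\<And>z r y. 0 \<le> r \<Longrightarrow> norm (exp (- (z * of_real r)) * \<phi> (T (max 0 r) y)) \<le> (L * M * norm y) * exp (- ((Re z - w) * r))"
proof -
  interpret \<phi>: bounded_linear \<phi> using assms by (rule bounded_clinearD)
  obtain L where L: "0 \<le> L" "\<And>x. norm (\<phi> x) \<le> L * norm x"
    using \<phi>.nonneg_bounded by (auto simp: mult.commute)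
  have "norm (exp (- (z * of_real r)) * \<phi> (T (max 0 r) y)) \<le> (L * M * norm y) * exp (- ((Re z - w) * r))" if "0 \<le> r" for z r y
  proof -
    have "norm (exp (- (z * of_real r)) * \<phi> (T (max 0 r) y)) \<le> exp (- (Re z * r)) * (L * (M * exp (w * r) * norm y))"
      unfolding norm_mult using that
      by (intro mult_mono order_trans[OF L(2)] mult_left_mono growth L) (auto simp: norm_exp_eq_Re growth)
    also have "\<dots> = (L * M * norm y) * exp (- ((Re z - w) * r))"
      by (simp add: left_diff_distrib exp_diff exp_minus field_simps)
    finally show ?thesis .
  qed
  then show ?thesis using that L by blast
qed

text \<open>A functional turns an improper vector integral into an absolutely convergent Lebesgue integral of a scalar function.
Here \<open>T (max 0 r)\<close> extends the orbit continuously to the whole line.\<close>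
lemma functional_lap_limit:
  fixes \<phi> :: "'a \<Rightarrow> complex"
  assumes \<phi>: "bounded_clinear \<phi>" and z: "w < Re z"
    and k: "continuous_on UNIV k" and kB: "\<And>s. 0 \<le> s \<Longrightarrow> \<bar>k s\<bar> \<le> B"
    and lim: "(\<lambda>n. lap (real n) k z y) \<longlonglongrightarrow> v"
  shows "integrable lborel (\<lambda>r. indicator {0<..} r *\<^sub>R (of_real (k r) * exp (- (z * of_real r)) * \<phi> (T (max 0 r) y)))"
    and "\<phi> v = (\<integral>r. indicator {0<..} r *\<^sub>R (of_real (k r) * exp (- (z * of_real r)) * \<phi> (T (max 0 r) y)) \<partial>lborel)"
proof -
  interpret \<phi>: bounded_linear \<phi> using \<phi> by (rule bounded_clinearD)
  obtain L where L: "0 \<le> L" "\<And>x. norm (\<phi> x) \<le> L * norm x"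
    and decay: "\<And>z r y. 0 \<le> r \<Longrightarrow> norm (exp (- (z * of_real r)) * \<phi> (T (max 0 r) y)) \<le> (L * M * norm y) * exp (- ((Re z - w) * r))"
    by (rule functional_orbit_decay[OF \<phi>]) blast
  define f where "f r = of_real (k r) * exp (- (z * of_real r)) * \<phi> (T (max 0 r) y)" for r
  have fc: "continuous_on UNIV f"
    unfolding f_def by (intro continuous_intros k \<phi>.continuous_on T_max_continuous)
  then have [measurable]: "f \<in> borel_measurable borel" by (rule borel_measurable_continuous_onI)
  have bd: "norm (f r) \<le> (B * L * M * norm y) * exp (- ((Re z - w) * r))" if "0 \<le> r" for r
  proof -
    have "norm (f r) = \<bar>k r\<bar> * norm (exp (- (z * of_real r)) * \<phi> (T (max 0 r) y))"
      unfolding f_def by (simp add: norm_mult)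
    also have "\<dots> \<le> B * ((L * M * norm y) * exp (- ((Re z - w) * r)))"
      using kB[OF that] decay[OF that] by (intro mult_mono) auto
    also have "\<dots> = (B * L * M * norm y) * exp (- ((Re z - w) * r))" by simp
    finally show ?thesis .
  qed
  have "integrable lborel (\<lambda>r. indicator {0..} r * exp (- (Re z - w) * r))"
    by (rule nonneg_has_integral_lborel(1)[OF _ _ has_integral_exp_minus_to_infinity]) (use z in auto)
  then have E: "integrable lborel (\<lambda>r. (B * L * M * norm y) * (indicator {0..} r * exp (- ((Re z - w) * r))))"
    by (intro integrable_mult_right) (simp only: mult_minus_left)
  show int: "integrable lborel (\<lambda>r. indicator {0<..} r *\<^sub>R (of_real (k r) * exp (- (z * of_real r)) * \<phi> (T (max 0 r) y)))"
    unfolding f_def[symmetric]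
  proof (rule Bochner_Integration.integrable_bound[OF E])
    show "AE r in lborel. norm (indicator {0<..} r *\<^sub>R f r) \<le> norm ((B * L * M * norm y) * (indicator {0..} r * exp (- ((Re z - w) * r))))"
      using bd by (intro AE_I2) (auto split: split_indicator intro: order_trans[OF _ abs_ge_self])
  qed measurable
  have "(\<lambda>n. \<phi> (lap (real n) k z y)) \<longlonglongrightarrow> \<phi> v" by (rule \<phi>.tendsto[OF lim])
  moreover have "\<phi> (lap (real n) k z y) = (\<integral>r. indicator {0..real n} r *\<^sub>R f r \<partial>lborel)" for n
  proof -
    have I: "((\<lambda>s. \<phi> ((of_real (k s) * exp (- (z * of_real s))) *\<^sub>C T s y)) has_integral \<phi> (lap (real n) k z y)) {0..real n}"
      unfolding lap_def
      by (rule has_integral_linear[OF integrable_integral[OF lap_integrable] \<phi>.bounded_linear_axioms, unfolded o_def])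
        (rule continuous_on_subset[OF k], simp)
    have "(f has_integral \<phi> (lap (real n) k z y)) {0..real n}"
      by (rule has_integral_eq[OF _ I]) (simp add: f_def bounded_clinear_scaleC[OF \<phi>] scaleC_complex_def)
    moreover have "(\<integral>r. indicator {0..real n} r *\<^sub>R f r \<partial>lborel) = integral {0..real n} f"
      using set_borel_integral_eq_integral(2)[OF borel_integrable_atLeastAtMost'[OF continuous_on_subset[OF fc]], of 0 "real n"]
      by (simp add: set_lebesgue_integral_def)
    ultimately show ?thesis by (simp add: integral_unique)
  qed
  moreover have "(\<lambda>n. \<integral>r. indicator {0..real n} r *\<^sub>R f r \<partial>lborel) \<longlonglongrightarrow> (\<integral>r. indicator {0..} r *\<^sub>R f r \<partial>lborel)"
  proof (rule integral_dominated_convergence[OF _ _ E])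
    show "AE r in lborel. (\<lambda>n. indicator {0..real n} r *\<^sub>R f r) \<longlonglongrightarrow> indicator {0..} r *\<^sub>R f r"
    proof (intro AE_I2 tendsto_eventually)
      fix r :: real
      show "\<forall>\<^sub>F n in sequentially. indicator {0..real n} r *\<^sub>R f r = indicator {0..} r *\<^sub>R f r"
        using eventually_ge_at_top[of "nat \<lceil>r\<rceil>"]
      proof eventually_elim
        case (elim n)
        then have "r \<le> real n" by linarith
        then show ?case by (auto simp: indicator_def)
      qed
    qed
    show "AE r in lborel. norm (indicator {0..real n} r *\<^sub>R f r) \<le> (B * L * M * norm y) * (indicator {0..} r * exp (- ((Re z - w) * r)))" for n
      using bd order_trans[OF norm_ge_zero bd] by (intro AE_I2) (auto split: split_indicator)
  qed measurable
  moreover have "(\<integral>r. indicator {0..} r *\<^sub>R f r \<partial>lborel) = (\<integral>r. indicator {0<..} r *\<^sub>R f r \<partial>lborel)"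
  proof (rule integral_cong_AE)
    show "AE r in lborel. indicator {0..} r *\<^sub>R f r = indicator {0<..} r *\<^sub>R f r"
      using AE_lborel_singleton[of "0::real"] by eventually_elim (auto split: split_indicator)
  qed measurable
  ultimately show "\<phi> v = (\<integral>r. indicator {0<..} r *\<^sub>R (of_real (k r) * exp (- (z * of_real r)) * \<phi> (T (max 0 r) y)) \<partial>lborel)"
    unfolding f_def[symmetric] using LIMSEQ_unique by fastforce
qed

lemma functional_frac_int:
  fixes \<phi> :: "'a \<Rightarrow> complex"
  assumes \<phi>: "bounded_clinear \<phi>" and \<omega>: "w < \<omega>" and th: "0 < \<theta>" "\<theta> < 1"
  shows "\<phi> (frac_int \<omega> \<theta> y) = (\<integral>s. pow_kernel (1 - \<theta>) s *\<^sub>R \<phi> (R (of_real (\<omega> + max 0 s)) y) \<partial>lborel)"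
proof -
  interpret \<phi>: bounded_linear \<phi> using \<phi> by (rule bounded_clinearD)
  obtain L where L: "0 \<le> L" "\<And>x. norm (\<phi> x) \<le> L * norm x"
    using \<phi>.nonneg_bounded by (auto simp: mult.commute)
  have \<omega>0: "0 < \<omega>" using \<omega> w_nonneg by simp
  define h where "h s = \<phi> (R (of_real (\<omega> + max 0 s)) y)" for s
  have "continuous_on UNIV (\<lambda>s. R (of_real (\<omega> + max 0 s)) y)"
    by (rule continuous_on_compose2[OF R_real_continuous[OF \<omega>0]]) (auto intro!: continuous_intros)
  then have "continuous_on UNIV h" unfolding h_def by (rule \<phi>.continuous_on)
  then have [measurable]: "h \<in> borel_measurable borel" by (rule borel_measurable_continuous_onI)
  define m where "m = \<omega> - w"
  have m: "0 < m" using \<omega> by (simp add: m_def)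
  have P: "integrable lborel (\<lambda>s. (L * M * norm y) * (indicator {0<..} s * pow_majorant \<theta> m s))"
  proof (intro integrable_mult_right nonneg_has_integral_lborel(1)[OF _ _ pow_majorant_has_integral[OF th m]])
    show "pow_majorant \<theta> m \<in> borel_measurable borel" unfolding pow_majorant_def by measurable
  qed (use m in \<open>auto simp: pow_majorant_def\<close>)
  have int: "integrable lborel (\<lambda>s. pow_kernel (1 - \<theta>) s *\<^sub>R h s)"
  proof (rule Bochner_Integration.integrable_bound[OF P])
    show "AE s in lborel. norm (pow_kernel (1 - \<theta>) s *\<^sub>R h s) \<le> norm ((L * M * norm y) * (indicator {0<..} s * pow_majorant \<theta> m s))"
    proof (intro AE_I2)
      fix s :: real
      show "norm (pow_kernel (1 - \<theta>) s *\<^sub>R h s) \<le> norm ((L * M * norm y) * (indicator {0<..} s * pow_majorant \<theta> m s))"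
      proof (cases "0 < s")
        case True
        have "norm (h s) \<le> L * (M / (s + m) * norm y)"
        proof -
          have "norm (h s) \<le> L * norm (R (of_real (\<omega> + s)) y)" using L(2) True by (simp add: h_def)
          also have "\<dots> \<le> L * (M / (Re (of_real (\<omega> + s)) - w) * norm y)"
            using \<omega> True by (intro mult_left_mono R_decay L(1)) auto
          finally show ?thesis by (simp add: m_def algebra_simps)
        qed
        then have "s powr - \<theta> * norm (h s) \<le> s powr - \<theta> * (L * (M / (s + m) * norm y))" by (rule mult_left_mono) simp
        also have "\<dots> = (L * M * norm y) * (s powr - \<theta> / (s + m))" by simp
        also have "\<dots> \<le> (L * M * norm y) * pow_majorant \<theta> m s"
          using True m M_nonneg L(1) by (intro mult_left_mono pow_majorant_ge) auto
        finally show ?thesis using True by (simp add: pow_kernel_def order_trans[OF _ abs_ge_self])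
      qed (simp add: pow_kernel_def)
    qed
  qed measurable
  have "((\<lambda>s. \<phi> (s powr - \<theta> *\<^sub>R R (of_real (\<omega> + s)) y)) has_integral \<phi> (frac_int \<omega> \<theta> y)) {0<..}"
    unfolding frac_int_def
    by (rule has_integral_linear[OF integrable_integral[OF frac_int_integrable[OF \<omega> th]] \<phi>.bounded_linear_axioms, unfolded o_def])
  then have "((\<lambda>s. pow_kernel (1 - \<theta>) s *\<^sub>R h s) has_integral \<phi> (frac_int \<omega> \<theta> y)) {0<..}"
    by (rule has_integral_eq[rotated]) (simp add: pow_kernel_def h_def \<phi>.scaleR)
  moreover have "(\<lambda>s. if s \<in> {0<..} then pow_kernel (1 - \<theta>) s *\<^sub>R h s else 0) = (\<lambda>s. pow_kernel (1 - \<theta>) s *\<^sub>R h s)"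
    by (auto simp: pow_kernel_def)
  ultimately have "((\<lambda>s. pow_kernel (1 - \<theta>) s *\<^sub>R h s) has_integral \<phi> (frac_int \<omega> \<theta> y)) UNIV"
    using has_integral_restrict_UNIV[of "{0<..}" "\<lambda>s. pow_kernel (1 - \<theta>) s *\<^sub>R h s"] by simp
  then show ?thesis
    using has_integral_integral_lborel[OF int] unfolding h_def by (rule has_integral_unique)
qed

text \<open>If \<open>frac_int \<omega> \<theta> y = 0\<close> then \<open>frac_int \<omega> \<theta> (T t y) = 0\<close> for all \<open>t \<ge> 0\<close>. Applying a functional \<open>\<phi>\<close> and writing \<open>R (\<omega> + s)\<close> as a
Laplace transform shows that \<open>u r = exp (- \<omega> r) \<phi> (T r y)\<close> satisfies Abel's homogeneous equation. Hence its integral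
\<open>\<phi> (R \<omega> y)\<close> is zero.\<close>
lemma frac_int_injective:
  assumes \<omega>: "w < \<omega>" and th: "0 < \<theta>" "\<theta> < 1" and zero: "frac_int \<omega> \<theta> y = 0"
  shows "y = 0"
proof -
  have \<omega>0: "0 < Re (complex_of_real \<omega>)" using \<omega> w_nonneg by simp
  have "R (of_real \<omega>) y = 0"
  proof (rule eq_zero_of_functionals)
    fix \<phi> :: "'a \<Rightarrow> complex" assume \<phi>: "bounded_clinear \<phi>"
    interpret \<phi>: bounded_linear \<phi> using \<phi> by (rule bounded_clinearD)
    obtain L where L: "0 \<le> L" "\<And>x. norm (\<phi> x) \<le> L * norm x"
      and decay: "\<And>z r y. 0 \<le> r \<Longrightarrow> norm (exp (- (z * of_real r)) * \<phi> (T (max 0 r) y)) \<le> (L * M * norm y) * exp (- ((Re z - w) * r))"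
      by (rule functional_orbit_decay[OF \<phi>]) blast
    define u where "u r = exp (- (of_real \<omega> * of_real r)) * \<phi> (T (max 0 r) y)" for r :: real
    have "continuous_on UNIV u" unfolding u_def by (intro continuous_intros \<phi>.continuous_on T_max_continuous)
    then have um[measurable]: "u \<in> borel_measurable borel" by (rule borel_measurable_continuous_onI)
    have bd: "norm (u r) \<le> (L * M * norm y) * exp (- ((\<omega> - w) * r))" if "0 \<le> r" for r
      using decay[OF that, of "of_real \<omega>" y] by (simp add: u_def)
    have laplace: "\<phi> (R (of_real (\<omega> + s)) x) = (\<integral>r. indicator {0<..} r *\<^sub>R (exp (- (of_real (\<omega> + s) * of_real r)) * \<phi> (T (max 0 r) x)) \<partial>lborel)"
      if "0 \<le> s" for s x
      using functional_lap_limit(2)[OF \<phi> _ _ _ laplace_tendsto_resolvent[of "of_real (\<omega> + s)" x], of 1] \<omega> that by simp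
    have "(\<integral>v. indicator {0<..} v *\<^sub>R u v \<partial>lborel) = 0"
    proof (rule abel_transform_zero[OF th _ um bd])
      show "0 < \<omega> - w" using \<omega> by simp
      fix t :: real assume t: "0 < t"
      have shift: "\<phi> (R (of_real (\<omega> + max 0 s)) (T t y)) = exp (of_real (\<omega> * t)) * (\<integral>r. (indicator {0<..} r * exp (- (r * s))) *\<^sub>R u (r + t) \<partial>lborel)"
        if "0 < s" for s
      proof -
        have "\<phi> (R (of_real (\<omega> + max 0 s)) (T t y)) = (\<integral>r. indicator {0<..} r *\<^sub>R (exp (- (of_real (\<omega> + s) * of_real r)) * \<phi> (T (max 0 r) (T t y))) \<partial>lborel)"
          using laplace[of s] that by simp
        also have "\<dots> = (\<integral>r. exp (of_real (\<omega> * t)) * ((indicator {0<..} r * exp (- (r * s))) *\<^sub>R u (r + t)) \<partial>lborel)"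
        proof (rule Bochner_Integration.integral_cong[OF refl])
          fix r :: real
          show "indicator {0<..} r *\<^sub>R (exp (- (of_real (\<omega> + s) * of_real r)) * \<phi> (T (max 0 r) (T t y))) = exp (of_real (\<omega> * t)) * ((indicator {0<..} r * exp (- (r * s))) *\<^sub>R u (r + t))"
          proof (cases "0 < r")
            case True
            have "exp (complex_of_real (\<omega> * t)) * (of_real (exp (- (r * s))) * exp (- (of_real \<omega> * of_real (r + t)))) = exp (- (of_real (\<omega> + s) * of_real r))"
              unfolding exp_of_real[symmetric] exp_add[symmetric] by (simp add: algebra_simps)
            then show ?thesis using True t T_add[of r t y]
              by (simp add: u_def scaleR_conv_of_real mult.assoc[symmetric])
          qed simp
        qed
        finally show ?thesis by (simp only: integral_mult_right_zero)
      qed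
      have "frac_int \<omega> \<theta> (T t y) = T t (frac_int \<omega> \<theta> y)"
        by (rule frac_int_commute[symmetric, OF \<omega> th T_linear]) (use t \<omega> w_nonneg in \<open>auto simp: R_T_commute\<close>)
      then have "\<phi> (frac_int \<omega> \<theta> (T t y)) = 0"
        using zero t by (simp add: linear_0[OF bounded_linear.linear[OF T_linear]] \<phi>.zero)
      then have "0 = (\<integral>s. pow_kernel (1 - \<theta>) s *\<^sub>R \<phi> (R (of_real (\<omega> + max 0 s)) (T t y)) \<partial>lborel)"
        by (simp add: functional_frac_int[OF \<phi> \<omega> th])
      also have "\<dots> = (\<integral>s. exp (of_real (\<omega> * t)) * (pow_kernel (1 - \<theta>) s *\<^sub>R (\<integral>r. (indicator {0<..} r * exp (- (r * s))) *\<^sub>R u (r + t) \<partial>lborel)) \<partial>lborel)"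
      proof (rule Bochner_Integration.integral_cong[OF refl])
        show "pow_kernel (1 - \<theta>) s *\<^sub>R \<phi> (R (of_real (\<omega> + max 0 s)) (T t y)) = exp (of_real (\<omega> * t)) * (pow_kernel (1 - \<theta>) s *\<^sub>R (\<integral>r. (indicator {0<..} r * exp (- (r * s))) *\<^sub>R u (r + t) \<partial>lborel))" for s
          using shift[of s] by (cases "0 < s") (simp_all add: pow_kernel_def)
      qed
      also have "\<dots> = exp (of_real (\<omega> * t)) * (\<integral>s. pow_kernel (1 - \<theta>) s *\<^sub>R (\<integral>r. (indicator {0<..} r * exp (- (r * s))) *\<^sub>R u (r + t) \<partial>lborel) \<partial>lborel)"
        by (rule integral_mult_right_zero)
      finally have "(\<integral>s. pow_kernel (1 - \<theta>) s *\<^sub>R (\<integral>r. (indicator {0<..} r * exp (- (r * s))) *\<^sub>R u (r + t) \<partial>lborel) \<partial>lborel) = 0"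
        by simp
      moreover have "(\<integral>s. pow_kernel (1 - \<theta>) s *\<^sub>R (\<integral>r. (indicator {0<..} r * exp (- (r * s))) *\<^sub>R u (r + t) \<partial>lborel) \<partial>lborel)
         = complex_of_real (Gamma (1 - \<theta>)) * (\<integral>r. pow_kernel \<theta> r *\<^sub>R u (r + t) \<partial>lborel)"
      proof (rule stieltjes_eq_pow_kernel[OF th])
        show "0 < \<omega> - w" using \<omega> by simp
        show "cmod (u (r + t)) \<le> (L * M * norm y) * exp (- ((\<omega> - w) * r))" if "0 < r" for r
        proof -
          have "cmod (u (r + t)) \<le> (L * M * norm y) * exp (- ((\<omega> - w) * (r + t)))" by (rule bd) (use that t in simp)
          also have "\<dots> \<le> (L * M * norm y) * exp (- ((\<omega> - w) * r))"
            using L(1) M_nonneg \<omega> t by (intro mult_left_mono) auto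
          finally show ?thesis .
        qed
      qed measurable
      moreover have "0 < Gamma (1 - \<theta>)" using th by (simp add: Gamma_real_pos)
      ultimately show "(\<integral>r. pow_kernel \<theta> r *\<^sub>R u (r + t) \<partial>lborel) = 0" by simp
    qed simp
    then show "\<phi> (R (of_real \<omega>) y) = 0" using laplace[of 0 y] by (simp add: u_def)
  qed
  then show ?thesis by (rule R_injective[OF \<omega>0])
qed

lemma res_power_injective:
  assumes \<omega>: "w < \<omega>" and th: "0 \<le> \<theta>" "\<theta> < 1"
  shows "res_power \<omega> n \<theta> y = 0 \<Longrightarrow> y = 0"
proof (induction n)
  case 0
  have "sin (pi * \<theta>) \<noteq> 0" if "\<theta> \<noteq> 0" using sin_gt_zero[of "pi * \<theta>"] that th by simp
  then show ?case using 0 frac_int_injective[OF \<omega>, of \<theta> y] th by (auto simp: res_power_def split: if_splits)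
next
  case (Suc n)
  then show ?case using R_injective[of "of_real \<omega>"] \<omega> w_nonneg by (simp add: res_power_Suc)
qed

end

section \<open>Fourier transforms of localised orbits\<close>

context resolvent_semigroup
begin

text \<open>\<open>lap 1 k (Complex a \<xi>) y\<close> is the Fourier transform of a bounded function supported in \<open>{0..1}\<close>. The bound is uniform in
\<open>a \<ge> 0\<close>.\<close>
lemma lap_Fourier_bound:
  assumes p: "1 \<le> p" and C: "0 \<le> C"
    and ft: "\<And>f :: real \<Rightarrow> 'a. f \<in> Lq_space 1 \<Longrightarrow> f \<in> Lq_space (ereal p) \<Longrightarrow>
        fourier_transform f \<in> Lq_space q \<and> Lq_norm q (fourier_transform f) \<le> C * Lq_norm (ereal p) f"
    and a: "0 \<le> a" and k: "continuous_on UNIV k" and k01: "k 0 = 0" "k 1 = 0" and B: "\<And>s. s \<in> {0..1} \<Longrightarrow> \<bar>k s\<bar> \<le> B"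
  shows "(\<lambda>\<xi>. lap 1 k (Complex a \<xi>) y) \<in> Lq_space q"
    "Lq_norm q (\<lambda>\<xi>. lap 1 k (Complex a \<xi>) y) \<le> C * (B * (M * exp w * norm y))"
proof -
  define h where "h s = (cutoff k s * exp (- (a * s))) *\<^sub>R T (max 0 s) y" for s
  have h: "continuous_on UNIV h"
    unfolding h_def by (intro continuous_intros cutoff_continuous k T_max_continuous)
  have supp: "h s = 0" if "s \<notin> {0..1}" for s 
  proof -
    have "cutoff k s = 0" using that by (subst cutoff_eq) (auto simp: k01)
    then show ?thesis by (simp add: h_def)
  qed
  have B0: "0 \<le> B" using B[of 0] k01 by simp
  have bd: "norm (h s) \<le> B * (M * exp w * norm y)" for s
  proof (cases "s \<in> {0..1}")
    case True
    have "\<bar>k s\<bar> * exp (- (a * s)) \<le> B * 1" using True a B B0 by (intro mult_mono) auto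
    then show ?thesis using True growth_upto[of s 1 y] k01 B0
      by (auto simp: h_def cutoff_eq[of k] abs_mult intro!: mult_mono)
  next
    case False
    then show ?thesis using supp B0 M_nonneg by simp
  qed
  have FT: "fourier_transform h = (\<lambda>\<xi>. lap 1 k (Complex a \<xi>) y)"
  proof
    fix \<xi>
    have "fourier_transform h \<xi> = integral UNIV (\<lambda>s. if s \<in> {0..1} then (of_real (k s) * exp (- (Complex a \<xi> * of_real s))) *\<^sub>C T s y else 0)"
      unfolding fourier_transform_def
    proof (rule integral_cong)
      fix s :: real
      show "cis (- (\<xi> * s)) *\<^sub>C h s = (if s \<in> {0..1} then (of_real (k s) * exp (- (Complex a \<xi> * of_real s))) *\<^sub>C T s y else 0)"
      proof (cases "s \<in> {0..1}")
        case True
        have "exp (- (Complex a \<xi> * of_real s)) = of_real (exp (- (a * s))) * cis (- (\<xi> * s))"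
          by (simp add: exp_eq_polar)
        then show ?thesis using True k01
          by (simp add: h_def cutoff_eq[of k] scaleC_scaleC mult_ac flip: scaleC_of_real)
      next
        case False
        then show ?thesis using supp[OF False] by (simp only: if_False scaleC.zero_right)
      qed
    qed
    then show "fourier_transform h \<xi> = lap 1 k (Complex a \<xi>) y"
      unfolding lap_def by (simp only: integral_restrict_UNIV)
  qed
  have 1: "h \<in> Lq_space 1" using Lq_norm_unit_support(1)[OF h supp bd, of 1] by (simp add: one_ereal_def)
  have 2: "h \<in> Lq_space (ereal p)" "Lq_norm (ereal p) h \<le> B * (M * exp w * norm y)"
    using Lq_norm_unit_support[OF h supp bd p] by blast+
  show "(\<lambda>\<xi>. lap 1 k (Complex a \<xi>) y) \<in> Lq_space q" using ft[OF 1 2(1)] FT by simp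
  show "Lq_norm q (\<lambda>\<xi>. lap 1 k (Complex a \<xi>) y) \<le> C * (B * (M * exp w * norm y))"
    using ft[OF 1 2(1)] FT mult_left_mono[OF 2(2) C] by simp
qed

lemma R_tendsto2:
  assumes z: "(z \<longlongrightarrow> z0) F" and v: "(v \<longlongrightarrow> v0) F" and z0: "0 < Re z0"
  shows "((\<lambda>i. R (z i) (v i)) \<longlongrightarrow> R z0 v0) F"
proof -
  have ev: "\<forall>\<^sub>F i in F. Re z0 / 2 < Re (z i)"
    by (rule order_tendstoD(1)[OF tendsto_Re[OF z]]) (use z0 in simp)
  have "((\<lambda>i. R (z i) v0) \<longlongrightarrow> R z0 v0) F"
    by (rule isCont_tendsto_compose[OF _ z]) (use R_tendsto[OF z0] in \<open>simp add: isCont_def\<close>)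
  moreover have "((\<lambda>i. R (z i) (v i - v0)) \<longlongrightarrow> 0) F"
  proof (rule Lim_null_comparison)
    show "\<forall>\<^sub>F i in F. norm (R (z i) (v i - v0)) \<le> g (inverse (Re z0 / 2)) * norm (v i - v0)"
      using ev by eventually_elim (rule R_bound_right, use z0 in auto)
    show "((\<lambda>i. g (inverse (Re z0 / 2)) * norm (v i - v0)) \<longlongrightarrow> 0) F"
      by (intro tendsto_mult_right_zero tendsto_norm_zero LIM_zero v)
  qed
  ultimately have "((\<lambda>i. R (z i) (v i - v0) + R (z i) v0) \<longlongrightarrow> R z0 v0) F" using tendsto_add by fastforce
  moreover have "\<forall>\<^sub>F i in F. R (z i) (v i - v0) + R (z i) v0 = R (z i) (v i)"
    using ev by eventually_elim (use z0 in \<open>simp add: R_diff\<close>)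
  ultimately show ?thesis by (rule Lim_transform_eventually)
qed

lemma R_continuous_on:
  assumes "continuous_on S z" "continuous_on S v" "\<And>x. x \<in> S \<Longrightarrow> 0 < Re (z x)"
  shows "continuous_on S (\<lambda>x. R (z x) (v x))"
  using assms unfolding continuous_on_def by (auto intro: R_tendsto2)

lemma functional_R_derivative:
  assumes \<phi>: "bounded_clinear \<phi>" and z: "0 < Re z"
  shows "((\<lambda>z. \<phi> (R z x) :: complex) has_field_derivative - \<phi> (R z (R z x))) (at z within S)"
proof -
  interpret \<phi>: bounded_linear \<phi> using \<phi> by (rule bounded_clinearD)
  have "((\<lambda>y. - \<phi> (R y (R z x))) \<longlongrightarrow> - \<phi> (R z (R z x))) (at z)"
    by (intro tendsto_minus \<phi>.tendsto R_tendsto z)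
  moreover have "\<forall>\<^sub>F y in at z. - \<phi> (R y (R z x)) = (\<phi> (R y x) - \<phi> (R z x)) / (y - z)"
  proof -
    have "\<forall>\<^sub>F y in at z. Re y > 0 \<and> y \<noteq> z"
      using eventually_conj[OF order_tendstoD(1)[OF tendsto_Re[OF tendsto_ident_at] z] eventually_neq_at_within] by simp
    then show ?thesis
    proof eventually_elim
      case (elim y)
      have "\<phi> (R y x) - \<phi> (R z x) = (z - y) * \<phi> (R y (R z x))"
        using resolvent_identity[of y z x] elim z
        by (metis \<phi>.diff bounded_clinear_scaleC[OF \<phi>] scaleC_complex_def)
      then show ?case using elim by (simp add: field_simps)
    qed
  qed
  ultimately have "((\<lambda>y. (\<phi> (R y x) - \<phi> (R z x)) / (y - z)) \<longlongrightarrow> - \<phi> (R z (R z x))) (at z)"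
    by (rule Lim_transform_eventually)
  then have "((\<lambda>z. \<phi> (R z x) :: complex) has_field_derivative - \<phi> (R z (R z x))) (at z)"
    by (simp add: has_field_derivative_iff)
  then show ?thesis by (rule has_field_derivative_at_within)
qed

lemma lap_continuous_on:
  assumes "continuous_on {0..1} k"
  shows "continuous_on S (\<lambda>z. lap 1 k z x)"
proof -
  have "continuous_on (S \<times> cbox 0 1) (\<lambda>(z, s). (of_real (k s) * exp (- (z * of_real s))) *\<^sub>C T s x)"
    unfolding case_prod_beta
    by (intro continuous_intros continuous_on_compose2[OF assms] continuous_on_compose2[OF T_continuous]) auto
  from integral_continuous_on_param[OF this] show ?thesis by (simp add: lap_def)
qed

text \<open>Under the functional, the product of the resolvent and the truncated transform becomes a single scalar integral over
\<open>{0..1}\<close> that depends holomorphically on a parameter.\<close>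
lemma functional_R_lap_holomorphic:
  assumes \<phi>: "bounded_clinear \<phi>" and k: "continuous_on {0..1} k"
  shows "(\<lambda>z. \<phi> (R z (lap 1 k z x)) :: complex) holomorphic_on {z. 0 < Re z}"
proof -
  interpret \<phi>: bounded_linear \<phi> using \<phi> by (rule bounded_clinearD)
  define f where "f z s = of_real (k s) * exp (- (z * of_real s)) * \<phi> (R z (T s x))" for z s
  define f' where "f' z s = of_real (k s) * (- of_real s * exp (- (z * of_real s)) * \<phi> (R z (T s x)) + - \<phi> (R z (R z (T s x))) * exp (- (z * of_real s)))" for z s
  have I: "(f z has_integral \<phi> (R z (lap 1 k z x))) {0..1}" if "0 < Re z" for z
  proof -
    have "((\<lambda>s. \<phi> (R z ((of_real (k s) * exp (- (z * of_real s))) *\<^sub>C T s x))) has_integral \<phi> (R z (lap 1 k z x))) {0..1}"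
      unfolding lap_def
      by (rule has_integral_linear[OF has_integral_linear[OF integrable_integral[OF lap_integrable[OF k]] R_linear[OF that]] \<phi>.bounded_linear_axioms, unfolded o_def])
    then show ?thesis
      by (rule has_integral_eq[rotated]) (simp add: f_def R_scaleC that bounded_clinear_scaleC[OF \<phi>] scaleC_complex_def)
  qed
  have "(\<lambda>z. integral (cbox 0 1) (f z)) holomorphic_on {z. 0 < Re z}"
  proof (rule leibniz_rule_holomorphic)
    fix z :: complex and s :: real assume z: "z \<in> {z. 0 < Re z}" and s: "s \<in> cbox 0 1"
    have e: "((\<lambda>z. exp (- (z * of_real s))) has_field_derivative - of_real s * exp (- (z * of_real s))) (at z within {z. 0 < Re z})"
      by (auto intro!: derivative_eq_intros)
    have "((\<lambda>z. of_real (k s) * (exp (- (z * of_real s)) * \<phi> (R z (T s x)))) has_field_derivative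
        of_real (k s) * (- of_real s * exp (- (z * of_real s)) * \<phi> (R z (T s x)) + - \<phi> (R z (R z (T s x))) * exp (- (z * of_real s)))) (at z within {z. 0 < Re z})"
      by (intro DERIV_cmult DERIV_mult e functional_R_derivative[OF \<phi>]) (use z in simp)
    then show "((\<lambda>z. f z s) has_field_derivative f' z s) (at z within {z. 0 < Re z})"
      unfolding f_def f'_def by (simp add: mult.assoc)
  next
    show "f z integrable_on cbox 0 1" if "z \<in> {z. 0 < Re z}" for z using I[of z] that by auto
  next
    have T: "continuous_on ({z. 0 < Re z} \<times> cbox 0 1) (\<lambda>zs. T (snd zs) x)"
      by (rule continuous_on_compose2[OF T_continuous]) (auto intro!: continuous_intros)
    have k': "continuous_on ({z. 0 < Re z} \<times> cbox 0 1) (\<lambda>zs. k (snd zs))"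
      by (rule continuous_on_compose2[OF k]) (auto intro!: continuous_intros)
    show "continuous_on ({z. 0 < Re z} \<times> cbox 0 1) (\<lambda>(z, s). f' z s)"
      unfolding f'_def case_prod_beta
      by (intro continuous_intros \<phi>.continuous_on R_continuous_on T k') auto
    show "convex {z. 0 < Re z}" by (rule convex_halfspace_Re_gt)
  qed
  then show ?thesis by (rule holomorphic_transform) (simp add: integral_unique[OF I])
qed

end

section \<open>The inversion formula\<close>

context resolvent_semigroup
begin

lemma bump_bounded: obtains B where "0 \<le> B" "\<And>s. s \<in> {0..1} \<Longrightarrow> \<bar>bump J j s\<bar> \<le> B"
proof -
  obtain B where "\<forall>x\<in>bump J j ` {0..1}. norm x \<le> B"
    using compact_continuous_image[OF bump_continuous compact_Icc, THEN compact_imp_bounded] unfolding bounded_iff by blast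
  then have "\<And>s. s \<in> {0..1} \<Longrightarrow> \<bar>bump J j s\<bar> \<le> max 0 B" by (auto intro: max.coboundedI2)
  then show ?thesis using that[of "max 0 B"] by simp
qed

text \<open>The case of two full resolvents, where crude bounds for the remaining terms suffice.\<close>
lemma smooth_orbit_decay:
  assumes b: "b < \<omega>" and \<omega>: "w < \<omega>" and J: "2 \<le> J"
  shows "\<exists>C\<ge>0. \<forall>z. 0 < Re z \<longrightarrow> Re z \<le> b \<longrightarrow>
    norm (lap 1 (bump J 0) z (R (of_real \<omega>) (R (of_real \<omega>) y))) \<le> C * (1 + \<bar>Im z\<bar>) powr - 2"
proof -
  obtain C where C: "0 \<le> C" and hC: "\<And>j z y. j + 2 \<le> J \<Longrightarrow> 0 < Re z \<Longrightarrow> Re z \<le> b \<Longrightarrow>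
    norm (lap 1 (bump J j) z (res_power \<omega> 2 0 y)) \<le> C * (1 + \<bar>Im z\<bar>) powr - (real 2 + 0) * (\<Sum>i\<le>Suc 2. norm (lap 1 (bump J (j + i)) z y))"
    using lap_res_power_decay[where \<psi>="bump J" and \<theta>=0 and n=2 and J=J, OF b \<omega> order_refl zero_less_one bump_has_derivative bump_ends]
    by blast
  have "\<exists>B. 0 \<le> B \<and> (\<forall>s\<in>{0..1}. \<bar>bump J i s\<bar> \<le> B)" for i by (metis bump_bounded)
  then obtain B where B: "\<And>i. 0 \<le> B i" "\<And>i s. s \<in> {0..1} \<Longrightarrow> \<bar>bump J i s\<bar> \<le> B i" by metis
  define S where "S = (\<Sum>i\<le>Suc 2. B i * (M * exp w * norm y))"
  have S: "0 \<le> S" unfolding S_def using B(1) M_nonneg by (intro sum_nonneg) auto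
  show ?thesis
  proof (intro exI[of _ "C * S"] conjI allI impI)
    fix z assume z: "0 < Re z" "Re z \<le> b"
    have "(\<Sum>i\<le>Suc 2. norm (lap 1 (bump J (0 + i)) z y)) \<le> S"
      unfolding S_def
    proof (rule sum_mono)
      fix i
      show "norm (lap 1 (bump J (0 + i)) z y) \<le> B i * (M * exp w * norm y)"
      proof -
        have "norm (lap 1 (bump J i) z y) \<le> 1 * (B i * (M * exp (w * 1) * norm y))"
          by (rule lap_norm_le) (use B z bump_continuous in auto)
        then show ?thesis by simp
      qed
    qed
    then have "C * (1 + \<bar>Im z\<bar>) powr - 2 * (\<Sum>i\<le>Suc 2. norm (lap 1 (bump J (0 + i)) z y)) \<le> C * (1 + \<bar>Im z\<bar>) powr - 2 * S"
      using C by (intro mult_left_mono) auto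
    then show "norm (lap 1 (bump J 0) z (R (of_real \<omega>) (R (of_real \<omega>) y))) \<le> C * S * (1 + \<bar>Im z\<bar>) powr - 2"
      using hC[of 0 z y] J z by (simp add: res_power_def numeral_2_eq_2 mult_ac)
  qed (use C S in simp)
qed

lemma integrable_line:
  fixes f :: "real \<Rightarrow> 'b::{banach, second_countable_topology}"
  assumes f: "continuous_on UNIV f" and le: "\<And>x. norm (f x) \<le> C * (1 + \<bar>x\<bar>) powr - 2"
  shows "integrable lborel f"
proof (rule Bochner_Integration.integrable_bound)
  show "integrable lborel (\<lambda>x. C * (1 + \<bar>x\<bar>) powr - 2)"
    by (intro integrable_mult_right integrable_one_plus_abs_powr) simp
  show "f \<in> borel_measurable lborel" using borel_measurable_continuous_onI[OF f] by simp
  show "AE x in lborel. norm (f x) \<le> norm (C * (1 + \<bar>x\<bar>) powr - 2)"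
    using le by (intro AE_I2) (auto intro: order_trans[OF _ abs_ge_self])
qed

lemma Complex_continuous: "continuous_on S (\<lambda>\<xi>. Complex a \<xi>)"
  unfolding Complex_eq by (intro continuous_intros)

lemma inversion_line_continuous:
  assumes "0 < a"
  shows "continuous_on S (\<lambda>\<xi>. R (Complex a \<xi>) (lap 1 (bump J 0) (Complex a \<xi>) x))"
  by (intro R_continuous_on Complex_continuous continuous_on_compose2[OF lap_continuous_on[OF bump_continuous, of UNIV]])
    (use assms in auto)

text \<open>The left-hand side is the inverse Fourier integral on the line \<open>Re z = a\<close>, where \<open>a\<close> may be smaller than the growth
exponent \<open>w\<close>. Both sides are compared after applying a functional and moving the line to \<open>Re z = b > w\<close>, where the
integrand is the Laplace transform of the orbit multiplied by the ramp. The quadratic decay needed for absolute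
convergence and for the shift comes from \<open>x\<close> being in the range of the squared resolvent.\<close>
lemma inversion_formula:
  assumes a: "0 < a" "a \<le> b" and b: "w < b" "b < \<omega>" and J: "2 \<le> J" and s: "0 \<le> s"
    and x: "x = R (of_real \<omega>) (R (of_real \<omega>) y)"
  shows "integral UNIV (\<lambda>\<xi>. cis (\<xi> * s) *\<^sub>C R (Complex a \<xi>) (lap 1 (bump J 0) (Complex a \<xi>) x))
    = (2 * pi * exp (- (a * s)) * ramp J s) *\<^sub>R T s x"
proof -
  have \<omega>: "w < \<omega>" using b by simp
  define F where "F z = R z (lap 1 (bump J 0) z x)" for z
  obtain C where C: "0 \<le> C" and hC: "\<And>z. 0 < Re z \<Longrightarrow> Re z \<le> b \<Longrightarrow> norm (lap 1 (bump J 0) z x) \<le> C * (1 + \<bar>Im z\<bar>) powr - 2"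
    using smooth_orbit_decay[OF b(2) \<omega> J] unfolding x by blast
  define \<kappa> where "\<kappa> = \<bar>g (inverse a)\<bar>"
  have F: "norm (F z) \<le> (\<kappa> * C) * (1 + \<bar>Im z\<bar>) powr - 2" if "a \<le> Re z" "Re z \<le> b" for z
  proof -
    have "norm (F z) \<le> g (inverse a) * norm (lap 1 (bump J 0) z x)" unfolding F_def by (rule R_bound_right[OF a(1) that(1)])
    also have "\<dots> \<le> \<kappa> * norm (lap 1 (bump J 0) z x)" unfolding \<kappa>_def by (intro mult_right_mono) auto
    also have "\<dots> \<le> \<kappa> * (C * (1 + \<bar>Im z\<bar>) powr - 2)" using hC[of z] that a by (intro mult_left_mono) (auto simp: \<kappa>_def)
    finally show ?thesis by simp
  qed
  have Fc: "continuous_on UNIV (\<lambda>\<xi>. F (Complex c \<xi>))" if "0 < c" for c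
    unfolding F_def by (rule inversion_line_continuous[OF that])
  have "(\<lambda>\<xi>. cis (\<xi> * s) *\<^sub>C F (Complex a \<xi>)) integrable_on UNIV"
  proof (rule continuous_dominated_integrable_on_UNIV)
    show "continuous_on UNIV (\<lambda>\<xi>. cis (\<xi> * s) *\<^sub>C F (Complex a \<xi>))"
      by (intro continuous_intros Fc a)
    show "(\<lambda>\<xi>. (\<kappa> * C) * (1 + \<bar>\<xi>\<bar>) powr - 2) integrable_on UNIV"
      by (intro integrable_on_mult_right integrable_on_lborel integrable_one_plus_abs_powr) simp
    show "norm (cis (\<xi> * s) *\<^sub>C F (Complex a \<xi>)) \<le> (\<kappa> * C) * (1 + \<bar>\<xi>\<bar>) powr - 2" for \<xi>
      using F[of "Complex a \<xi>"] a by (simp add: norm_scaleC)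
  qed
  note int = this
  have "integral UNIV (\<lambda>\<xi>. cis (\<xi> * s) *\<^sub>C F (Complex a \<xi>)) - (2 * pi * exp (- (a * s)) * ramp J s) *\<^sub>R T s x = 0"
  proof (rule eq_zero_of_functionals)
    fix \<phi> :: "'a \<Rightarrow> complex" assume \<phi>: "bounded_clinear \<phi>"
    interpret \<phi>: bounded_linear \<phi> using \<phi> by (rule bounded_clinearD)
    obtain L where L: "0 \<le> L" "\<And>x. norm (\<phi> x) \<le> L * norm x"
      and decay: "\<And>z r y. 0 \<le> r \<Longrightarrow> norm (exp (- (z * of_real r)) * \<phi> (T (max 0 r) y)) \<le> (L * M * norm y) * exp (- ((Re z - w) * r))"
      by (rule functional_orbit_decay[OF \<phi>]) blast
    define f where "f z = exp (z * of_real s) * \<phi> (F z)" for z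
    have fC: "f (Complex c \<xi>) = of_real (exp (c * s)) * (cis (\<xi> * s) * \<phi> (F (Complex c \<xi>)))" for c \<xi>
      by (simp add: f_def exp_eq_polar)
    have phiF: "cmod (\<phi> (F z)) \<le> (L * \<kappa> * C) * (1 + \<bar>Im z\<bar>) powr - 2" if "a \<le> Re z" "Re z \<le> b" for z
      using order_trans[OF L(2) mult_left_mono[OF F[OF that] L(1)]] by (simp add: mult_ac)
    have phiFc: "continuous_on UNIV (\<lambda>\<xi>. \<phi> (F (Complex c \<xi>)))" if "0 < c" for c
      by (intro \<phi>.continuous_on Fc that)
    have phiFI: "integrable lborel (\<lambda>\<xi>. \<phi> (F (Complex c \<xi>)))" if "a \<le> c" "c \<le> b" for c
      by (rule integrable_line[OF phiFc, where C="L * \<kappa> * C"]) (use phiF[of "Complex c _"] that a in auto)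
    have cisFI: "integrable lborel (\<lambda>\<xi>. cis (\<xi> * s) * \<phi> (F (Complex c \<xi>)))" if "a \<le> c" "c \<le> b" for c
      by (rule integrable_line[where C="L * \<kappa> * C"])
        (use phiF[of "Complex c _"] that a in \<open>auto simp: norm_mult intro!: continuous_intros phiFc\<close>)
    \<comment> \<open>the factor \<open>exp (z * of_real s)\<close> in \<open>f\<close> makes the inversion integrals on all lines directly comparable\<close>
    have shift: "(\<integral>\<xi>. f (Complex a \<xi>) \<partial>lborel) = (\<integral>\<xi>. f (Complex b \<xi>) \<partial>lborel)"
    proof (rule integral_vertical_line_shift)
      show "f holomorphic_on {z. 0 < Re z}"
        unfolding f_def F_def by (intro holomorphic_intros functional_R_lap_holomorphic[OF \<phi> bump_continuous])
      show "convex {z. 0 < Re z}" "open {z. 0 < Re z}" by (simp_all add: convex_halfspace_Re_gt open_halfspace_Re_gt)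
      show "a \<le> Re z \<Longrightarrow> Re z \<le> b \<Longrightarrow> z \<in> {z. 0 < Re z}" for z using a by simp
      show "a \<le> b" by (rule a)
      show "cmod (f z) \<le> (exp (b * s) * (L * \<kappa> * C)) / (1 + (Im z)\<^sup>2)" if z: "a \<le> Re z" "Re z \<le> b" for z
      proof -
        have pow: "(1 + \<bar>Im z\<bar>) powr - 2 \<le> 1 / (1 + (Im z)\<^sup>2)"
        proof -
          have "(1 + \<bar>Im z\<bar>) powr - 2 = 1 / (1 + \<bar>Im z\<bar>)\<^sup>2" by (simp add: powr_minus_divide powr_numeral)
          also have "\<dots> \<le> 1 / (1 + (Im z)\<^sup>2)"
            by (rule frac_le) (auto simp: power2_sum add_pos_nonneg)
          finally show ?thesis .
        qed
        have "cmod (f z) \<le> exp (b * s) * ((L * \<kappa> * C) * (1 + \<bar>Im z\<bar>) powr - 2)"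
          unfolding f_def norm_mult using phiF[OF z] z s by (intro mult_mono) (auto simp: norm_exp_eq_Re mult_right_mono)
        also have "\<dots> \<le> exp (b * s) * ((L * \<kappa> * C) * (1 / (1 + (Im z)\<^sup>2)))"
          using pow L C by (intro mult_left_mono) (auto simp: \<kappa>_def)
        finally show ?thesis by simp
      qed
      show "integrable lborel (\<lambda>y. f (Complex a y))" "integrable lborel (\<lambda>y. f (Complex b y))"
        unfolding fC using a by (intro integrable_mult_right cisFI; simp)+
    qed
    \<comment> \<open>the function whose Fourier transform is \<open>\<phi> (F (Complex b \<xi>))\<close>; the ramp extends it by zero to negative \<open>r\<close>\<close>
    define f0 where "f0 r = complex_of_real (ramp J r) * exp (- (of_real b * of_real r)) * \<phi> (T (max 0 r) x)" for r :: real
    have lim: "(\<lambda>n. lap (real n) (ramp J) (Complex b \<xi>) x) \<longlonglongrightarrow> F (Complex b \<xi>)" for \<xi>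
    proof -
      have "lap 1 (cutoff (bump J 0)) z x = lap 1 (bump J 0) z x" for z
        unfolding lap_def by (rule integral_cong) (simp add: cutoff_bump)
      moreover have "(\<lambda>n. lap (real n) (ramp J) (Complex b \<xi>) x)
          \<longlonglongrightarrow> R (Complex b \<xi>) (lap 1 (cutoff (bump J 0)) (Complex b \<xi>) x + of_real (ramp J 0) *\<^sub>C x)"
        by (rule lap_tendsto_resolvent) (use b in \<open>auto intro: ramp_has_derivative cutoff_bump ramp_eventually_const\<close>)
      ultimately show ?thesis by (simp add: ramp_nonpos scaleC.zero_left F_def)
    qed
    have supp: "indicator {0<..} r *\<^sub>R (of_real (ramp J r) * exp (- (z * of_real r)) * \<phi> (T (max 0 r) x)) = of_real (ramp J r) * exp (- (z * of_real r)) * \<phi> (T (max 0 r) x)" for z r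
      by (auto simp: ramp_nonpos split: split_indicator)
    have inv: "(\<integral>\<xi>. cis (\<xi> * s) * \<phi> (F (Complex b \<xi>)) \<partial>lborel) = 2 * pi * f0 s"
    proof (rule fourier_inversion)
      show "continuous_on UNIV f0"
        unfolding f0_def by (intro continuous_intros ramp_continuous \<phi>.continuous_on T_max_continuous)
      show "integrable lborel f0"
        using functional_lap_limit(1)[OF \<phi> _ ramp_continuous ramp_bounds(2) lim, of 0] b
        unfolding supp f0_def by (simp add: Complex_eq)
      show "cmod (f0 r) \<le> ramp J 1 * (L * M * norm x * 1)" for r
      proof (cases "0 \<le> r")
        case True
        have "cmod (exp (- (of_real b * of_real r)) * \<phi> (T (max 0 r) x)) \<le> (L * M * norm x) * exp (- ((b - w) * r))"
          using decay[OF True, of "of_real b" x] by simp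
        also have "\<dots> \<le> (L * M * norm x) * 1" using b True L M_nonneg by (intro mult_left_mono) auto
        finally show ?thesis unfolding f0_def mult.assoc norm_mult[of "of_real _"]
          using ramp_bounds(2)[of J r] ramp_bounds(1)[of J 1] by (intro mult_mono) auto
      next
        case False
        then show ?thesis using L M_nonneg ramp_bounds(1)[of J 1] by (simp add: f0_def ramp_nonpos)
      qed
      show "integrable lborel (\<lambda>\<xi>. \<phi> (F (Complex b \<xi>)))" by (rule phiFI) (use a in auto)
      fix \<xi>
      have "\<phi> (F (Complex b \<xi>)) = (\<integral>r. of_real (ramp J r) * exp (- (Complex b \<xi> * of_real r)) * \<phi> (T (max 0 r) x) \<partial>lborel)"
        using functional_lap_limit(2)[OF \<phi> _ ramp_continuous ramp_bounds(2) lim, of \<xi>] b unfolding supp by simp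
      also have "\<dots> = (\<integral>r. cis (- (\<xi> * r)) * f0 r \<partial>lborel)"
      proof (rule Bochner_Integration.integral_cong[OF refl])
        fix r :: real
        have "exp (- (Complex b \<xi> * of_real r)) = cis (- (\<xi> * r)) * exp (- (of_real b * of_real r))"
        proof -
          have "exp (- (of_real b * of_real r)) = complex_of_real (exp (- (b * r)))" by (simp flip: exp_of_real)
          moreover have "exp (- (Complex b \<xi> * of_real r)) = of_real (exp (- (b * r))) * cis (- (\<xi> * r))"
            using exp_eq_polar[of "- (Complex b \<xi> * of_real r)"] by simp
          ultimately show ?thesis by (simp only: mult.commute)
        qed
        then show "of_real (ramp J r) * exp (- (Complex b \<xi> * of_real r)) * \<phi> (T (max 0 r) x) = cis (- (\<xi> * r)) * f0 r"
          by (simp add: f0_def)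
      qed
      finally show "\<phi> (F (Complex b \<xi>)) = (\<integral>r. cis (- (\<xi> * r)) * f0 r \<partial>lborel)" .
    qed
    have "\<phi> (integral UNIV (\<lambda>\<xi>. cis (\<xi> * s) *\<^sub>C F (Complex a \<xi>))) = (\<integral>\<xi>. cis (\<xi> * s) * \<phi> (F (Complex a \<xi>)) \<partial>lborel)"
    proof -
      have "((\<lambda>\<xi>. \<phi> (cis (\<xi> * s) *\<^sub>C F (Complex a \<xi>))) has_integral \<phi> (integral UNIV (\<lambda>\<xi>. cis (\<xi> * s) *\<^sub>C F (Complex a \<xi>)))) UNIV"
        by (rule has_integral_linear[OF integrable_integral[OF int] \<phi>.bounded_linear_axioms, unfolded o_def])
      then have "((\<lambda>\<xi>. cis (\<xi> * s) * \<phi> (F (Complex a \<xi>))) has_integral \<phi> (integral UNIV (\<lambda>\<xi>. cis (\<xi> * s) *\<^sub>C F (Complex a \<xi>)))) UNIV"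
        by (simp add: bounded_clinear_scaleC[OF \<phi>] scaleC_complex_def)
      then show ?thesis
        using has_integral_integral_lborel[OF cisFI[of a]] a by (intro has_integral_unique) auto
    qed
    also have "\<dots> = of_real (exp (- (a * s))) * (\<integral>\<xi>. f (Complex a \<xi>) \<partial>lborel)"
      unfolding fC integral_mult_right_zero by (simp add: exp_minus)
    also have "\<dots> = of_real (exp (- (a * s))) * (of_real (exp (b * s)) * (2 * pi * f0 s))"
      unfolding shift unfolding fC integral_mult_right_zero inv ..
    also have "\<dots> = (2 * pi * exp (- (a * s)) * ramp J s) *\<^sub>R \<phi> (T s x)"
    proof -
      have "complex_of_real (exp (b * s)) * exp (- (of_real b * of_real s)) = 1"
        by (simp add: exp_of_real[symmetric] exp_minus)
      then have "complex_of_real (exp (b * s)) * (2 * pi * f0 s) = 2 * pi * ramp J s * \<phi> (T s x)"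
        using s by (simp add: f0_def mult_ac)
      then show ?thesis by (simp add: scaleR_conv_of_real)
    qed
    finally show "\<phi> (integral UNIV (\<lambda>\<xi>. cis (\<xi> * s) *\<^sub>C F (Complex a \<xi>)) - (2 * pi * exp (- (a * s)) * ramp J s) *\<^sub>R T s x) = 0"
      by (simp add: \<phi>.diff \<phi>.scaleR)
  qed
  then show ?thesis unfolding F_def by simp
qed

end

section \<open>The growth estimate for a semigroup with known resolvents\<close>

context resolvent_semigroup
begin

text \<open>Fourier type is used twice, for the compactly supported pieces \<open>G i\<close> of the orbit and for the product \<open>F\<close>. The hypothesis \<open>t \<ge> max 2 (1 / b)\<close> places the window \<open>{t - 1..t}\<close> where the
ramp is constant, and the line \<open>Re z = 1 / t\<close> to the left of \<open>b\<close>. The constant depends on \<open>y\<close> only through the bound \<open>L\<close>,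
and not on how \<open>y\<close> is represented as a square of the resolvent.\<close>
lemma smooth_estimate:
  assumes p: "1 \<le> p" "p \<le> 2" and CF: "0 \<le> CF"
    and ft: "\<And>f :: real \<Rightarrow> 'a. f \<in> Lq_space 1 \<Longrightarrow> f \<in> Lq_space (ereal p) \<Longrightarrow>
        fourier_transform f \<in> Lq_space (hoelder_conj p) \<and> Lq_norm (hoelder_conj p) (fourier_transform f) \<le> CF * Lq_norm (ereal p) f"
    and b: "w < b" "b < \<omega>" and th: "0 \<le> \<theta>" "\<theta> < 1"
    and \<gamma>: "1 / ereal p - 1 / hoelder_conj p < ereal (real n + \<theta>) \<or> p = 2 \<and> real n + \<theta> = 0"
  shows "\<exists>C\<ge>0. \<forall>t y. max 2 (1 / b) \<le> t \<longrightarrow> 0 \<le> g t \<longrightarrow> norm (R (of_real \<omega>) (R (of_real \<omega>) y)) \<le> L \<longrightarrow>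
      norm (T t (res_power \<omega> n \<theta> (R (of_real \<omega>) (R (of_real \<omega>) y)))) \<le> C * g t"
proof -
  have \<omega>: "w < \<omega>" and b0: "0 < b" and \<omega>0: "0 < Re (complex_of_real \<omega>)" using b w_nonneg by auto
  \<comment> \<open>\<open>bump J i\<close> has to vanish at both ends for \<open>i \<le> Suc n\<close>, and \<open>smooth_orbit_decay\<close> asks for \<open>2 \<le> J\<close>\<close>
  define J where "J = n + 3"
  have "\<exists>B. 0 \<le> B \<and> (\<forall>s\<in>{0..1}. \<bar>bump J i s\<bar> \<le> B)" for i by (metis bump_bounded)
  then obtain B where B: "\<And>i. 0 \<le> B i" "\<And>i s. s \<in> {0..1} \<Longrightarrow> \<bar>bump J i s\<bar> \<le> B i" by metis
  define L' where "L' = (\<Sum>i\<le>Suc n. CF * (B i * (M * exp w * \<bar>L\<bar>)))"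
  obtain K where K: "0 \<le> K" and hK: "\<And>G :: real \<Rightarrow> 'a. G \<in> Lq_space (hoelder_conj p) \<Longrightarrow> Lq_norm (hoelder_conj p) G \<le> L' \<Longrightarrow>
      integrable lborel (\<lambda>x. ((1 + \<bar>x\<bar>) powr - (real n + \<theta>) * norm (G x)) powr p) \<and>
      (\<integral>x. ((1 + \<bar>x\<bar>) powr - (real n + \<theta>) * norm (G x)) powr p \<partial>lborel) \<le> K"
    using weighted_Lq_imp_Lp[where L=L', OF p \<gamma>] by blast
  obtain D where D: "0 \<le> D" and hD: "\<And>j z y. j + n \<le> J \<Longrightarrow> 0 < Re z \<Longrightarrow> Re z \<le> b \<Longrightarrow>
    norm (lap 1 (bump J j) z (res_power \<omega> n \<theta> y)) \<le> D * (1 + \<bar>Im z\<bar>) powr - (real n + \<theta>) * (\<Sum>i\<le>Suc n. norm (lap 1 (bump J (j + i)) z y))"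
    using lap_res_power_decay[where \<psi>="bump J" and \<theta>=\<theta> and n=n and J=J, OF b(2) \<omega> th bump_has_derivative bump_ends]
    by blast
  define N where "N = real (Suc (Suc n))"
  \<comment> \<open>the summand 1 only makes \<open>M1\<close> positive\<close>
  define M1 where "M1 = M * exp w + 1"
  define \<beta> where "\<beta> = ramp J 1"
  have M1: "0 < M1" using M_nonneg by (simp add: M1_def add_nonneg_pos)
  have \<beta>: "0 < \<beta>" unfolding \<beta>_def by (rule ramp_pos)
  define c where "c = 2 * pi * exp (- 1) * \<beta> / M1"
  have c: "0 < c" using M1 \<beta> by (simp add: c_def)
  define E where "E = D * N * (N * K) powr (1 / p)"
  have E: "0 \<le> E" using D by (simp add: E_def N_def)
  show ?thesis
  proof (intro exI[of _ "CF * E / c"] conjI allI impI)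
    show "0 \<le> CF * E / c" using CF E c by simp
    fix t y0 assume t: "max 2 (1 / b) \<le> t" and gt: "0 \<le> g t" and L: "norm (R (of_real \<omega>) (R (of_real \<omega>) y0)) \<le> L"
    define y where "y = R (of_real \<omega>) (R (of_real \<omega>) y0)"
    define x where "x = res_power \<omega> n \<theta> y"
    define a where "a = 1 / t"
    have t0: "2 \<le> t" "1 / b \<le> t" using t by auto
    have a: "0 < a" "a \<le> b" using t0 b0 by (auto simp: a_def field_simps)
    have ga: "g (inverse a) = g t" by (simp add: a_def)
    have x: "x = R (of_real \<omega>) (R (of_real \<omega>) (res_power \<omega> n \<theta> y0))"
    proof -
      have "R (of_real \<omega>) (res_power \<omega> n \<theta> u) = res_power \<omega> n \<theta> (R (of_real \<omega>) u)" for u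
        by (rule res_power_commute[OF \<omega> th R_linear[OF \<omega>0]]) (rule R_commute, use \<omega>0 in auto)
      then show ?thesis unfolding x_def y_def by simp
    qed
    define G where "G i \<xi> = lap 1 (bump J i) (Complex a \<xi>) y" for i \<xi>
    define F where "F \<xi> = R (Complex a \<xi>) (lap 1 (bump J 0) (Complex a \<xi>) x)" for \<xi>
    define A where "A i \<xi> = (1 + \<bar>\<xi>\<bar>) powr - (real n + \<theta>) * norm (G i \<xi>)" for i \<xi>
    have G: "G i \<in> Lq_space (hoelder_conj p)" "Lq_norm (hoelder_conj p) (G i) \<le> L'" if i: "i \<le> Suc n" for i
    proof -
      have e: "bump J i 0 = 0" "bump J i 1 = 0" using bump_ends[of i J] i by (simp_all add: J_def)
      note * = lap_Fourier_bound[OF p(1) CF ft less_imp_le[OF a(1)] bump_continuous e B(2), where y=y, folded G_def]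
      show "G i \<in> Lq_space (hoelder_conj p)" by (rule *(1)) auto
      have "Lq_norm (hoelder_conj p) (G i) \<le> CF * (B i * (M * exp w * norm y))" by (rule *(2)) auto
      also have "\<dots> \<le> CF * (B i * (M * exp w * \<bar>L\<bar>))"
        using L CF B M_nonneg unfolding y_def[symmetric] by (intro mult_left_mono) auto
      also have "\<dots> \<le> L'" unfolding L'_def
        by (rule member_le_sum[of i "{..Suc n}" "\<lambda>i. CF * (B i * (M * exp w * \<bar>L\<bar>))"]) (use i CF B M_nonneg in auto)
      finally show "Lq_norm (hoelder_conj p) (G i) \<le> L'" .
    qed
    have A: "integrable lborel (\<lambda>\<xi>. A i \<xi> powr p)" "(\<integral>\<xi>. A i \<xi> powr p \<partial>lborel) \<le> K" if "i \<le> Suc n" for i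
      using hK[OF G[OF that]] unfolding A_def by blast+
    have F_le: "norm (F \<xi>) \<le> g t * D * (\<Sum>i\<le>Suc n. A i \<xi>)" for \<xi>
    proof -
      have "norm (F \<xi>) \<le> g t * norm (lap 1 (bump J 0) (Complex a \<xi>) x)"
        unfolding F_def ga[symmetric] by (rule R_bound_right) (use a in auto)
      also have "\<dots> \<le> g t * (D * (1 + \<bar>\<xi>\<bar>) powr - (real n + \<theta>) * (\<Sum>i\<le>Suc n. norm (G i \<xi>)))"
        using hD[of 0 "Complex a \<xi>" y] a gt unfolding x_def G_def J_def by (intro mult_left_mono) auto
      finally show ?thesis by (simp only: A_def sum_distrib_left[symmetric] mult.assoc)
    qed
    define Q where "Q \<xi> = (g t * D * N) powr p * (\<Sum>i\<le>Suc n. A i \<xi> powr p)" for \<xi>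
    have F_Q: "norm (F \<xi>) powr p \<le> Q \<xi>" for \<xi>
    proof -
      have "norm (F \<xi>) powr p \<le> (g t * D * (\<Sum>i\<le>Suc n. A i \<xi>)) powr p"
        using F_le p by (intro powr_mono2) auto
      also have "\<dots> = (g t * D) powr p * (\<Sum>i\<le>Suc n. A i \<xi>) powr p" by (rule powr_mult)
      also have "\<dots> \<le> (g t * D) powr p * (N powr p * (\<Sum>i\<le>Suc n. A i \<xi> powr p))"
        unfolding N_def by (intro mult_left_mono sum_powr_le) (use p in \<open>auto simp: A_def\<close>)
      also have "\<dots> = Q \<xi>" unfolding Q_def by (simp add: powr_mult)
      finally show ?thesis .
    qed
    have Q: "integrable lborel Q" unfolding Q_def
      by (intro integrable_mult_right Bochner_Integration.integrable_sum A) auto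
    have Q_le: "(\<integral>\<xi>. Q \<xi> \<partial>lborel) \<le> (g t * D * N) powr p * (N * K)"
    proof -
      have "(\<integral>\<xi>. Q \<xi> \<partial>lborel) = (g t * D * N) powr p * (\<Sum>i\<le>Suc n. (\<integral>\<xi>. A i \<xi> powr p \<partial>lborel))"
        unfolding Q_def integral_mult_right_zero by (subst Bochner_Integration.integral_sum) (use A in auto)
      also have "\<dots> \<le> (g t * D * N) powr p * (\<Sum>i\<le>Suc n. K)" by (intro mult_left_mono sum_mono A) auto
      also have "(\<Sum>i\<le>Suc n. K) = N * K" by (simp add: N_def)
      finally show ?thesis .
    qed
    have Fc: "continuous_on UNIV F" unfolding F_def by (rule inversion_line_continuous[OF a(1)])
    have Fp: "F \<in> Lq_space (ereal p)" by (rule Lq_space_continuous[OF Fc Q F_Q])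
    have Fp_norm: "Lq_norm (ereal p) F \<le> E * g t"
    proof -
      have "(\<integral>\<xi>. norm (F \<xi>) powr p \<partial>lborel) \<le> (g t * D * N) powr p * (N * K)"
        using integral_mono[OF _ Q F_Q] Fp Q_le by (fastforce simp: Lq_space_def)
      then have "Lq_norm (ereal p) F \<le> ((g t * D * N) powr p * (N * K)) powr (1 / p)"
        unfolding Lq_norm_def using p by (auto intro!: powr_mono2)
      also have "\<dots> = E * g t"
        using p gt D K by (simp add: powr_mult powr_powr E_def N_def)
      finally show ?thesis .
    qed
    have F1: "F \<in> Lq_space 1"
    proof -
      obtain C where C: "0 \<le> C" and hC: "\<And>z. 0 < Re z \<Longrightarrow> Re z \<le> b \<Longrightarrow> norm (lap 1 (bump J 0) z x) \<le> C * (1 + \<bar>Im z\<bar>) powr - 2"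
        using smooth_orbit_decay[OF b(2) \<omega>, of J "res_power \<omega> n \<theta> y0"] unfolding x by (auto simp: J_def)
      have "F \<in> Lq_space (ereal 1)"
      proof (rule Lq_space_continuous[OF Fc])
        show "integrable lborel (\<lambda>\<xi>. g t * C * (1 + \<bar>\<xi>\<bar>) powr - 2)"
          by (intro integrable_mult_right integrable_one_plus_abs_powr) simp
        show "norm (F \<xi>) powr 1 \<le> g t * C * (1 + \<bar>\<xi>\<bar>) powr - 2" for \<xi>
        proof -
          have "norm (F \<xi>) \<le> g t * norm (lap 1 (bump J 0) (Complex a \<xi>) x)"
            unfolding F_def ga[symmetric] by (rule R_bound_right) (use a in auto)
          also have "\<dots> \<le> g t * (C * (1 + \<bar>\<xi>\<bar>) powr - 2)"
            using hC[of "Complex a \<xi>"] a gt by (intro mult_left_mono) auto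
          finally show ?thesis by simp
        qed
      qed
      then show ?thesis by (simp add: one_ereal_def)
    qed
    \<comment> \<open>the Fourier transform of \<open>F\<close> is the inverse transform reflected at 0, hence the sign of \<open>s\<close>\<close>
    have FT: "fourier_transform F (- s) = (2 * pi * exp (- (a * s)) * ramp J s) *\<^sub>R T s x" if "0 \<le> s" for s
      using inversion_formula[OF a b _ that x, of J] unfolding fourier_transform_def F_def by (simp add: J_def mult.commute)
    have "c * norm (T t x) \<le> Lq_norm (hoelder_conj p) (fourier_transform F)"
    proof (rule Lq_norm_ge_on_unit_interval[where c="- t"])
      show "fourier_transform F \<in> Lq_space (hoelder_conj p)" using ft[OF F1 Fp] by blast
      show "hoelder_conj p = \<infinity> \<or> (\<exists>r>0. hoelder_conj p = ereal r)" by (rule hoelder_conj_cases[OF p(1)])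
      show "0 \<le> c * norm (T t x)" using c by simp
      fix \<sigma> assume "\<sigma> \<in> {- t..- t + 1}"
      then obtain s where s: "\<sigma> = - s" "t - 1 \<le> s" "s \<le> t" by (intro that[of "- \<sigma>"]) auto
      have s1: "1 \<le> s" using s t0 by simp
      have "T t x = T (t - s) (T s x)" using T_add[of "t - s" s x] s s1 by simp
      then have "norm (T t x) \<le> M * exp (w * 1) * norm (T s x)" using growth_upto[of "t - s" 1 "T s x"] s by simp
      also have "\<dots> \<le> M1 * norm (T s x)" unfolding M1_def by (intro mult_right_mono) auto
      finally have 1: "norm (T t x) / M1 \<le> norm (T s x)" using M1 by (simp add: divide_le_eq mult.commute)
      have 2: "exp (- 1) \<le> exp (- (a * s))" using s t0 by (simp add: a_def)
      have "c * norm (T t x) = 2 * pi * exp (- 1) * \<beta> * (norm (T t x) / M1)" by (simp add: c_def)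
      also have "\<dots> \<le> 2 * pi * exp (- (a * s)) * \<beta> * norm (T s x)"
        using 1 2 \<beta> M1 by (intro mult_mono) auto
      also have "\<dots> = norm (fourier_transform F \<sigma>)"
        using FT[of s] s1 s \<beta> ramp_eventually_const[OF s1, of J] by (simp add: \<beta>_def abs_mult)
      finally show "c * norm (T t x) \<le> norm (fourier_transform F \<sigma>)" .
    qed
    also have "\<dots> \<le> CF * Lq_norm (ereal p) F" using ft[OF F1 Fp] by blast
    also have "\<dots> \<le> CF * (E * g t)" by (rule mult_left_mono[OF Fp_norm CF])
    finally have "norm (T t x) \<le> CF * E / c * g t" using c by (simp add: field_simps)
    then show "norm (T t (res_power \<omega> n \<theta> (R (of_real \<omega>) (R (of_real \<omega>) y0)))) \<le> CF * E / c * g t"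
      unfolding x_def y_def .
  qed
qed

text \<open>The mean of the orbit over \<open>{0..h}\<close> lies in the range of the resolvent by integration by parts with weight 1, and it tends
to \<open>y\<close> as \<open>h\<close> tends to 0.\<close>
lemma range_resolvent_dense:
  assumes \<mu>: "0 < Re \<mu>" and e: "0 < e"
  shows "\<exists>z. norm (R \<mu> z - y) < e"
proof -
  obtain d where d: "0 < d" and hd: "\<And>h. 0 < h \<Longrightarrow> h < d \<Longrightarrow> dist (T h y) y < e / 2"
    using tendstoD[OF T_tendsto_0[of y], of "e / 2"] e unfolding eventually_at_right_field by auto
  define h where "h = d / 2"
  have h: "0 < h" "h < d" using d by (simp_all add: h_def)
  define I where "I = integral {0..h} (\<lambda>s. 1 *\<^sub>C T s y)"
  have "I = R \<mu> (\<mu> *\<^sub>C I + integral {0..h} (\<lambda>s. 0 *\<^sub>C T s y) - 1 *\<^sub>C T h y + 1 *\<^sub>C y)"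
    unfolding I_def by (rule orbit_integration_by_parts[OF _ \<mu>]) (use h in \<open>auto intro!: derivative_eq_intros\<close>)
  then obtain u where u: "I = R \<mu> u" by blast
  have "((\<lambda>s. 1 *\<^sub>C T s y - y) has_integral (I - h *\<^sub>R y)) {0..h}"
    using has_integral_diff[OF integrable_integral[OF weighted_orbit_integrable[of h "\<lambda>_. 1" y]] has_integral_const_real[of y 0 h]] h
    by (simp add: I_def)
  moreover have "norm (1 *\<^sub>C T s y - y) \<le> e / 2" if "s \<in> {0..h}" for s
  proof (cases "s = 0")
    case False
    then show ?thesis using hd[of s] that h by (simp add: scaleC_one dist_norm)
  qed (use e in \<open>simp add: scaleC_one\<close>)
  ultimately have "norm (I - h *\<^sub>R y) \<le> e / 2 * Henstock_Kurzweil_Integration.content (cbox 0 h)"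
    by (intro has_integral_bound[where f="\<lambda>s. 1 *\<^sub>C T s y - y"]) (use e in auto)
  then have "norm (I - h *\<^sub>R y) \<le> e / 2 * h" using h by simp
  then have "(1 / h) * norm (I - h *\<^sub>R y) \<le> e / 2" using h by (simp add: field_simps)
  then have "norm ((1 / h) *\<^sub>R (I - h *\<^sub>R y)) \<le> e / 2" using h by simp
  moreover have "(1 / h) *\<^sub>R (I - h *\<^sub>R y) = R \<mu> ((1 / h) *\<^sub>R u) - y"
    using h u \<mu> by (simp add: scaleR_diff_right R_scaleR)
  ultimately have "norm (R \<mu> ((1 / h) *\<^sub>R u) - y) \<le> e / 2" by simp
  then show ?thesis using e by (intro exI[of _ "(1 / h) *\<^sub>R u"]) simp
qed

lemma range_resolvent_square_dense:
  assumes \<mu>: "0 < Re \<mu>" and e: "0 < e"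
  shows "\<exists>z. norm (R \<mu> (R \<mu> z) - y) < e"
proof -
  define \<kappa> where "\<kappa> = \<bar>g (inverse (Re \<mu>))\<bar> + 1"
  have \<kappa>: "0 < \<kappa>" by (simp add: \<kappa>_def)
  obtain u where u: "norm (R \<mu> u - y) < e / 2" using range_resolvent_dense[OF \<mu>, of "e / 2" y] e by auto
  obtain z where z: "norm (R \<mu> z - u) < e / 2 / \<kappa>" using range_resolvent_dense[OF \<mu>, of "e / 2 / \<kappa>" u] e \<kappa> by auto
  have "norm (R \<mu> (R \<mu> z - u)) \<le> \<kappa> * norm (R \<mu> z - u)"
    by (rule order_trans[OF R_bound[OF \<mu>]]) (intro mult_right_mono, auto simp: \<kappa>_def)
  also have "\<dots> \<le> e / 2" using z \<kappa> by (simp add: field_simps)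
  finally have "norm (R \<mu> (R \<mu> z) - R \<mu> u) \<le> e / 2" using \<mu> by (simp add: R_diff)
  then have "norm (R \<mu> (R \<mu> z) - y) < e" using u norm_triangle_ineq[of "R \<mu> (R \<mu> z) - R \<mu> u" "R \<mu> u - y"] by simp
  then show ?thesis by blast
qed

text \<open>For large \<open>t\<close>, approximate \<open>y\<close> by vectors in the range of the squared resolvent, of norm at most 2. For small \<open>t\<close> the
semigroup is bounded, which is what the summand 1 in \<open>g t + 1\<close> pays for.\<close>
lemma main_estimate:
  assumes p: "1 \<le> p" "p \<le> 2" and CF: "0 \<le> CF"
    and ft: "\<And>f :: real \<Rightarrow> 'a. f \<in> Lq_space 1 \<Longrightarrow> f \<in> Lq_space (ereal p) \<Longrightarrow>
        fourier_transform f \<in> Lq_space (hoelder_conj p) \<and> Lq_norm (hoelder_conj p) (fourier_transform f) \<le> CF * Lq_norm (ereal p) f"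
    and \<omega>: "w < \<omega>" and th: "0 \<le> \<theta>" "\<theta> < 1" and g_pos: "\<And>t. 0 < t \<Longrightarrow> 0 < g t"
    and \<gamma>: "1 / ereal p - 1 / hoelder_conj p < ereal (real n + \<theta>) \<or> p = 2 \<and> real n + \<theta> = 0"
  shows "\<exists>C\<ge>0. \<forall>t>0. \<forall>y. norm y \<le> 1 \<longrightarrow> norm (T t (res_power \<omega> n \<theta> y)) \<le> C * (g t + 1)"
proof -
  obtain b where b: "w < b" "b < \<omega>" using dense[OF \<omega>] by blast
  have \<omega>0: "0 < Re (complex_of_real \<omega>)" using \<omega> w_nonneg by simp
  have lin: "bounded_linear (res_power \<omega> n \<theta>)" by (rule res_power_bounded_linear[OF \<omega> th])
  obtain C1 where C1: "0 \<le> C1" and hC1: "\<And>t y. max 2 (1 / b) \<le> t \<Longrightarrow> 0 \<le> g t \<Longrightarrow> norm (R (of_real \<omega>) (R (of_real \<omega>) y)) \<le> 2 \<Longrightarrow>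
      norm (T t (res_power \<omega> n \<theta> (R (of_real \<omega>) (R (of_real \<omega>) y)))) \<le> C1 * g t"
    using smooth_estimate[OF p CF ft b th \<gamma>, of 2] by blast
  define t0 where "t0 = max 2 (1 / b)"
  define C2 where "C2 = M * exp (w * t0) * onorm (res_power \<omega> n \<theta>)"
  have C2: "0 \<le> C2" using M_nonneg onorm_pos_le[OF lin] by (simp add: C2_def)
  show ?thesis
  proof (intro exI[of _ "C1 + C2"] conjI allI impI)
    fix t :: real and y :: 'a assume t: "0 < t" and y: "norm y \<le> 1"
    show "norm (T t (res_power \<omega> n \<theta> y)) \<le> (C1 + C2) * (g t + 1)"
    proof (cases "t0 \<le> t")
      case True
      have "\<exists>z. norm (R (of_real \<omega>) (R (of_real \<omega>) z) - y) < 1 / real (Suc k)" for k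
        by (rule range_resolvent_square_dense[OF \<omega>0]) simp
      then obtain z where z: "\<And>k. norm (R (of_real \<omega>) (R (of_real \<omega>) (z k)) - y) < 1 / real (Suc k)" by metis
      define v where "v k = R (of_real \<omega>) (R (of_real \<omega>) (z k))" for k
      have "(\<lambda>k. v k - y) \<longlonglongrightarrow> 0"
        by (rule Lim_null_comparison[OF _ LIMSEQ_Suc[OF lim_1_over_n]])
          (use z in \<open>auto simp: v_def intro!: always_eventually less_imp_le\<close>)
      then have v: "v \<longlonglongrightarrow> y" by (rule LIM_zero_cancel)
      have "norm (v k) \<le> 2" for k
      proof -
        have "norm (v k) \<le> norm (v k - y) + norm y" using norm_triangle_ineq[of "v k - y" y] by simp
        also have "norm (v k - y) \<le> 1 / real (Suc k)" using z[of k] by (simp add: v_def)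
        also have "\<dots> \<le> 1" by simp
        finally show ?thesis using y by simp
      qed
      then have "norm (T t (res_power \<omega> n \<theta> (v k))) \<le> C1 * g t" for k
        using hC1[of t "z k"] True g_pos[OF t] by (simp add: v_def t0_def)
      moreover have "(\<lambda>k. norm (T t (res_power \<omega> n \<theta> (v k)))) \<longlonglongrightarrow> norm (T t (res_power \<omega> n \<theta> y))"
        using t by (intro tendsto_norm bounded_linear.tendsto[OF T_linear] bounded_linear.tendsto[OF lin] v) simp
      ultimately have "norm (T t (res_power \<omega> n \<theta> y)) \<le> C1 * g t"
        by (intro LIMSEQ_le_const2) auto
      also have "\<dots> \<le> (C1 + C2) * (g t + 1)" using C1 C2 g_pos[OF t] by (intro mult_mono) auto
      finally show ?thesis .
    next
      case False
      have "norm (T t (res_power \<omega> n \<theta> y)) \<le> M * exp (w * t0) * norm (res_power \<omega> n \<theta> y)"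
        by (rule growth_upto) (use t False in auto)
      also have "\<dots> \<le> M * exp (w * t0) * (onorm (res_power \<omega> n \<theta>) * 1)"
        using order_trans[OF onorm[OF lin, of y] mult_left_mono[OF y onorm_pos_le[OF lin]]] M_nonneg
        by (intro mult_left_mono) auto
      also have "\<dots> \<le> C2 * 1" by (simp add: C2_def)
      also have "\<dots> \<le> (C1 + C2) * (g t + 1)" using C1 C2 g_pos[OF t] by (intro mult_mono) auto
      finally show ?thesis .
    qed
  qed (use C1 C2 in simp)
qed

end

section \<open>Growth of the semigroup on fractional domains\<close>

lemma op_shift_op_shift: "op_shift \<mu> (op_shift \<nu> A) = op_shift (\<nu> + \<mu>) A"
  unfolding op_shift_def by (auto simp: scaleC_add_left algebra_simps)

lemma mem_op_neg: "(x, y) \<in> op_neg A \<longleftrightarrow> (x, - y) \<in> A"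
  unfolding op_neg_def by (auto intro: exI[of _ "- y"])

lemma mem_op_shift: "(x, y) \<in> op_shift \<mu> A \<longleftrightarrow> (x, y - \<mu> *\<^sub>C x) \<in> A"
  unfolding op_shift_def by (auto intro!: exI[of _ "y - \<mu> *\<^sub>C x"])

text \<open>The resolvent set is defined with \<open>\<mu> - A\<close>; for \<open>\<mu> = - z\<close> the inverse of \<open>z + A\<close> is minus the inverse of \<open>\<mu> - A\<close>.\<close>
lemma op_inv_op_shift:
  fixes A :: "'a::complex_banach operator"
  assumes gen: "op_neg A = generator T" and z: "- z \<in> op_resolvent_set A"
  shows "bounded_clinear (op_inv (op_shift z A))"
    and "(x, y) \<in> generator T \<longleftrightarrow> x = op_inv (op_shift z A) (z *\<^sub>C x - y)"
proof -
  obtain S where S: "bounded_clinear S" and iff: "\<And>x y. (x, y) \<in> op_shift (- z) (op_neg A) \<longleftrightarrow> x = S y"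
    using z unfolding op_resolvent_set_def boundedly_invertible_def by auto
  have gen_iff: "(x, y) \<in> generator T \<longleftrightarrow> x = S (y - z *\<^sub>C x)" for x y
    using iff[of x "y - z *\<^sub>C x"] unfolding mem_op_shift gen by (simp add: scaleC.minus_left)
  have inv: "op_inv (op_shift z A) u = - S u" for u
  proof -
    have "(x, u) \<in> op_shift z A \<longleftrightarrow> x = - S u" for x
    proof -
      have "(x, u) \<in> op_shift z A \<longleftrightarrow> (x, z *\<^sub>C x - u) \<in> generator T"
        unfolding mem_op_shift gen[symmetric] mem_op_neg by simp
      also have "\<dots> \<longleftrightarrow> x = S (- u)" by (simp add: gen_iff)
      also have "S (- u) = - S u" using S by (simp add: bounded_clinear_def linear_neg bounded_linear.linear)
      finally show ?thesis .
    qed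
    then show ?thesis unfolding op_inv_def by simp
  qed
  show "bounded_clinear (op_inv (op_shift z A))"
    using S unfolding inv[abs_def] bounded_clinear_def by (auto intro: bounded_linear_minus simp: scaleC.minus_right)
  show "(x, y) \<in> generator T \<longleftrightarrow> x = op_inv (op_shift z A) (z *\<^sub>C x - y)"
    using S unfolding inv gen_iff bounded_clinear_def
    by (metis bounded_linear.linear linear_neg minus_diff_eq)
qed

lemma growth_boundD:
  assumes T: "C0_semigroup T" and w: "growth_bound T < ereal \<omega>"
  obtains M w where "0 \<le> M" "w < \<omega>" "\<And>t x. 0 \<le> t \<Longrightarrow> norm (T t x) \<le> M * exp (w * t) * norm x"
proof -
  obtain w M where "w < \<omega>" and M: "\<And>t. 0 \<le> t \<Longrightarrow> onorm (T t) \<le> M * exp (w * t)"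
    using w unfolding growth_bound_def INF_less_iff by auto
  moreover have "norm (T t x) \<le> \<bar>M\<bar> * exp (w * t) * norm x" if t: "0 \<le> t" for t x
  proof -
    have "bounded_linear (T t)" using T t by (simp add: C0_semigroup_def bounded_clinear_def)
    then have "norm (T t x) \<le> onorm (T t) * norm x" by (rule onorm)
    also have "\<dots> \<le> M * exp (w * t) * norm x" by (intro mult_right_mono M t) simp
    also have "\<dots> \<le> \<bar>M\<bar> * exp (w * t) * norm x" by (intro mult_right_mono) auto
    finally show ?thesis .
  qed
  ultimately show ?thesis using that[of "\<bar>M\<bar>" w] by simp
qed

lemma hoelder_gap_nonneg:
  assumes "1 \<le> p" "p \<le> 2"
  shows "0 \<le> 1 / ereal p - 1 / hoelder_conj p"
proof (cases "p = 1")
  case True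
  then show ?thesis using inverse_ereal_eq[of 1] by (simp add: hoelder_conj_def)
next
  case False
  then have "1 / ereal p - 1 / hoelder_conj p = ereal (1 / p - 1 / (p / (p - 1)))"
    using assms inverse_ereal_eq[of p] inverse_ereal_eq[of "p / (p - 1)"] by (simp add: hoelder_conj_def)
  moreover have "0 \<le> 1 / p - 1 / (p / (p - 1))" using assms by (simp add: field_simps)
  ultimately show ?thesis by simp
qed

lemma has_fourier_typeE:
  assumes "has_fourier_type TYPE('a::complex_banach) p"
  obtains C where "0 \<le> C" "\<And>f :: real \<Rightarrow> 'a. f \<in> Lq_space 1 \<Longrightarrow> f \<in> Lq_space (ereal p) \<Longrightarrow>
        fourier_transform f \<in> Lq_space (hoelder_conj p) \<and> Lq_norm (hoelder_conj p) (fourier_transform f) \<le> C * Lq_norm (ereal p) f"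
proof -
  obtain C where C: "\<And>f :: real \<Rightarrow> 'a. f \<in> Lq_space 1 \<Longrightarrow> f \<in> Lq_space (ereal p) \<Longrightarrow>
        fourier_transform f \<in> Lq_space (hoelder_conj p) \<and> Lq_norm (hoelder_conj p) (fourier_transform f) \<le> C * Lq_norm (ereal p) f"
    using assms unfolding has_fourier_type_def by blast
  show ?thesis
  proof (rule that[of "\<bar>C\<bar>"])
    fix f :: "real \<Rightarrow> 'a" assume f: "f \<in> Lq_space 1" "f \<in> Lq_space (ereal p)"
    have "C * Lq_norm (ereal p) f \<le> \<bar>C\<bar> * Lq_norm (ereal p) f"
      by (intro mult_right_mono Lq_norm_nonneg f) simp
    then show "fourier_transform f \<in> Lq_space (hoelder_conj p) \<and> Lq_norm (hoelder_conj p) (fourier_transform f) \<le> \<bar>C\<bar> * Lq_norm (ereal p) f"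
      using C[OF f] by linarith
  qed simp
qed

lemma graph_onorm_le:
  assumes "\<And>x. x \<in> Domain B \<Longrightarrow> graph_norm B x \<le> 1 \<Longrightarrow> norm (S x) \<le> C"
  shows "graph_onorm B S \<le> ennreal C"
  unfolding graph_onorm_def using assms by (intro SUP_least ennreal_leI) auto

theorem proposition3p9:
  fixes A :: "'a::complex_banach operator"
    and T :: "real \<Rightarrow> 'a \<Rightarrow> 'a"
    and p \<omega> :: real
    and g :: "real \<Rightarrow> real"
  assumes nonzero_space: "\<exists>x::'a. x \<noteq> 0"
    and semigroup: "C0_semigroup T"
    and gen: "op_neg A = generator T"
    and p_range: "1 \<le> p" "p \<le> 2"
    and fourier_type: "has_fourier_type TYPE('a) p"
    and left_half_plane: "{z. Re z < 0} \<subseteq> op_resolvent_set A"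
    and g_pos: "\<And>t. 0 < t \<Longrightarrow> 0 < g t"
    and g_mono: "mono_on {0<..} g"
    and resolvent_bound: "\<And>z. 0 < Re z \<Longrightarrow> onorm (op_inv (op_shift z A)) \<le> g (inverse (Re z))"
    and omega: "growth_bound T < ereal \<omega>"
  shows "\<forall>\<gamma>. 1 / ereal p - 1 / hoelder_conj p < ereal \<gamma> \<or> p = 2 \<and> \<gamma> = 0 \<longrightarrow>
           (\<exists>C\<ge>0. \<forall>t>0. graph_onorm (frac_power (op_shift (complex_of_real \<omega>) A) \<gamma>) (T t)
                          \<le> ennreal (C * (g t + 1)))"
proof (intro allI impI)
  fix \<gamma> assume \<gamma>: "1 / ereal p - 1 / hoelder_conj p < ereal \<gamma> \<or> p = 2 \<and> \<gamma> = 0"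
  obtain M w where M: "0 \<le> M" and w: "w < \<omega>" and growth: "\<And>t x. 0 \<le> t \<Longrightarrow> norm (T t x) \<le> M * exp (w * t) * norm x"
    using growth_boundD[OF semigroup omega] by blast
  define B where "B = op_shift (complex_of_real \<omega>) A"
  show "\<exists>C\<ge>0. \<forall>t>0. graph_onorm (frac_power (op_shift (complex_of_real \<omega>) A) \<gamma>) (T t) \<le> ennreal (C * (g t + 1))"
    unfolding B_def[symmetric]
  proof (cases "0 < \<omega>")
    case False
    show "\<exists>C\<ge>0. \<forall>t>0. graph_onorm (frac_power B \<gamma>) (T t) \<le> ennreal (C * (g t + 1))"
    proof (intro exI[of _ M] conjI M allI impI graph_onorm_le)
      fix t :: real and x assume t: "0 < t" and x: "graph_norm (frac_power B \<gamma>) x \<le> 1"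
      have "norm x \<le> graph_norm (frac_power B \<gamma>) x" by (simp add: graph_norm_def)
      then have x1: "norm x \<le> 1" using x by linarith
      have "w * t \<le> 0" using w False t by (intro mult_nonpos_nonneg) auto
      then have "norm (T t x) \<le> M * 1 * 1"
        using t M x1 by (intro order_trans[OF growth] mult_mono) auto
      also have "\<dots> \<le> M * (g t + 1)" using mult_left_mono[OF _ M, of 1 "g t + 1"] g_pos[OF t] by simp
      finally show "norm (T t x) \<le> M * (g t + 1)" .
    qed
  next
    case True
    define R where "R z = op_inv (op_shift z A)" for z
    have res: "- z \<in> op_resolvent_set A" if "0 < Re z" for z using left_half_plane that by auto
    note R_lin = op_inv_op_shift(1)[OF gen res, folded R_def]
    note R_gen = op_inv_op_shift(2)[OF gen res, folded R_def]
    interpret resolvent_semigroup T R M "max w 0" g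
    proof
      show "C0_semigroup T" "0 \<le> M" "0 \<le> max w 0" "mono_on {0<..} g" by (simp_all add: semigroup M g_mono)
      show "norm (T t x) \<le> M * exp (max w 0 * t) * norm x" if "0 \<le> t" for t x
      proof -
        have "w * t \<le> max w 0 * t" using that by (intro mult_right_mono) auto
        then have "M * exp (w * t) * norm x \<le> M * exp (max w 0 * t) * norm x"
          using M by (intro mult_right_mono mult_left_mono) auto
        then show ?thesis using growth[OF that, of x] by linarith
      qed
      fix z :: complex assume z: "0 < Re z"
      show "bounded_clinear (R z)" by (rule R_lin[OF z])
      show "(R z y, z *\<^sub>C R z y - y) \<in> generator T" for y by (subst R_gen[OF z]) simp
      show "R z (z *\<^sub>C x - y) = x" if "(x, y) \<in> generator T" for x y using that R_gen[OF z] by metis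
      show "norm (R z x) \<le> g (inverse (Re z)) * norm x" for x
        by (rule order_trans[OF onorm[OF bounded_clinearD[OF R_lin[OF z]]]])
          (use resolvent_bound[OF z] in \<open>simp add: R_def mult_right_mono\<close>)
    qed
    define n where "n = nat \<lfloor>\<gamma>\<rfloor>"
    define \<theta> where "\<theta> = frac \<gamma>"
    have "0 \<le> \<gamma>" using \<gamma> order_le_less_trans[OF hoelder_gap_nonneg[OF p_range]] by fastforce
    then have \<gamma>_eq: "\<gamma> = real n + \<theta>" by (simp add: n_def \<theta>_def frac_def)
    have th: "0 \<le> \<theta>" "\<theta> < 1" by (simp_all add: \<theta>_def frac_lt_1)
    have \<omega>: "max w 0 < \<omega>" using w True by simp
    have np: "neg_power B \<gamma> y = res_power \<omega> n \<theta> y" for y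
      unfolding neg_power_def balakrishnan_def res_power_def frac_int_def B_def op_shift_op_shift R_def n_def \<theta>_def
      by simp
    have inj: "y = y'" if "neg_power B \<gamma> y = neg_power B \<gamma> y'" for y y'
    proof -
      have "res_power \<omega> n \<theta> (y - y') = 0"
        using that unfolding np by (simp add: linear_diff[OF bounded_linear.linear[OF res_power_bounded_linear[OF \<omega> th]]])
      then show ?thesis using res_power_injective[OF \<omega> th] by fastforce
    qed
    obtain CF where CF: "0 \<le> CF" and ft: "\<And>f :: real \<Rightarrow> 'a. f \<in> Lq_space 1 \<Longrightarrow> f \<in> Lq_space (ereal p) \<Longrightarrow>
        fourier_transform f \<in> Lq_space (hoelder_conj p) \<and> Lq_norm (hoelder_conj p) (fourier_transform f) \<le> CF * Lq_norm (ereal p) f"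
      using has_fourier_typeE[OF fourier_type] by blast
    obtain C where C: "0 \<le> C" and hC: "\<And>t y. 0 < t \<Longrightarrow> norm y \<le> 1 \<Longrightarrow> norm (T t (res_power \<omega> n \<theta> y)) \<le> C * (g t + 1)"
      using main_estimate[OF p_range CF ft \<omega> th g_pos \<gamma>[unfolded \<gamma>_eq]] by blast
    show "\<exists>C\<ge>0. \<forall>t>0. graph_onorm (frac_power B \<gamma>) (T t) \<le> ennreal (C * (g t + 1))"
    proof (intro exI[of _ C] conjI C allI impI graph_onorm_le)
      fix t :: real and x assume t: "0 < t" and dom: "x \<in> Domain (frac_power B \<gamma>)" and x: "graph_norm (frac_power B \<gamma>) x \<le> 1"
      obtain y where y: "x = neg_power B \<gamma> y" using dom by (auto simp: frac_power_def)
      have "(THE y'. (x, y') \<in> frac_power B \<gamma>) = y"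
        by (rule the_equality) (use y inj in \<open>auto simp: frac_power_def\<close>)
      then have "norm y \<le> graph_norm (frac_power B \<gamma>) x" by (simp add: graph_norm_def)
      then have "norm y \<le> 1" using x by linarith
      then show "norm (T t x) \<le> C * (g t + 1)" using hC[OF t] unfolding y np by blast
    qed
  qed
qed

end
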